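(* Let $A$ be a noetherian normal integral domain and let $D$ be a coaffine divisor class of $X=\operatorname{Spec} A$. Then $D$, regarded as a divisor class on the affine line $X\times\mathbb{A}^1=\operatorname{Spec} A[T]$ (via pull back), is also coaffine. If all hypersurfaces in $\operatorname{Spec} A$ are coaffine, then all hypersurfaces in $\operatorname{Spec} A[T]$ are coaffine.
   Context: On a noetherian, separated, integral, normal scheme $X$, a Weil divisor $D$ (or its class) is called coaffine if for every effective divisor $D'$ linearly equivalent to $D$ the complement $X\setminus\operatorname{supp} D'$ is affine. A hypersurface is a closed subset all of whose irreducible components have codimension one; it is regarded as the corresponding reduced effective Weil divisor. (Thus all hypersurfaces of $\operatorname{Spec} A$ are coaffine if and only if every hypersurface of $\operatorname{Spec} A$ has affine complement.) *)

theory Defs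
  imports
    "HOL-Analysis.Abstract_Topology"
    "HOL-Algebra.Ring_Divisibility"
    "HOL-Algebra.RingHom"
    "HOL-Computational_Algebra.Polynomial"
    "HOL-Computational_Algebra.Fraction_Field"
    "HOL-Decision_Procs.Algebra_Aux"
begin

section \<open>The Zariski topology\<close>

definition spectrum :: "('a, 'm) ring_scheme \<Rightarrow> 'a set set" where
  "spectrum R = {P. primeideal P R}"

definition zero_locus :: "('a, 'm) ring_scheme \<Rightarrow> 'a set \<Rightarrow> 'a set set" where
  "zero_locus R S = {P \<in> spectrum R. S \<subseteq> P}"

definition zariski :: "('a, 'm) ring_scheme \<Rightarrow> 'a set topology" where
  "zariski R = topology (\<lambda>U. \<exists>S \<subseteq> carrier R. U = spectrum R - zero_locus R S)"

lemma zero_locus_Un: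
  assumes "S \<subseteq> carrier R" "T \<subseteq> carrier R"
  shows "zero_locus R S \<union> zero_locus R T
       = zero_locus R {s \<otimes>\<^bsub>R\<^esub> t | s t. s \<in> S \<and> t \<in> T}" (is "?l = zero_locus R ?ST")
proof (intro equalityI subsetI)
  fix P assume P: "P \<in> ?l"
  then interpret primeideal P R by (auto simp: zero_locus_def spectrum_def)
  from P show "P \<in> zero_locus R ?ST"
    using assms I_l_closed I_r_closed by (auto simp: zero_locus_def) blast+
next
  fix P assume P: "P \<in> zero_locus R ?ST"
  then interpret primeideal P R by (auto simp: zero_locus_def spectrum_def)
  have "S \<subseteq> P \<or> T \<subseteq> P"
  proof (rule ccontr)
    assume "\<not> (S \<subseteq> P \<or> T \<subseteq> P)"
    then obtain s t where st: "s \<in> S" "t \<in> T" "s \<notin> P" "t \<notin> P" by blast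
    then have "s \<otimes>\<^bsub>R\<^esub> t \<in> P" using P by (auto simp: zero_locus_def)
    then show False using I_prime[of s t] st assms by blast
  qed
  with P show "P \<in> ?l" by (auto simp: zero_locus_def)
qed

lemma istopology_zariski:
  "istopology (\<lambda>U. \<exists>S \<subseteq> carrier R. U = spectrum R - zero_locus R S)"
  unfolding istopology_def
proof (intro conjI allI impI)
  fix U V
  assume "\<exists>S\<subseteq>carrier R. U = spectrum R - zero_locus R S"
    and "\<exists>S\<subseteq>carrier R. V = spectrum R - zero_locus R S"
  then obtain S T where S: "S \<subseteq> carrier R" "U = spectrum R - zero_locus R S"
    and T: "T \<subseteq> carrier R" "V = spectrum R - zero_locus R T" by blast
  let ?ST = "{s \<otimes>\<^bsub>R\<^esub> t | s t. s \<in> S \<and> t \<in> T}"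
  show "\<exists>S\<subseteq>carrier R. U \<inter> V = spectrum R - zero_locus R S"
  proof (cases "spectrum R = {}")
    case True
    then show ?thesis using S by auto
  next
    case False
    then obtain P where "primeideal P R" by (auto simp: spectrum_def)
    then interpret primeideal P R .
    have "?ST \<subseteq> carrier R" using S(1) T(1) by blast
    moreover have "U \<inter> V = spectrum R - zero_locus R ?ST"
      using zero_locus_Un[OF S(1) T(1)] S(2) T(2) by blast
    ultimately show ?thesis by blast
  qed
next
  fix \<U> assume "\<forall>U\<in>\<U>. \<exists>S\<subseteq>carrier R. U = spectrum R - zero_locus R S"
  then obtain f where f: "\<And>U. U \<in> \<U> \<Longrightarrow> f U \<subseteq> carrier R \<and> U = spectrum R - zero_locus R (f U)"
    by metis
  have "\<Union>\<U> = spectrum R - zero_locus R (\<Union>(f ` \<U>))"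
  proof (intro equalityI subsetI)
    fix P assume "P \<in> \<Union>\<U>"
    then obtain U where "U \<in> \<U>" "P \<in> U" by blast
    then show "P \<in> spectrum R - zero_locus R (\<Union>(f ` \<U>))"
      using f[of U] by (auto simp: zero_locus_def)
  next
    fix P assume P: "P \<in> spectrum R - zero_locus R (\<Union>(f ` \<U>))"
    then obtain U where "U \<in> \<U>" "\<not> f U \<subseteq> P" by (auto simp: zero_locus_def)
    then show "P \<in> \<Union>\<U>" using f[of U] P by (auto simp: zero_locus_def)
  qed
  then show "\<exists>S\<subseteq>carrier R. \<Union>\<U> = spectrum R - zero_locus R S"
    using f by (intro exI[of _ "\<Union>(f ` \<U>)"]) blast
qed

lemma openin_zariski:
  "openin (zariski R) U \<longleftrightarrow> (\<exists>S \<subseteq> carrier R. U = spectrum R - zero_locus R S)"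
  by (simp add: zariski_def istopology_zariski)


section \<open>Affine schemes\<close>

text \<open>
  The element \<open>a/s\<close> of the localization of \<open>R\<close> at the prime \<open>P\<close>, as an equivalence class of pairs.
\<close>
definition fraction :: "('a, 'm) ring_scheme \<Rightarrow> 'a set \<Rightarrow> 'a \<Rightarrow> 'a \<Rightarrow> ('a \<times> 'a) set" where
  "fraction R P a s = {(b, t). b \<in> carrier R \<and> t \<in> carrier R - P \<and>
     (\<exists>u \<in> carrier R - P. u \<otimes>\<^bsub>R\<^esub> (a \<otimes>\<^bsub>R\<^esub> t \<ominus>\<^bsub>R\<^esub> b \<otimes>\<^bsub>R\<^esub> s) = \<zero>\<^bsub>R\<^esub>)}"

definition localization :: "('a, 'm) ring_scheme \<Rightarrow> 'a set \<Rightarrow> ('a \<times> 'a) set ring" where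
  "localization R P = \<lparr>
     carrier = {fraction R P a s | a s. a \<in> carrier R \<and> s \<in> carrier R - P},
     mult = (\<lambda>x y. \<Union>(a, s)\<in>x. \<Union>(b, t)\<in>y. fraction R P (a \<otimes>\<^bsub>R\<^esub> b) (s \<otimes>\<^bsub>R\<^esub> t)),
     one = fraction R P \<one>\<^bsub>R\<^esub> \<one>\<^bsub>R\<^esub>,
     zero = fraction R P \<zero>\<^bsub>R\<^esub> \<one>\<^bsub>R\<^esub>,
     add = (\<lambda>x y. \<Union>(a, s)\<in>x. \<Union>(b, t)\<in>y.
              fraction R P (a \<otimes>\<^bsub>R\<^esub> t \<oplus>\<^bsub>R\<^esub> b \<otimes>\<^bsub>R\<^esub> s) (s \<otimes>\<^bsub>R\<^esub> t)) \<rparr>"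

text \<open>
  Sections of the structure sheaf over \<open>U\<close>: families of elements of the local rings at the points
  of \<open>U\<close> that are locally given by a single fraction.
\<close>
definition structure_sheaf ::
    "('a, 'm) ring_scheme \<Rightarrow> 'a set set \<Rightarrow> ('a set \<Rightarrow> ('a \<times> 'a) set) ring" where
  "structure_sheaf R U = \<lparr>
     carrier = {\<sigma> \<in> (\<Pi>\<^sub>E P\<in>U. carrier (localization R P)).
       \<forall>P\<in>U. \<exists>V a f. openin (zariski R) V \<and> P \<in> V \<and> V \<subseteq> U \<and> a \<in> carrier R \<and> f \<in> carrier R \<and>
         (\<forall>Q\<in>V. f \<notin> Q \<and> \<sigma> Q = fraction R Q a f)},
     mult = (\<lambda>\<sigma> \<tau>. \<lambda>P\<in>U. \<sigma> P \<otimes>\<^bsub>localization R P\<^esub> \<tau> P),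
     one = (\<lambda>P\<in>U. \<one>\<^bsub>localization R P\<^esub>),
     zero = (\<lambda>P\<in>U. \<zero>\<^bsub>localization R P\<^esub>),
     add = (\<lambda>\<sigma> \<tau>. \<lambda>P\<in>U. \<sigma> P \<oplus>\<^bsub>localization R P\<^esub> \<tau> P) \<rparr>"

text \<open>
  A ringed space: \<open>sections X U\<close> is the ring of sections over an open set \<open>U\<close>, and \<open>restr X U V\<close>
  restricts sections from \<open>U\<close> to \<open>V\<close>; only their values at open sets matter.
\<close>
record ('p, 's) ringed_space =
  base :: "'p topology"
  sections :: "'p set \<Rightarrow> 's ring"
  restr :: "'p set \<Rightarrow> 'p set \<Rightarrow> 's \<Rightarrow> 's"

definition Spec :: "('a, 'm) ring_scheme \<Rightarrow> ('a set, 'a set \<Rightarrow> ('a \<times> 'a) set) ringed_space" where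
  "Spec R = \<lparr> base = zariski R, sections = structure_sheaf R, restr = (\<lambda>U V \<sigma>. restrict \<sigma> V) \<rparr>"

definition open_subspace :: "('p, 's) ringed_space \<Rightarrow> 'p set \<Rightarrow> ('p, 's) ringed_space" where
  "open_subspace X U = \<lparr> base = subtopology (base X) U, sections = sections X, restr = restr X \<rparr>"

text \<open>
  Isomorphism of ringed spaces. The homomorphisms that an isomorphism induces on stalks are
  isomorphisms, hence local, so between locally ringed spaces this is the same as isomorphism of
  locally ringed spaces.
\<close>
definition ringed_iso :: "('p, 's) ringed_space \<Rightarrow> ('q, 't) ringed_space \<Rightarrow> bool" where
  "ringed_iso X Y \<longleftrightarrow> (\<exists>\<phi> \<psi>.
     let pre = (\<lambda>V. {x \<in> topspace (base X). \<phi> x \<in> V}) in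
       homeomorphic_map (base X) (base Y) \<phi> \<and>
       (\<forall>V. openin (base Y) V \<longrightarrow> \<psi> V \<in> ring_iso (sections Y V) (sections X (pre V))) \<and>
       (\<forall>V W. openin (base Y) V \<and> openin (base Y) W \<and> W \<subseteq> V \<longrightarrow>
          (\<forall>\<sigma> \<in> carrier (sections Y V).
             \<psi> W (restr Y V W \<sigma>) = restr X (pre V) (pre W) (\<psi> V \<sigma>))))"

text \<open>
  The ring \<open>B\<close> has its carrier in the type of the sections of \<open>X\<close>. This is no loss of generality:
  if \<open>X\<close> is isomorphic to the spectrum of some ring, that ring is isomorphic to the ring of global
  sections of \<open>X\<close>.
\<close>
definition affine_scheme :: "('p, 's) ringed_space \<Rightarrow> bool" where
  "affine_scheme X \<longleftrightarrow> (\<exists>B :: 's ring. cring B \<and> ringed_iso X (Spec B))"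


section \<open>Codimension one and hypersurfaces\<close>

definition irreducible_closedin :: "'p topology \<Rightarrow> 'p set \<Rightarrow> bool" where
  "irreducible_closedin T Y \<longleftrightarrow> closedin T Y \<and> Y \<noteq> {} \<and>
     (\<forall>F G. closedin T F \<and> closedin T G \<and> Y = F \<union> G \<longrightarrow> Y = F \<or> Y = G)"

text \<open>For an irreducible closed \<open>Y\<close>: the longest chains starting with \<open>Y\<close> have length one.\<close>
definition codim_one :: "'p topology \<Rightarrow> 'p set \<Rightarrow> bool" where
  "codim_one T Y \<longleftrightarrow> irreducible_closedin T Y \<and>
     (\<exists>Z. irreducible_closedin T Z \<and> Y \<subset> Z) \<and>
     \<not> (\<exists>Z Z'. irreducible_closedin T Z \<and> irreducible_closedin T Z' \<and> Y \<subset> Z \<and> Z \<subset> Z')"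

text \<open>For a closed set \<open>H\<close>, whose irreducible components are closed.\<close>
definition irreducible_component :: "'p topology \<Rightarrow> 'p set \<Rightarrow> 'p set \<Rightarrow> bool" where
  "irreducible_component T H Y \<longleftrightarrow> irreducible_closedin T Y \<and> Y \<subseteq> H \<and>
     (\<forall>Z. irreducible_closedin T Z \<and> Y \<subseteq> Z \<and> Z \<subseteq> H \<longrightarrow> Z = Y)"

definition hypersurface :: "'p topology \<Rightarrow> 'p set \<Rightarrow> bool" where
  "hypersurface T H \<longleftrightarrow> closedin T H \<and> (\<forall>Y. irreducible_component T H Y \<longrightarrow> codim_one T Y)"


section \<open>Weil divisors on the spectrum of a noetherian normal domain\<close>

definition normal_domain :: "'a::idom itself \<Rightarrow> bool" where
  "normal_domain _ \<longleftrightarrow> (\<forall>x :: 'a fract.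
     (\<exists>p :: 'a poly. lead_coeff p = 1 \<and> poly (map_poly (\<lambda>a. Fraction_Field.Fract a 1) p) x = 0) \<longrightarrow>
     x \<in> range (\<lambda>a. Fraction_Field.Fract a 1))"

text \<open>A prime divisor is represented by its generic point \<open>P\<close>; it is the closure \<open>V(P)\<close> of \<open>P\<close>.\<close>
definition prime_divisor :: "'a::idom set \<Rightarrow> bool" where
  "prime_divisor P \<longleftrightarrow> P \<in> spectrum cring_class_ops \<and>
     codim_one (zariski cring_class_ops) (zero_locus cring_class_ops P)"

definition local_ring :: "'a::idom set \<Rightarrow> 'a fract set" where
  "local_ring P = {Fraction_Field.Fract a s | a s. s \<notin> P}"

definition local_ring_max :: "'a::idom set \<Rightarrow> 'a fract set" where
  "local_ring_max P = {Fraction_Field.Fract a s | a s. a \<in> P \<and> s \<notin> P}"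

text \<open>
  The normalized valuation of the discrete valuation ring \<open>local_ring P\<close> at a nonzero element \<open>f\<close>:
  the \<open>n\<close> with \<open>f = u \<pi>\<^sup>n\<close> for a unit \<open>u\<close> and a generator \<open>\<pi>\<close> of the maximal ideal.
\<close>
definition valuation_at :: "'a::idom set \<Rightarrow> 'a fract \<Rightarrow> int" where
  "valuation_at P f = (THE n. \<exists>\<pi> u. local_ring_max P = (\<lambda>x. \<pi> * x) ` local_ring P \<and>
     u \<in> local_ring P - local_ring_max P \<and> f = u * \<pi> powi n)"

definition weil_divisor :: "('a::idom set \<Rightarrow> int) \<Rightarrow> bool" where
  "weil_divisor D \<longleftrightarrow> finite {P. D P \<noteq> 0} \<and> (\<forall>P. D P \<noteq> 0 \<longrightarrow> prime_divisor P)"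

definition principal_divisor :: "'a::idom fract \<Rightarrow> 'a set \<Rightarrow> int" where
  "principal_divisor f P = (if prime_divisor P then valuation_at P f else 0)"

definition linear_equivalence :: "(('a::idom set \<Rightarrow> int) \<times> ('a set \<Rightarrow> int)) set" where
  "linear_equivalence = {(D, E). weil_divisor D \<and> weil_divisor E \<and>
     (\<exists>f. f \<noteq> 0 \<and> (\<forall>P. E P = D P + principal_divisor f P))}"

definition divisor_classes :: "('a::idom set \<Rightarrow> int) set set" where
  "divisor_classes = Collect weil_divisor // linear_equivalence"

definition effective :: "('a::idom set \<Rightarrow> int) \<Rightarrow> bool" where
  "effective D \<longleftrightarrow> (\<forall>P. 0 \<le> D P)"

definition supp :: "('a::idom set \<Rightarrow> int) \<Rightarrow> 'a set set" where
  "supp D = (\<Union>P\<in>{P. D P \<noteq> 0}. zero_locus cring_class_ops P)"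

definition coaffine_class :: "('a::idom set \<Rightarrow> int) set \<Rightarrow> bool" where
  "coaffine_class C \<longleftrightarrow> C \<in> divisor_classes \<and>
     (\<forall>D'\<in>C. effective D' \<longrightarrow>
        affine_scheme (open_subspace (Spec cring_class_ops) (spectrum cring_class_ops - supp D')))"

definition coaffine_divisor :: "('a::idom set \<Rightarrow> int) \<Rightarrow> bool" where
  "coaffine_divisor D \<longleftrightarrow> weil_divisor D \<and> coaffine_class (linear_equivalence `` {D})"

definition reduced_divisor :: "'a::idom set set \<Rightarrow> 'a set \<Rightarrow> int" where
  "reduced_divisor H P = (if P \<in> spectrum cring_class_ops \<and>
     irreducible_component (zariski cring_class_ops) H (zero_locus cring_class_ops P) then 1 else 0)"


section \<open>Pull back to the affine line\<close>

text \<open>The extension \<open>P A[T]\<close> of a prime ideal \<open>P\<close> of \<open>A\<close>.\<close>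
definition extend_prime :: "'a::idom set \<Rightarrow> 'a poly set" where
  "extend_prime P = {p. \<forall>i. poly.coeff p i \<in> P}"

text \<open>
  The inverse image of the prime divisor \<open>V(P)\<close> under the flat projection is the integral
  subscheme \<open>V(P A[T])\<close>, so \<open>V(P)\<close> pulls back to \<open>V(P A[T])\<close> with multiplicity one. A prime \<open>P\<close>
  is recovered from its extension as the set of constants \<open>{a. [:a:] \<in> Q}\<close>.
\<close>
definition pullback :: "('a::idom set \<Rightarrow> int) \<Rightarrow> 'a poly set \<Rightarrow> int" where
  "pullback D Q = (if \<exists>P. prime_divisor P \<and> Q = extend_prime P then D {a. [:a:] \<in> Q} else 0)"

definition pullback_class :: "('a::idom set \<Rightarrow> int) set \<Rightarrow> ('a poly set \<Rightarrow> int) set" where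
  "pullback_class C = linear_equivalence `` (pullback ` C)"

end

theory Submission
  imports Defs "HOL-Computational_Algebra.Polynomial_Factorial"
begin

text \<open>
  For an open set \<open>U\<close> of the spectrum of a domain let \<open>O(U)\<close> be the ring of elements of the fraction
  field that are regular on \<open>U\<close>. Then \<open>U\<close> is affine if and only if every prime ideal of \<open>O(U)\<close>
  contracts to a point of \<open>U\<close>.

  An effective divisor equivalent to the pull back of \<open>D\<close> has the form \<open>E = D + div g\<close> with a
  polynomial \<open>g = g\<^sub>0 + g\<^sub>1 T + \<dots>\<close> over \<open>A\<close>, after replacing \<open>D\<close> by an equivalent divisor, and every
  \<open>D\<^sub>i = D + div g\<^sub>i\<close> with \<open>g\<^sub>i \<noteq> 0\<close> is effective. On the complement \<open>U\<close> of \<open>E\<close> the functions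
  \<open>x\<^sub>i = g\<^sub>i / g\<close> are regular, and the sum of the \<open>T\<^sup>i x\<^sub>i\<close> is \<open>1\<close>; so a prime \<open>q\<close> of \<open>O(U)\<close> misses
  some \<open>x\<^sub>i\<close>. A power of \<open>x\<^sub>i\<close> clears the poles of any regular function on the affine complement of
  \<open>D\<^sub>i\<close>, hence \<open>q\<close> lies over a point of this complement. There \<open>g / g\<^sub>i\<close> is regular; if \<open>E\<close> passed
  through the contraction of \<open>q\<close>, it would belong to \<open>q\<close>, although its product with \<open>x\<^sub>i\<close> is \<open>1\<close>.

  Height one primes of \<open>A[T]\<close> lying over \<open>0\<close> are principal up to constants, so every divisor on
  \<open>Spec A[T]\<close> is equivalent to a pull back. The class of any divisor on \<open>Spec A\<close> is coaffine once
  all hypersurfaces are, because an effective divisor has the same support as its reduction.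
\<close>

section \<open>Structure sheaves of domains\<close>

text \<open>Noetherianity and normality are assumed, and used, only for \<open>A\<close>. Of
  \<open>A[T]\<close> three facts are needed: every height one prime has a uniformizer, a nonzero
  polynomial lies in finitely many of them, and regularity at a prime can be tested at the height
  one primes inside it. They are proved by sorting these primes into extensions
  \<open>P A[T]\<close> and primes over \<open>0\<close>; at the latter nonzero constants are units,
  so pseudo-division does the work of Euclidean division over the fraction field. The link between
  both rings is that the valuation of \<open>P A[T]\<close> is the minimum of the valuations of the
  coefficients: it bounds the multiplicities of \<open>E\<close> at extended primes by those of each
  \<open>D\<^sub>i\<close>. Testing affineness by primes of \<open>O(U)\<close> avoids covering
  \<open>U\<close> by pieces: \<open>q\<close> is carried to the functions on the complement of
  \<open>D\<^sub>i\<close> by algebra in the fraction fields, although only the localization of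
  \<open>O(U)\<close> at \<open>x\<^sub>i\<close> receives these functions.\<close>

lemma (in cring) exists_primeideal:
  assumes J: "ideal J R" and one: "\<one> \<notin> J"
  shows "\<exists>P. primeideal P R \<and> J \<subseteq> P"
proof -
  \<comment> \<open>An ideal maximal among those above \<open>J\<close> that avoid \<open>1\<close>
    is a maximal ideal, hence prime.\<close>
  let ?S = "{I. ideal I R \<and> J \<subseteq> I \<and> \<one> \<notin> I}"
  have "\<exists>M\<in>?S. \<forall>X\<in>?S. M \<subseteq> X \<longrightarrow> X = M"
  proof (rule subset_Zorn_nonempty)
    show "?S \<noteq> {}" using assms by auto
    fix C assume C: "C \<noteq> {}" "subset.chain ?S C"
    then have "subset.chain {I. ideal I R} C"
      by (auto simp: subset.chain_def)
    then have "ideal (\<Union>C) R" using chain_Union_is_ideal[of C] C(1) by auto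
    with C show "\<Union>C \<in> ?S" by (auto simp: subset.chain_def)
  qed
  then obtain M where M': "M \<in> ?S" "\<forall>X\<in>?S. M \<subseteq> X \<longrightarrow> X = M" by (rule bexE)
  then have M: "ideal M R" "J \<subseteq> M" "\<one> \<notin> M" by auto
  have max: "X = M" if "ideal X R" "\<one> \<notin> X" "M \<subseteq> X" for X
    using M'(2) that M(2) by simp
  have "maximalideal M R"
  proof (rule maximalidealI[OF M(1)])
    show "carrier R \<noteq> M" using M(3) by auto
    fix X assume X: "ideal X R" "M \<subseteq> X" "X \<subseteq> carrier R"
    show "X = M \<or> X = carrier R"
      using max[OF X(1) _ X(2)] ideal.one_imp_carrier[OF X(1)] by metis
  qed
  then have "primeideal M R" by (rule maximalideal_prime)
  then show ?thesis using M(2) by (intro exI[of _ M]) simp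
qed

lemma (in ring) topspace_zariski [simp]: "topspace (zariski R) = spectrum R"
proof
  show "topspace (zariski R) \<subseteq> spectrum R"
    using openin_topspace[of "zariski R"] unfolding openin_zariski by auto
  have "zero_locus R {\<one>} = {}"
    by (auto simp: zero_locus_def spectrum_def dest: primeideal.I_notcarr
        ideal.one_imp_carrier[OF primeideal.axioms(1)])
  then have "openin (zariski R) (spectrum R)"
    unfolding openin_zariski by (intro exI[of _ "{\<one>}"]) auto
  then show "spectrum R \<subseteq> topspace (zariski R)" by (rule openin_subset)
qed

lemma (in cring) primeideal_simps:
  assumes "primeideal P R"
  shows "P \<subseteq> carrier R" "\<zero> \<in> P" "\<one> \<notin> P"
    "\<And>a b. a \<in> P \<Longrightarrow> b \<in> P \<Longrightarrow> a \<oplus> b \<in> P"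
    "\<And>a b. a \<in> carrier R \<Longrightarrow> b \<in> carrier R \<Longrightarrow> a \<otimes> b \<in> P \<longleftrightarrow> a \<in> P \<or> b \<in> P"
proof -
  interpret primeideal P R by fact
  show "P \<subseteq> carrier R" by auto
  show "\<zero> \<in> P" by auto
  show "\<one> \<notin> P" using I_notcarr one_imp_carrier by blast
  show "a \<oplus> b \<in> P" if "a \<in> P" "b \<in> P" for a b using that by (rule a_closed)
  show "a \<otimes> b \<in> P \<longleftrightarrow> a \<in> P \<or> b \<in> P" if "a \<in> carrier R" "b \<in> carrier R" for a b
    using that I_prime[OF that] I_l_closed[of b a] I_r_closed[of a b] by metis
qed

section \<open>Arithmetic of fractions at a prime\<close>

lemma (in cring) mem_fraction_iff:
  assumes "primeideal P R" "a \<in> carrier R" "s \<in> carrier R"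
  shows "(b, t) \<in> fraction R P a s \<longleftrightarrow> b \<in> carrier R \<and> t \<in> carrier R - P \<and>
    (\<exists>u \<in> carrier R - P. u \<otimes> (a \<otimes> t) = u \<otimes> (b \<otimes> s))"
proof -
  have "u \<otimes> (a \<otimes> t \<ominus> b \<otimes> s) = \<zero> \<longleftrightarrow> u \<otimes> (a \<otimes> t) = u \<otimes> (b \<otimes> s)"
    if "u \<in> carrier R" "b \<in> carrier R" "t \<in> carrier R" for u b t
  proof -
    have "u \<otimes> (a \<otimes> t \<ominus> b \<otimes> s) = u \<otimes> (a \<otimes> t) \<ominus> u \<otimes> (b \<otimes> s)"
      using that assms by (simp add: r_distr a_minus_def r_minus)
    then show ?thesis using that assms by simp
  qed
  then show ?thesis by (auto simp: fraction_def)
qed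

lemma (in cring) fraction_self:
  assumes "primeideal P R" "a \<in> carrier R" "s \<in> carrier R - P"
  shows "(a, s) \<in> fraction R P a s"
  using assms primeideal_simps[OF assms(1)] by (auto simp: mem_fraction_iff)

lemma (in cring) fraction_cong_subset:
  assumes P: "primeideal P R" and c: "a \<in> carrier R" "s \<in> carrier R - P" "b \<in> carrier R" "t \<in> carrier R - P"
    and u: "u \<in> carrier R - P" "u \<otimes> (a \<otimes> t) = u \<otimes> (b \<otimes> s)"
  shows "fraction R P a s \<subseteq> fraction R P b t"
proof clarify
  fix c v assume "(c, v) \<in> fraction R P a s"
  then obtain w where w: "c \<in> carrier R" "v \<in> carrier R - P" "w \<in> carrier R - P"
    "w \<otimes> (a \<otimes> v) = w \<otimes> (c \<otimes> s)"
    using mem_fraction_iff[OF P] c by blast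
  \<comment> \<open>Transitivity of equality of fractions costs the factor \<open>s\<close> besides
    the two witnesses \<open>u\<close> and \<open>w\<close>; all three lie outside
    \<open>P\<close>.\<close>
  have "(u \<otimes> w \<otimes> s) \<otimes> (b \<otimes> v) = (u \<otimes> (b \<otimes> s)) \<otimes> (w \<otimes> v)"
    using c u w by (simp add: m_ac)
  also have "\<dots> = (u \<otimes> (a \<otimes> t)) \<otimes> (w \<otimes> v)" using u by simp
  also have "\<dots> = (w \<otimes> (a \<otimes> v)) \<otimes> (u \<otimes> t)" using c u(1) w(1-3) by (simp add: m_ac)
  also have "\<dots> = (w \<otimes> (c \<otimes> s)) \<otimes> (u \<otimes> t)" using w by simp
  also have "\<dots> = (u \<otimes> w \<otimes> s) \<otimes> (c \<otimes> t)" using c u(1) w(1-3) by (simp add: m_ac)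
  finally have "(u \<otimes> w \<otimes> s) \<otimes> (b \<otimes> v) = (u \<otimes> w \<otimes> s) \<otimes> (c \<otimes> t)" .
  moreover have "u \<otimes> w \<otimes> s \<in> carrier R - P"
    using c u w primeideal_simps(5)[OF P] by auto
  ultimately show "(c, v) \<in> fraction R P b t"
    using mem_fraction_iff[OF P] c w by blast
qed

lemma (in cring) fraction_cong:
  assumes "primeideal P R" "a \<in> carrier R" "s \<in> carrier R - P" "b \<in> carrier R" "t \<in> carrier R - P"
    and "u \<in> carrier R - P" "u \<otimes> (a \<otimes> t) = u \<otimes> (b \<otimes> s)"
  shows "fraction R P a s = fraction R P b t"
  using assms fraction_cong_subset[of P a s b t u] fraction_cong_subset[of P b t a s u] by auto

text \<open>The operations of \<open>localization\<close> are unions over all pairs of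
  representatives; once every choice gives the same class, inhabited index sets make the union equal
  to it.\<close>

lemma UN_pair_const:
  assumes "(a, s) \<in> X" "(b, t) \<in> Y"
    and "\<And>a s b t. (a, s) \<in> X \<Longrightarrow> (b, t) \<in> Y \<Longrightarrow> f a s b t = c"
  shows "(\<Union>(a, s)\<in>X. \<Union>(b, t)\<in>Y. f a s b t) = c"
proof -
  have "(\<Union>(a, s)\<in>X. \<Union>(b, t)\<in>Y. f a s b t) = (\<Union>x\<in>X. \<Union>y\<in>Y. c)"
    using assms(3) by (intro SUP_cong) auto
  also have "\<dots> = c" using assms(1,2) by blast
  finally show ?thesis .
qed

lemma (in cring) localization_mult:
  assumes P: "primeideal P R" and c: "a \<in> carrier R" "s \<in> carrier R - P" "b \<in> carrier R" "t \<in> carrier R - P"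
  shows "fraction R P a s \<otimes>\<^bsub>localization R P\<^esub> fraction R P b t = fraction R P (a \<otimes> b) (s \<otimes> t)"
proof -
  have "fraction R P (a' \<otimes> b') (s' \<otimes> t') = fraction R P (a \<otimes> b) (s \<otimes> t)"
    if "(a', s') \<in> fraction R P a s" "(b', t') \<in> fraction R P b t" for a' s' b' t'
  proof -
    obtain u where u: "a' \<in> carrier R" "s' \<in> carrier R - P" "u \<in> carrier R - P"
      "u \<otimes> (a \<otimes> s') = u \<otimes> (a' \<otimes> s)"
      using \<open>(a', s') \<in> _\<close> mem_fraction_iff[OF P] c by blast
    obtain w where w: "b' \<in> carrier R" "t' \<in> carrier R - P" "w \<in> carrier R - P"
      "w \<otimes> (b \<otimes> t') = w \<otimes> (b' \<otimes> t)"
      using \<open>(b', t') \<in> _\<close> mem_fraction_iff[OF P] c by blast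
    have "(u \<otimes> w) \<otimes> ((a' \<otimes> b') \<otimes> (s \<otimes> t)) = (u \<otimes> (a' \<otimes> s)) \<otimes> (w \<otimes> (b' \<otimes> t))"
      using c u(1-3) w(1-3) by (simp add: m_ac)
    also have "\<dots> = (u \<otimes> (a \<otimes> s')) \<otimes> (w \<otimes> (b \<otimes> t'))" using u w by simp
    also have "\<dots> = (u \<otimes> w) \<otimes> ((a \<otimes> b) \<otimes> (s' \<otimes> t'))"
      using c u(1-3) w(1-3) by (simp add: m_ac)
    finally show ?thesis
      using c u w primeideal_simps(5)[OF P] by (intro fraction_cong[OF P, of _ _ _ _ "u \<otimes> w"]) auto
  qed
  then show ?thesis
    unfolding localization_def monoid.simps ring.simps
    by (rule UN_pair_const[OF fraction_self[OF P c(1,2)] fraction_self[OF P c(3,4)]])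
qed

lemma (in cring) localization_add:
  assumes P: "primeideal P R" and c: "a \<in> carrier R" "s \<in> carrier R - P" "b \<in> carrier R" "t \<in> carrier R - P"
  shows "fraction R P a s \<oplus>\<^bsub>localization R P\<^esub> fraction R P b t
    = fraction R P (a \<otimes> t \<oplus> b \<otimes> s) (s \<otimes> t)"
proof -
  have "fraction R P (a' \<otimes> t' \<oplus> b' \<otimes> s') (s' \<otimes> t') = fraction R P (a \<otimes> t \<oplus> b \<otimes> s) (s \<otimes> t)"
    if "(a', s') \<in> fraction R P a s" "(b', t') \<in> fraction R P b t" for a' s' b' t'
  proof -
    obtain u where u: "a' \<in> carrier R" "s' \<in> carrier R - P" "u \<in> carrier R - P"
      "u \<otimes> (a \<otimes> s') = u \<otimes> (a' \<otimes> s)"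
      using \<open>(a', s') \<in> _\<close> mem_fraction_iff[OF P] c by blast
    obtain w where w: "b' \<in> carrier R" "t' \<in> carrier R - P" "w \<in> carrier R - P"
      "w \<otimes> (b \<otimes> t') = w \<otimes> (b' \<otimes> t)"
      using \<open>(b', t') \<in> _\<close> mem_fraction_iff[OF P] c by blast
    have "(u \<otimes> w) \<otimes> ((a' \<otimes> t' \<oplus> b' \<otimes> s') \<otimes> (s \<otimes> t))
        = (u \<otimes> (a' \<otimes> s)) \<otimes> (w \<otimes> t \<otimes> t') \<oplus> (w \<otimes> (b' \<otimes> t)) \<otimes> (u \<otimes> s \<otimes> s')"
      using c u(1-3) w(1-3) by (simp add: l_distr r_distr m_ac)
    also have "\<dots> = (u \<otimes> (a \<otimes> s')) \<otimes> (w \<otimes> t \<otimes> t') \<oplus> (w \<otimes> (b \<otimes> t')) \<otimes> (u \<otimes> s \<otimes> s')"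
      using u w by simp
    also have "\<dots> = (u \<otimes> w) \<otimes> ((a \<otimes> t \<oplus> b \<otimes> s) \<otimes> (s' \<otimes> t'))"
      using c u(1-3) w(1-3) by (simp add: l_distr r_distr m_ac)
    finally show ?thesis
      using c u w primeideal_simps(5)[OF P] by (intro fraction_cong[OF P, of _ _ _ _ "u \<otimes> w"]) auto
  qed
  then show ?thesis
    unfolding localization_def monoid.simps ring.simps
    by (rule UN_pair_const[OF fraction_self[OF P c(1,2)] fraction_self[OF P c(3,4)]])
qed

text \<open>
  Realizing the fraction field of \<open>R\<close> as a fixed field \<open>'k\<close> makes all stalks and all rings of sections
  over nonempty open sets subsets of \<open>'k\<close>, also for different rings \<open>R\<close>.
\<close>
locale embedded_domain = domain R for R :: "('a, 'm) ring_scheme" (structure) +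
  fixes \<iota> :: "'a \<Rightarrow> 'k::field"
  assumes emb_add: "a \<in> carrier R \<Longrightarrow> b \<in> carrier R \<Longrightarrow> \<iota> (a \<oplus> b) = \<iota> a + \<iota> b"
    and emb_mult: "a \<in> carrier R \<Longrightarrow> b \<in> carrier R \<Longrightarrow> \<iota> (a \<otimes> b) = \<iota> a * \<iota> b"
    and emb_one: "\<iota> \<one> = 1"
    and emb_inj: "inj_on \<iota> (carrier R)"
begin

lemma emb_zero: "\<iota> \<zero> = 0"
  using emb_add[of \<zero> \<zero>] by (metis add_cancel_right_right r_zero zero_closed)

lemma emb_eq_iff: "a \<in> carrier R \<Longrightarrow> b \<in> carrier R \<Longrightarrow> \<iota> a = \<iota> b \<longleftrightarrow> a = b"
  using emb_inj by (auto dest: inj_onD)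

lemma emb_nonzero: "primeideal P R \<Longrightarrow> s \<in> carrier R - P \<Longrightarrow> \<iota> s \<noteq> 0"
  using emb_eq_iff[of s \<zero>] primeideal_simps(2)[of P] emb_zero by auto

lemma primeideal_zero: "primeideal {\<zero>} R"
  using zeroprimeideal .

section \<open>Stalks, germs and sections inside the fixed field\<close>

definition stalk :: "'a set \<Rightarrow> 'k set" where
  "stalk P = {k. \<exists>a \<in> carrier R. \<exists>s \<in> carrier R - P. k * \<iota> s = \<iota> a}"

text \<open>All pairs representing \<open>k\<close>. For \<open>k\<close> in the stalk this is the
  corresponding element of the localization; otherwise it is empty.\<close>

definition germ :: "'a set \<Rightarrow> 'k \<Rightarrow> ('a \<times> 'a) set" where
  "germ P k = {(a, s). a \<in> carrier R \<and> s \<in> carrier R - P \<and> \<iota> a = k * \<iota> s}"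

text \<open>Over the empty set this is all of \<open>'k\<close>, whereas the sheaf has a single
  section there. Hence the nonemptiness assumptions in \<open>carrier_structure_sheaf\<close> and
  its consequences.\<close>

definition regular :: "'a set set \<Rightarrow> 'k set" where
  "regular V = {k. \<forall>P \<in> V. k \<in> stalk P}"

definition sect :: "'a set set \<Rightarrow> 'k \<Rightarrow> 'a set \<Rightarrow> ('a \<times> 'a) set" where
  "sect V k = (\<lambda>P\<in>V. germ P k)"

lemma emb_in_stalk: "primeideal P R \<Longrightarrow> a \<in> carrier R \<Longrightarrow> \<iota> a \<in> stalk P"
  unfolding stalk_def using primeideal_simps(3)[of P] emb_one
  by (intro CollectI bexI[of _ a] bexI[of _ \<one>]) auto

lemma stalk_divide: "primeideal P R \<Longrightarrow> a \<in> carrier R \<Longrightarrow> s \<in> carrier R - P \<Longrightarrow> \<iota> a / \<iota> s \<in> stalk P"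
  unfolding stalk_def using emb_nonzero[of P s] by force

lemma stalkE:
  assumes "primeideal P R" "k \<in> stalk P"
  obtains a s where "a \<in> carrier R" "s \<in> carrier R - P" "k = \<iota> a / \<iota> s" "\<iota> s \<noteq> 0"
proof -
  from assms(2) obtain a s where as: "a \<in> carrier R" "s \<in> carrier R - P" "k * \<iota> s = \<iota> a"
    by (auto simp: stalk_def)
  with emb_nonzero[OF assms(1) as(2)] show thesis by (intro that[of a s]) (auto simp: field_simps)
qed

lemma stalk_closed:
  assumes P: "primeideal P R" and k: "k \<in> stalk P" "l \<in> stalk P"
  shows "k * l \<in> stalk P" "k + l \<in> stalk P"
proof -
  obtain a s where a: "a \<in> carrier R" "s \<in> carrier R - P" "k = \<iota> a / \<iota> s" "\<iota> s \<noteq> 0"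
    using stalkE[OF P k(1)] .
  obtain b t where b: "b \<in> carrier R" "t \<in> carrier R - P" "l = \<iota> b / \<iota> t" "\<iota> t \<noteq> 0"
    using stalkE[OF P k(2)] .
  have st: "s \<otimes> t \<in> carrier R - P" using a b primeideal_simps(5)[OF P] by auto
  have "k * l = \<iota> (a \<otimes> b) / \<iota> (s \<otimes> t)" using a b by (simp add: emb_mult)
  then show "k * l \<in> stalk P" using st a b by (auto intro!: stalk_divide[OF P])
  have "k + l = \<iota> (a \<otimes> t \<oplus> b \<otimes> s) / \<iota> (s \<otimes> t)"
    using a b by (simp add: emb_mult emb_add field_simps)
  then show "k + l \<in> stalk P" using st a b by (auto intro!: stalk_divide[OF P])
qed

text \<open>In a domain the auxiliary factor \<open>u\<close> of the relation cancels, since \<iota>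
  maps elements outside \<open>P\<close> to nonzero elements.\<close>

lemma fraction_eq_germ:
  assumes P: "primeideal P R" and a: "a \<in> carrier R" "s \<in> carrier R - P"
  shows "fraction R P a s = germ P (\<iota> a / \<iota> s)"
proof -
  have "u \<otimes> (a \<otimes> t) = u \<otimes> (b \<otimes> s) \<longleftrightarrow> \<iota> b = \<iota> a / \<iota> s * \<iota> t"
    if "u \<in> carrier R - P" "b \<in> carrier R" "t \<in> carrier R - P" for u b t
  proof -
    have "u \<otimes> (a \<otimes> t) = u \<otimes> (b \<otimes> s) \<longleftrightarrow> \<iota> (u \<otimes> (a \<otimes> t)) = \<iota> (u \<otimes> (b \<otimes> s))"
      using that a by (intro emb_eq_iff[symmetric]) auto
    also have "\<dots> \<longleftrightarrow> \<iota> b = \<iota> a / \<iota> s * \<iota> t"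
      using that a emb_nonzero[OF P, of u] emb_nonzero[OF P, of s] by (auto simp: emb_mult field_simps)
    finally show ?thesis .
  qed
  note iff = this
  have mem: "(b, t) \<in> fraction R P a s \<longleftrightarrow> (b, t) \<in> germ P (\<iota> a / \<iota> s)" for b t
  proof (cases "b \<in> carrier R \<and> t \<in> carrier R - P")
    case True
    have "(\<exists>u\<in>carrier R - P. u \<otimes> (a \<otimes> t) = u \<otimes> (b \<otimes> s))
        \<longleftrightarrow> (\<exists>u\<in>carrier R - P. \<iota> b = \<iota> a / \<iota> s * \<iota> t)"
      by (rule bex_cong[OF refl], rule iff) (use True in auto)
    also have "\<dots> \<longleftrightarrow> \<iota> b = \<iota> a / \<iota> s * \<iota> t"
      using primeideal_simps(3)[OF P] one_closed by blast
    finally show ?thesis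
      using mem_fraction_iff[OF P a(1), of s b t] a(2) True by (simp add: germ_def)
  next
    case False
    then show ?thesis using mem_fraction_iff[OF P a(1), of s b t] a(2) by (auto simp: germ_def)
  qed
  then show ?thesis by (intro Set.set_eqI) (metis surj_pair)
qed

lemma carrier_localization:
  assumes P: "primeideal P R"
  shows "carrier (localization R P) = germ P ` stalk P"
proof -
  have "fraction R P a s \<in> germ P ` stalk P" if "a \<in> carrier R" "s \<in> carrier R - P" for a s
    using fraction_eq_germ[OF P that] stalk_divide[OF P that] by simp
  moreover have "\<exists>a s. germ P k = fraction R P a s \<and> a \<in> carrier R \<and> s \<in> carrier R - P"
    if k: "k \<in> stalk P" for k
  proof -
    obtain a s where "a \<in> carrier R" "s \<in> carrier R - P" "k = \<iota> a / \<iota> s"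
      using stalkE[OF P k] by metis
    then show ?thesis using fraction_eq_germ[OF P, of a s] by (intro exI[of _ a] exI[of _ s]) simp
  qed
  ultimately show ?thesis unfolding localization_def partial_object.simps by blast
qed

lemma germ_inj:
  assumes P: "primeideal P R" and k: "k \<in> stalk P" and eq: "germ P k = germ P l"
  shows "k = l"
proof -
  obtain a s where a: "a \<in> carrier R" "s \<in> carrier R - P" "k = \<iota> a / \<iota> s" "\<iota> s \<noteq> 0"
    using stalkE[OF P k] .
  then have "(a, s) \<in> germ P k" by (auto simp: germ_def)
  then have "(a, s) \<in> germ P l" using eq by simp
  then have "\<iota> a = l * \<iota> s" by (simp add: germ_def)
  then show ?thesis using a by simp
qed

lemma germ_hom:
  assumes P: "primeideal P R" and k: "k \<in> stalk P" "l \<in> stalk P"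
  shows "germ P k \<otimes>\<^bsub>localization R P\<^esub> germ P l = germ P (k * l)"
    "germ P k \<oplus>\<^bsub>localization R P\<^esub> germ P l = germ P (k + l)"
proof -
  obtain a s where a: "a \<in> carrier R" "s \<in> carrier R - P" "k = \<iota> a / \<iota> s" "\<iota> s \<noteq> 0"
    using stalkE[OF P k(1)] .
  obtain b t where b: "b \<in> carrier R" "t \<in> carrier R - P" "l = \<iota> b / \<iota> t" "\<iota> t \<noteq> 0"
    using stalkE[OF P k(2)] .
  have st: "s \<otimes> t \<in> carrier R - P" using a b primeideal_simps(5)[OF P] by auto
  have "k * l = \<iota> (a \<otimes> b) / \<iota> (s \<otimes> t)" using a b by (simp add: emb_mult)
  then show "germ P k \<otimes>\<^bsub>localization R P\<^esub> germ P l = germ P (k * l)"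
    using localization_mult[OF P a(1,2) b(1,2)] fraction_eq_germ[OF P] a b st by auto
  have "k + l = \<iota> (a \<otimes> t \<oplus> b \<otimes> s) / \<iota> (s \<otimes> t)"
    using a b by (simp add: emb_mult emb_add field_simps)
  then show "germ P k \<oplus>\<^bsub>localization R P\<^esub> germ P l = germ P (k + l)"
    using localization_add[OF P a(1,2) b(1,2)] fraction_eq_germ[OF P] a b st by auto
qed

lemma germ_one: "primeideal P R \<Longrightarrow> \<one>\<^bsub>localization R P\<^esub> = germ P 1"
  using fraction_eq_germ[of P \<one> \<one>] primeideal_simps(3)[of P] by (simp add: localization_def emb_one)

lemma open_subset: "openin (zariski R) V \<Longrightarrow> P \<in> V \<Longrightarrow> primeideal P R"
  using openin_subset[of "zariski R" V] by (auto simp: spectrum_def)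

lemma open_downward:
  "openin (zariski R) V \<Longrightarrow> P \<in> V \<Longrightarrow> primeideal Q R \<Longrightarrow> Q \<subseteq> P \<Longrightarrow> Q \<in> V"
  by (auto simp: openin_zariski zero_locus_def spectrum_def)

lemma generic_in_open: "openin (zariski R) V \<Longrightarrow> V \<noteq> {} \<Longrightarrow> {\<zero>} \<in> V"
  using open_downward[of V _ "{\<zero>}"] primeideal_zero open_subset primeideal_simps(2) by fastforce

lemma open_basic: "f \<in> carrier R \<Longrightarrow> openin (zariski R) {P \<in> spectrum R. f \<notin> P}"
  unfolding openin_zariski by (intro exI[of _ "{f}"]) (auto simp: zero_locus_def)

lemma regular_closed:
  assumes "openin (zariski R) V" "k \<in> regular V" "l \<in> regular V"
  shows "k * l \<in> regular V" "k + l \<in> regular V"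
  using assms stalk_closed open_subset unfolding regular_def by blast+

lemma emb_in_regular: "openin (zariski R) V \<Longrightarrow> a \<in> carrier R \<Longrightarrow> \<iota> a \<in> regular V"
  using emb_in_stalk open_subset unfolding regular_def by blast

lemma one_in_regular: "openin (zariski R) V \<Longrightarrow> 1 \<in> regular V"
  using emb_in_regular[of V \<one>] emb_one by simp

text \<open>Every nonempty open set contains the generic point \<open>{\<zero>}\<close>. The germ
  there determines one \<open>k\<close> in the field, and each local representation
  \<open>a / f\<close> agrees with it because its domain contains the generic point too.\<close>

lemma carrier_structure_sheaf:
  assumes V: "openin (zariski R) V" "V \<noteq> {}"
  shows "carrier (structure_sheaf R V) = sect V ` regular V"
proof (intro equalityI subsetI)
  fix \<sigma> assume "\<sigma> \<in> carrier (structure_sheaf R V)"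
  then have \<sigma>: "\<sigma> \<in> (\<Pi>\<^sub>E P\<in>V. carrier (localization R P))"
    and loc: "\<forall>P\<in>V. \<exists>W a f. openin (zariski R) W \<and> P \<in> W \<and> W \<subseteq> V \<and> a \<in> carrier R \<and> f \<in> carrier R \<and>
         (\<forall>Q\<in>W. f \<notin> Q \<and> \<sigma> Q = fraction R Q a f)"
    by (auto simp: structure_sheaf_def)
  have "{\<zero>} \<in> V" using generic_in_open V .
  then have "\<sigma> {\<zero>} \<in> germ {\<zero>} ` stalk {\<zero>}"
    using PiE_mem[OF \<sigma>] carrier_localization[OF primeideal_zero] by metis
  then obtain k where k: "k \<in> stalk {\<zero>}" "\<sigma> {\<zero>} = germ {\<zero>} k" by blast
  have *: "k \<in> stalk P \<and> \<sigma> P = germ P k" if P: "P \<in> V" for P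
  proof -
    obtain W a f where W: "openin (zariski R) W" "P \<in> W" "a \<in> carrier R" "f \<in> carrier R"
      "\<And>Q. Q \<in> W \<Longrightarrow> f \<notin> Q \<and> \<sigma> Q = fraction R Q a f"
      using loc P by meson
    have eq: "\<sigma> Q = germ Q (\<iota> a / \<iota> f) \<and> \<iota> a / \<iota> f \<in> stalk Q" if "Q \<in> W" for Q
      using W(3,4) W(5)[OF that] open_subset[OF W(1) that]
      by (auto simp: fraction_eq_germ intro!: stalk_divide)
    have "{\<zero>} \<in> W" using generic_in_open W by blast
    then have "k = \<iota> a / \<iota> f"
      using eq[of "{\<zero>}"] k germ_inj[OF primeideal_zero] by metis
    then show ?thesis using eq[OF W(2)] by simp
  qed
  then have "\<sigma> = sect V k"
    using \<sigma> by (intro ext) (simp add: sect_def PiE_def extensional_def)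
  moreover have "k \<in> regular V" using * by (simp add: regular_def)
  ultimately show "\<sigma> \<in> sect V ` regular V" by (rule image_eqI)
next
  fix \<sigma> assume "\<sigma> \<in> sect V ` regular V"
  then obtain k where "k \<in> regular V" and k2: "\<sigma> = sect V k" by blast
  then have k: "\<And>P. P \<in> V \<Longrightarrow> k \<in> stalk P" "\<sigma> = sect V k" by (auto simp: regular_def)
  have "\<exists>W a f. openin (zariski R) W \<and> P \<in> W \<and> W \<subseteq> V \<and> a \<in> carrier R \<and> f \<in> carrier R \<and>
         (\<forall>Q\<in>W. f \<notin> Q \<and> \<sigma> Q = fraction R Q a f)" if P: "P \<in> V" for P
  proof -
    obtain a s where a: "a \<in> carrier R" "s \<in> carrier R - P" "k = \<iota> a / \<iota> s" "\<iota> s \<noteq> 0"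
      using stalkE[OF open_subset[OF V(1) P] k(1)[OF P]] .
    define W where "W = V \<inter> {P \<in> spectrum R. s \<notin> P}"
    have "openin (zariski R) W" unfolding W_def using V a by (intro openin_Int open_basic) auto
    moreover have "P \<in> W" using a P open_subset[OF V(1) P] by (auto simp: W_def spectrum_def)
    moreover have "\<forall>Q\<in>W. s \<notin> Q \<and> \<sigma> Q = fraction R Q a s"
      using a k2 by (simp add: W_def sect_def spectrum_def fraction_eq_germ)
    moreover have "W \<subseteq> V" by (auto simp: W_def)
    ultimately show ?thesis using a(1,2) by (intro exI[of _ W] exI[of _ a] exI[of _ s]) simp
  qed
  moreover have "\<sigma> \<in> (\<Pi>\<^sub>E P\<in>V. carrier (localization R P))"
    unfolding k2 sect_def
    using carrier_localization[OF open_subset[OF V(1)]] k(1) by (intro PiE_I) auto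
  ultimately show "\<sigma> \<in> carrier (structure_sheaf R V)" by (simp add: structure_sheaf_def)
qed

lemma sect_inj:
  assumes V: "openin (zariski R) V" "V \<noteq> {}"
  shows "inj_on (sect V) (regular V)"
proof (rule inj_onI)
  fix k l assume k: "k \<in> regular V" "sect V k = sect V l"
  have "{\<zero>} \<in> V" using generic_in_open V .
  then have "germ {\<zero>} k = germ {\<zero>} l" and "k \<in> stalk {\<zero>}"
    using fun_cong[OF k(2), of "{\<zero>}"] k(1) by (simp_all add: sect_def regular_def)
  then show "k = l" using germ_inj[OF primeideal_zero] by metis
qed

lemma sect_hom:
  assumes "openin (zariski R) V" "k \<in> regular V" "l \<in> regular V"
  shows "sect V k \<otimes>\<^bsub>structure_sheaf R V\<^esub> sect V l = sect V (k * l)"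
    "sect V k \<oplus>\<^bsub>structure_sheaf R V\<^esub> sect V l = sect V (k + l)"
  using assms open_subset[of V]
  by (auto intro!: restrict_ext simp: structure_sheaf_def sect_def regular_def germ_hom)

lemma sect_one: "openin (zariski R) V \<Longrightarrow> \<one>\<^bsub>structure_sheaf R V\<^esub> = sect V 1"
  using open_subset[of V] by (auto intro!: restrict_ext simp: structure_sheaf_def sect_def germ_one)

lemma restrict_sect: "W \<subseteq> V \<Longrightarrow> restrict (sect V k) W = sect W k"
  by (auto intro!: restrict_ext simp: sect_def Int_absorb1)

end

lemma carrier_structure_sheaf_empty: "carrier (structure_sheaf R {}) = {\<lambda>_. undefined}"
  by (auto simp: structure_sheaf_def)

section \<open>The affineness criterion\<close>

lemma (in cring) ideal_leftI:
  assumes sub: "I \<subseteq> carrier R" and zero: "\<zero> \<in> I"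
    and add: "\<And>a b. a \<in> I \<Longrightarrow> b \<in> I \<Longrightarrow> a \<oplus> b \<in> I"
    and mult: "\<And>a r. a \<in> I \<Longrightarrow> r \<in> carrier R \<Longrightarrow> r \<otimes> a \<in> I"
  shows "ideal I R"
proof (rule idealI[OF ring_axioms])
  have neg: "\<ominus> a \<in> I" if "a \<in> I" for a
  proof -
    have "a \<in> carrier R" using that sub by blast
    then have "\<ominus> a = \<ominus> \<one> \<otimes> a" by (simp add: l_minus)
    then show ?thesis using mult[OF that, of "\<ominus> \<one>"] by simp
  qed
  show "subgroup I (add_monoid R)"
    by (rule add.subgroupI) (use sub zero add neg in \<open>auto simp: a_inv_def\<close>)
  show "r \<otimes> a \<in> I" if "a \<in> I" "r \<in> carrier R" for a r using mult that .
  then show "a \<otimes> r \<in> I" if "a \<in> I" "r \<in> carrier R" for a r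
    using that sub m_comm[of a r] by auto
qed

lemma (in cring) primeidealI_iff:
  assumes sub: "P \<subseteq> carrier R" and zero: "\<zero> \<in> P" and one: "\<one> \<notin> P"
    and add: "\<And>a b. a \<in> P \<Longrightarrow> b \<in> P \<Longrightarrow> a \<oplus> b \<in> P"
    and mult: "\<And>a b. a \<in> carrier R \<Longrightarrow> b \<in> carrier R \<Longrightarrow> a \<otimes> b \<in> P \<longleftrightarrow> a \<in> P \<or> b \<in> P"
  shows "primeideal P R"
proof (rule primeidealI)
  show "ideal P R" by (rule ideal_leftI) (use sub zero add mult in auto)
  show "cring R" by (rule is_cring)
  show "carrier R \<noteq> P" using one by auto
  show "a \<in> P \<or> b \<in> P" if "a \<in> carrier R" "b \<in> carrier R" "a \<otimes> b \<in> P" for a b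
    using mult that by simp
qed

text \<open>Primes of a subring are handled as plain subsets, so that rings of functions on
  different open sets can be compared without ring records. The right to left half of the last
  condition is absorption.\<close>

definition prime_in :: "'k::comm_ring_1 set \<Rightarrow> 'k set \<Rightarrow> bool" where
  "prime_in C q \<longleftrightarrow> q \<subseteq> C \<and> 0 \<in> q \<and> 1 \<notin> q \<and> (\<forall>x\<in>q. \<forall>y\<in>q. x + y \<in> q) \<and>
     (\<forall>x\<in>C. \<forall>y\<in>C. x * y \<in> q \<longleftrightarrow> x \<in> q \<or> y \<in> q)"

context embedded_domain
begin

lemma prime_contract:
  assumes q: "prime_in C q" and C: "\<iota> ` carrier R \<subseteq> C"
  shows "primeideal {a \<in> carrier R. \<iota> a \<in> q} R"
proof (rule primeidealI_iff)
  show "a \<otimes> b \<in> {a \<in> carrier R. \<iota> a \<in> q} \<longleftrightarrow> a \<in> {a \<in> carrier R. \<iota> a \<in> q} \<or> b \<in> {a \<in> carrier R. \<iota> a \<in> q}"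
    if "a \<in> carrier R" "b \<in> carrier R" for a b
  proof -
    have "\<iota> a \<in> C" "\<iota> b \<in> C" using that C by auto
    then show ?thesis using q that by (auto simp: prime_in_def emb_mult)
  qed
qed (use q in \<open>auto simp: prime_in_def emb_zero emb_one emb_add\<close>)

lemma prime_image:
  assumes Q: "primeideal Q R"
  shows "prime_in (\<iota> ` carrier R) (\<iota> ` Q)"
  unfolding prime_in_def
proof (intro conjI ballI)
  note Q' = primeideal_simps[OF Q]
  have mem: "\<iota> a \<in> \<iota> ` Q \<longleftrightarrow> a \<in> Q" if "a \<in> carrier R" for a
    using that Q'(1) emb_inj by (auto dest: inj_onD)
  show "\<iota> ` Q \<subseteq> \<iota> ` carrier R" using Q'(1) by auto
  show "0 \<in> \<iota> ` Q" using mem[of \<zero>] Q' emb_zero by simp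
  show "1 \<notin> \<iota> ` Q" using mem[of \<one>] Q' emb_one by simp
  show "x + y \<in> \<iota> ` Q" if xy: "x \<in> \<iota> ` Q" "y \<in> \<iota> ` Q" for x y
  proof -
    obtain a b where ab: "a \<in> Q" "b \<in> Q" "x = \<iota> a" "y = \<iota> b" using xy by auto
    then have "x + y = \<iota> (a \<oplus> b)" using Q'(1) by (simp add: emb_add subset_iff)
    then show ?thesis using Q'(4)[OF ab(1,2)] by simp
  qed
  show "x * y \<in> \<iota> ` Q \<longleftrightarrow> x \<in> \<iota> ` Q \<or> y \<in> \<iota> ` Q"
    if xy: "x \<in> \<iota> ` carrier R" "y \<in> \<iota> ` carrier R" for x y
  proof -
    obtain a b where ab: "a \<in> carrier R" "b \<in> carrier R" "x = \<iota> a" "y = \<iota> b" using xy by auto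
    then have "x * y = \<iota> (a \<otimes> b)" by (simp add: emb_mult)
    then show ?thesis using mem Q'(5)[OF ab(1,2)] ab by simp
  qed
qed

lemma emb_minus_one: "\<iota> (\<ominus> \<one>) = - 1"
proof -
  have "\<iota> (\<one> \<oplus> \<ominus> \<one>) = 0" by (simp only: r_neg one_closed emb_zero)
  then show ?thesis
    using emb_add[of \<one> "\<ominus> \<one>"] by (simp add: emb_one) (metis add_eq_0_iff)
qed

lemma regular_uminus:
  assumes "openin (zariski R) V" "k \<in> regular V"
  shows "- k \<in> regular V"
  using regular_closed(1)[OF assms(1) emb_in_regular[OF assms(1), of "\<ominus> \<one>"] assms(2)]
  by (simp add: emb_minus_one)

lemma zero_in_regular: "openin (zariski R) V \<Longrightarrow> 0 \<in> regular V"
  using emb_in_regular[of V \<zero>] emb_zero by simp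

lemma sect_zero: "openin (zariski R) V \<Longrightarrow> \<zero>\<^bsub>structure_sheaf R V\<^esub> = sect V 0"
  using open_subset[of V] fraction_eq_germ[of _ \<zero> \<one>] primeideal_simps(3)
  by (auto intro!: restrict_ext simp: structure_sheaf_def sect_def localization_def emb_zero emb_one)

text \<open>All ring laws are transported from the field along \<open>sect V\<close>. The result
  serves as the ring \<open>B\<close> in \<open>affine_scheme\<close>, whose elements must have the
  type of sections.\<close>

lemma structure_sheaf_embedded:
  assumes V: "openin (zariski R) V" "V \<noteq> {}"
  shows "embedded_domain (structure_sheaf R V) (inv_into (regular V) (sect V))"
proof -
  let ?S = "structure_sheaf R V"
  note car = carrier_structure_sheaf[OF V]
  note hom = sect_hom[OF V(1)] sect_one[OF V(1)] sect_zero[OF V(1)]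
  note cl = regular_closed[OF V(1)] one_in_regular[OF V(1)] zero_in_regular[OF V(1)]
    regular_uminus[OF V(1)]
  note eq = inj_on_eq_iff[OF sect_inj[OF V]]
  have "cring ?S"
  proof (rule cringI)
    show "abelian_group ?S"
    proof (rule abelian_groupI)
      show "\<exists>y\<in>carrier ?S. y \<oplus>\<^bsub>?S\<^esub> x = \<zero>\<^bsub>?S\<^esub>" if "x \<in> carrier ?S" for x
      proof -
        obtain k where k: "k \<in> regular V" "x = sect V k"
          using \<open>x \<in> carrier ?S\<close> unfolding car by auto
        then show ?thesis using cl(5)[OF k(1)] by (intro bexI[of _ "sect V (- k)"]) (auto simp: hom car)
      qed
    qed (auto simp: car hom cl add_ac)
    show "comm_monoid ?S"
      by (rule comm_monoidI) (auto simp: car hom cl mult_ac)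
  qed (auto simp: car hom cl algebra_simps)
  then have "domain ?S"
  proof (rule domain.intro, unfold_locales)
    show "\<one>\<^bsub>?S\<^esub> \<noteq> \<zero>\<^bsub>?S\<^esub>" using eq[of 1 0] cl by (simp add: hom)
    show "x = \<zero>\<^bsub>?S\<^esub> \<or> y = \<zero>\<^bsub>?S\<^esub>"
      if "x \<otimes>\<^bsub>?S\<^esub> y = \<zero>\<^bsub>?S\<^esub>" "x \<in> carrier ?S" "y \<in> carrier ?S" for x y
      using that cl by (auto simp: car hom eq)
  qed
  then show ?thesis
  proof (rule embedded_domain.intro, unfold_locales)
    show "inj_on (inv_into (regular V) (sect V)) (carrier ?S)"
      unfolding car by (rule inj_on_inv_into) simp
  qed (auto simp: car hom cl inv_into_f_f[OF sect_inj[OF V]])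
qed

lemma image_inv_sect:
  assumes V: "openin (zariski R) V" "V \<noteq> {}"
  shows "inv_into (regular V) (sect V) ` carrier (structure_sheaf R V) = regular V"
  using inv_into_image_cancel[OF sect_inj[OF V], of "regular V"]
  by (auto simp: carrier_structure_sheaf[OF V] inv_into_f_f[OF sect_inj[OF V]])

end

text \<open>
  \<open>B\<close> is a copy of the ring \<open>O(U)\<close>. The points \<open>P\<close> of \<open>U\<close> and \<open>phi P\<close> of \<open>Spec B\<close> have the same stalk in
  \<open>'k\<close>, so the structure sheaves agree once the topologies do.
\<close>
locale affine_pair = R: embedded_domain R \<iota> + B: embedded_domain B \<kappa>
  for R :: "('a, 'm) ring_scheme" and \<iota> :: "'a \<Rightarrow> 'k::field"
    and B :: "('b, 'n) ring_scheme" and \<kappa> :: "'b \<Rightarrow> 'k" +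
  fixes U :: "'a set set"
  assumes U: "openin (zariski R) U" "U \<noteq> {}"
    and image: "\<kappa> ` carrier B = R.regular U"
    and crit: "\<And>q. prime_in (R.regular U) q \<Longrightarrow> {a \<in> carrier R. \<iota> a \<in> q} \<in> U"
begin

text \<open>The contraction to \<open>B\<close> of the maximal ideal of the stalk at
  \<open>P\<close>.\<close>

definition phi :: "'a set \<Rightarrow> 'b set" where
  "phi P = {b \<in> carrier B. \<exists>a\<in>P. \<exists>s\<in>carrier R - P. \<kappa> b * \<iota> s = \<iota> a}"

text \<open>The contraction of \<open>Q\<close> along the restriction map from \<open>R\<close> to
  functions on \<open>U\<close>.\<close>

definition chi :: "'b set \<Rightarrow> 'a set" where
  "chi Q = {a \<in> carrier R. \<iota> a \<in> \<kappa> ` Q}"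

lemma prime_U: "P \<in> U \<Longrightarrow> primeideal P R"
  using R.open_subset[OF U(1)] .

text \<open>Two fractions for the same element differ by cross multiplication with denominators
  outside \<open>P\<close>, so vanishing at \<open>P\<close> can be read off from any one
  numerator.\<close>

lemma phi_iff:
  assumes P: "P \<in> U" and b: "b \<in> carrier B" and as: "a \<in> carrier R" "s \<in> carrier R - P"
    and eq: "\<kappa> b = \<iota> a / \<iota> s"
  shows "b \<in> phi P \<longleftrightarrow> a \<in> P"
proof
  note P' = R.primeideal_simps[OF prime_U[OF P]]
  note s0 = R.emb_nonzero[OF prime_U[OF P]]
  assume "b \<in> phi P"
  then obtain a' s' where a': "a' \<in> P" "s' \<in> carrier R - P" "\<kappa> b * \<iota> s' = \<iota> a'"
    by (auto simp: phi_def)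
  have "a' \<in> carrier R" using a' P' by auto
  then have "\<iota> (a \<otimes>\<^bsub>R\<^esub> s') = \<iota> (a' \<otimes>\<^bsub>R\<^esub> s)"
    using a' as eq s0[OF as(2)] by (simp add: R.emb_mult field_simps)
  then have "a \<otimes>\<^bsub>R\<^esub> s' = a' \<otimes>\<^bsub>R\<^esub> s"
    using R.emb_eq_iff as a' \<open>a' \<in> carrier R\<close> by simp
  moreover have "a' \<otimes>\<^bsub>R\<^esub> s \<in> P" using P'(5)[of a' s] as a' \<open>a' \<in> carrier R\<close> by simp
  ultimately show "a \<in> P" using P'(5)[of a s'] as a' by simp
next
  assume "a \<in> P"
  then show "b \<in> phi P"
    using b as eq R.emb_nonzero[OF prime_U[OF P] as(2)] unfolding phi_def
    by (intro CollectI conjI bexI[of _ s] bexI[of _ a]) simp_all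
qed

lemma repr:
  assumes P: "P \<in> U" and b: "b \<in> carrier B"
  obtains a s where "a \<in> carrier R" "s \<in> carrier R - P" "\<kappa> b = \<iota> a / \<iota> s" "\<iota> s \<noteq> 0"
    "b \<in> phi P \<longleftrightarrow> a \<in> P"
proof -
  have "\<kappa> b \<in> R.stalk P" using image b P by (auto simp: R.regular_def)
  then obtain a s where as: "a \<in> carrier R" "s \<in> carrier R - P" "\<kappa> b = \<iota> a / \<iota> s" "\<iota> s \<noteq> 0"
    using R.stalkE[OF prime_U[OF P]] by metis
  then show thesis using that phi_iff[OF P b as(1-3)] by simp
qed

lemma lift:
  assumes "a \<in> carrier R"
  obtains b where "b \<in> carrier B" "\<kappa> b = \<iota> a"
proof -
  have "\<iota> a \<in> \<kappa> ` carrier B" using R.emb_in_regular[OF U(1) assms] image by simp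
  then show thesis using that by auto
qed

lemma phi_prime:
  assumes P: "P \<in> U"
  shows "primeideal (phi P) B"
proof (rule B.primeidealI_iff)
  note P' = R.primeideal_simps[OF prime_U[OF P]]
  have one: "\<one>\<^bsub>R\<^esub> \<in> carrier R - P" using P' by simp
  show "phi P \<subseteq> carrier B" by (auto simp: phi_def)
  show "\<zero>\<^bsub>B\<^esub> \<in> phi P"
    using phi_iff[OF P B.zero_closed R.zero_closed one] P' by (simp add: R.emb_zero B.emb_zero)
  show "\<one>\<^bsub>B\<^esub> \<notin> phi P"
    using phi_iff[OF P B.one_closed R.one_closed one] P' by (simp add: R.emb_one B.emb_one)
  fix b b'
  show "b \<oplus>\<^bsub>B\<^esub> b' \<in> phi P" if b: "b \<in> phi P" "b' \<in> phi P"
  proof -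
    have c: "b \<in> carrier B" "b' \<in> carrier B" using b by (auto simp: phi_def)
    obtain a s where a: "a \<in> carrier R" "s \<in> carrier R - P" "\<kappa> b = \<iota> a / \<iota> s" "\<iota> s \<noteq> 0" "a \<in> P"
      using repr[OF P c(1)] b by metis
    obtain a' s' where a': "a' \<in> carrier R" "s' \<in> carrier R - P" "\<kappa> b' = \<iota> a' / \<iota> s'" "\<iota> s' \<noteq> 0" "a' \<in> P"
      using repr[OF P c(2)] b by metis
    have st: "s \<otimes>\<^bsub>R\<^esub> s' \<in> carrier R - P" using a a' P'(5)[of s s'] by simp
    have "\<kappa> (b \<oplus>\<^bsub>B\<^esub> b') = \<iota> (a \<otimes>\<^bsub>R\<^esub> s' \<oplus>\<^bsub>R\<^esub> a' \<otimes>\<^bsub>R\<^esub> s) / \<iota> (s \<otimes>\<^bsub>R\<^esub> s')"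
      using a a' c by (simp add: R.emb_mult R.emb_add B.emb_add field_simps)
    moreover have "a \<otimes>\<^bsub>R\<^esub> s' \<oplus>\<^bsub>R\<^esub> a' \<otimes>\<^bsub>R\<^esub> s \<in> P"
      using a a' P'(5)[of a s'] P'(5)[of a' s] by (intro P'(4)) simp_all
    ultimately show ?thesis
      using phi_iff[OF P _ _ st, of "b \<oplus>\<^bsub>B\<^esub> b'" "a \<otimes>\<^bsub>R\<^esub> s' \<oplus>\<^bsub>R\<^esub> a' \<otimes>\<^bsub>R\<^esub> s"] c a a' by simp
  qed
  show "b \<otimes>\<^bsub>B\<^esub> b' \<in> phi P \<longleftrightarrow> b \<in> phi P \<or> b' \<in> phi P" if c: "b \<in> carrier B" "b' \<in> carrier B"
  proof -
    obtain a s where a: "a \<in> carrier R" "s \<in> carrier R - P" "\<kappa> b = \<iota> a / \<iota> s" "\<iota> s \<noteq> 0"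
      "b \<in> phi P \<longleftrightarrow> a \<in> P"
      using repr[OF P c(1)] by metis
    obtain a' s' where a': "a' \<in> carrier R" "s' \<in> carrier R - P" "\<kappa> b' = \<iota> a' / \<iota> s'" "\<iota> s' \<noteq> 0"
      "b' \<in> phi P \<longleftrightarrow> a' \<in> P"
      using repr[OF P c(2)] by metis
    have st: "s \<otimes>\<^bsub>R\<^esub> s' \<in> carrier R - P" using a a' P'(5)[of s s'] by simp
    have "\<kappa> (b \<otimes>\<^bsub>B\<^esub> b') = \<iota> (a \<otimes>\<^bsub>R\<^esub> a') / \<iota> (s \<otimes>\<^bsub>R\<^esub> s')"
      using a a' c by (simp add: R.emb_mult B.emb_mult)
    then have "b \<otimes>\<^bsub>B\<^esub> b' \<in> phi P \<longleftrightarrow> a \<otimes>\<^bsub>R\<^esub> a' \<in> P"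
      using phi_iff[OF P, of "b \<otimes>\<^bsub>B\<^esub> b'"] c a(1) a'(1) st by simp
    then show ?thesis using P'(5)[OF a(1) a'(1)] a(5) a'(5) by simp
  qed
qed

text \<open>The only use of \<open>crit\<close>: it puts contracted primes into \<open>U\<close>,
  which is what makes \<open>chi\<close> an inverse of \<open>phi\<close>.\<close>

lemma chi_in_U:
  assumes "primeideal Q B"
  shows "chi Q \<in> U"
  using crit[of "\<kappa> ` Q"] B.prime_image[OF assms] image by (simp add: chi_def)

lemma chi_iff:
  assumes "primeideal Q B" "a \<in> carrier R" "b \<in> carrier B" "\<kappa> b = \<iota> a"
  shows "a \<in> chi Q \<longleftrightarrow> b \<in> Q"
proof
  assume "a \<in> chi Q"
  then obtain b' where b': "b' \<in> Q" "\<kappa> b' = \<kappa> b" using assms by (auto simp: chi_def)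
  then have "b' = b" using B.primeideal_simps(1)[OF assms(1)] assms B.emb_eq_iff by (metis subset_iff)
  then show "b \<in> Q" using b' by simp
next
  assume "b \<in> Q"
  then show "a \<in> chi Q" using assms by (auto simp: chi_def intro!: image_eqI[of _ _ b])
qed

lemma phi_chi:
  assumes Q: "primeideal Q B"
  shows "phi (chi Q) = Q"
proof -
  note U' = chi_in_U[OF Q]
  have "b \<in> phi (chi Q) \<longleftrightarrow> b \<in> Q" if b: "b \<in> carrier B" for b
  proof -
    obtain a s where a: "a \<in> carrier R" "s \<in> carrier R - chi Q" "\<kappa> b = \<iota> a / \<iota> s" "\<iota> s \<noteq> 0"
      "b \<in> phi (chi Q) \<longleftrightarrow> a \<in> chi Q" using repr[OF U' b] .
    obtain a' where a': "a' \<in> carrier B" "\<kappa> a' = \<iota> a" using lift[OF a(1)] .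
    obtain s' where s': "s' \<in> carrier B" "\<kappa> s' = \<iota> s" using lift[of s] a(2) by blast
    \<comment> \<open>The fraction \<open>b = a / s\<close> with \<open>s\<close> outside the
      contraction becomes \<open>b s' = a'\<close> in \<open>B\<close> with \<open>s'\<close>
      outside \<open>Q\<close>, so \<open>b\<close> and \<open>a'\<close> lie in \<open>Q\<close>
      together.\<close>
    have "\<kappa> a' = \<kappa> (b \<otimes>\<^bsub>B\<^esub> s')" using a a' s' b by (simp add: B.emb_mult)
    then have "a' = b \<otimes>\<^bsub>B\<^esub> s'" using B.emb_eq_iff a' s' b by simp
    then have "a' \<in> Q \<longleftrightarrow> b \<in> Q \<or> s' \<in> Q" using B.primeideal_simps(5)[OF Q b s'(1)] by simp
    then show ?thesis using chi_iff[OF Q _ a'(1,2)] chi_iff[OF Q _ s'] a by simp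
  qed
  moreover have "phi (chi Q) \<subseteq> carrier B" by (auto simp: phi_def)
  ultimately show ?thesis using B.primeideal_simps(1)[OF Q] by (intro subset_antisym subsetI) (metis subset_iff)+
qed

lemma chi_phi:
  assumes P: "P \<in> U"
  shows "chi (phi P) = P"
proof -
  note P' = R.primeideal_simps[OF prime_U[OF P]]
  have "a \<in> chi (phi P) \<longleftrightarrow> a \<in> P" if a: "a \<in> carrier R" for a
  proof -
    obtain b where b: "b \<in> carrier B" "\<kappa> b = \<iota> a" using lift[OF a] .
    have "b \<in> phi P \<longleftrightarrow> a \<in> P"
      by (rule phi_iff[OF P b(1) a, of "\<one>\<^bsub>R\<^esub>"]) (use P' b in \<open>simp_all add: R.emb_one\<close>)
    then show ?thesis using chi_iff[OF phi_prime[OF P] a b] by simp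
  qed
  moreover have "chi (phi P) \<subseteq> carrier R" by (auto simp: chi_def)
  ultimately show ?thesis using P'(1) by (intro subset_antisym subsetI) (metis subset_iff)+
qed

lemma stalk_phi:
  assumes P: "P \<in> U"
  shows "B.stalk (phi P) = R.stalk P"
proof (intro subset_antisym subsetI)
  note P' = R.primeideal_simps[OF prime_U[OF P]]
  fix k assume "k \<in> B.stalk (phi P)"
  then obtain b t where b: "b \<in> carrier B" "t \<in> carrier B - phi P" "k = \<kappa> b / \<kappa> t" "\<kappa> t \<noteq> 0"
    using B.stalkE[OF phi_prime[OF P]] by metis
  obtain a s where a: "a \<in> carrier R" "s \<in> carrier R - P" "\<kappa> b = \<iota> a / \<iota> s" "\<iota> s \<noteq> 0"
    using repr[OF P b(1)] by metis
  obtain a' s' where a': "a' \<in> carrier R" "s' \<in> carrier R - P" "\<kappa> t = \<iota> a' / \<iota> s'" "\<iota> s' \<noteq> 0"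
    "t \<in> phi P \<longleftrightarrow> a' \<in> P"
    using repr[OF P, of t] b(2) by (metis DiffD1)
  have "s \<otimes>\<^bsub>R\<^esub> a' \<in> carrier R - P" using a a' b P'(5)[of s a'] by simp
  moreover have "k = \<iota> (a \<otimes>\<^bsub>R\<^esub> s') / \<iota> (s \<otimes>\<^bsub>R\<^esub> a')"
    unfolding b(3) a(3) a'(3) using a a' by (simp add: R.emb_mult)
  ultimately show "k \<in> R.stalk P"
    using R.stalk_divide[OF prime_U[OF P]] a a' by simp
next
  fix k assume "k \<in> R.stalk P"
  then obtain a s where a: "a \<in> carrier R" "s \<in> carrier R - P" "k = \<iota> a / \<iota> s" "\<iota> s \<noteq> 0"
    using R.stalkE[OF prime_U[OF P]] by metis
  obtain a' where a': "a' \<in> carrier B" "\<kappa> a' = \<iota> a" using lift[OF a(1)] .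
  obtain s' where s': "s' \<in> carrier B" "\<kappa> s' = \<iota> s" using lift[of s] a(2) by blast
  have "s' \<notin> phi P" using chi_iff[OF phi_prime[OF P] _ s'] a(2) chi_phi[OF P] by simp
  then show "k \<in> B.stalk (phi P)"
    using B.stalk_divide[OF phi_prime[OF P] a'(1), of s'] s' a' a by simp
qed

lemma openin_preimage:
  assumes V: "openin (zariski B) V"
  shows "openin (zariski R) {P \<in> U. phi P \<in> V}"
proof (subst openin_subopen, intro ballI)
  fix P assume P: "P \<in> {P \<in> U. phi P \<in> V}"
  obtain S where S: "S \<subseteq> carrier B" "V = spectrum B - zero_locus B S"
    using V by (auto simp: openin_zariski)
  with P obtain b where b: "b \<in> S" "b \<notin> phi P" by (auto simp: zero_locus_def)
  have bc: "b \<in> carrier B" using b S by auto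
  obtain a s where a: "a \<in> carrier R" "s \<in> carrier R - P" "\<kappa> b = \<iota> a / \<iota> s" "\<iota> s \<noteq> 0"
    "b \<in> phi P \<longleftrightarrow> a \<in> P"
    using repr[of P b] P bc by auto
  \<comment> \<open>Where neither numerator nor denominator of this fraction vanishes,
    \<open>b\<close> stays outside the image prime.\<close>
  define T where "T = U \<inter> ({P \<in> spectrum R. a \<notin> P} \<inter> {P \<in> spectrum R. s \<notin> P})"
  have "openin (zariski R) T"
    unfolding T_def using U a by (intro openin_Int R.open_basic) auto
  moreover have "P \<in> T" using P a b prime_U by (auto simp: T_def spectrum_def)
  moreover have "phi Q \<in> V" if "Q \<in> T" for Q
  proof -
    have Q: "Q \<in> U" "a \<notin> Q" "s \<notin> Q" using that by (auto simp: T_def)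
    then have "b \<notin> phi Q" using phi_iff[OF Q(1) bc a(1) _ a(3)] a(2) by simp
    then show ?thesis
      using S b phi_prime[OF Q(1)] by (auto simp: zero_locus_def spectrum_def)
  qed
  ultimately show "\<exists>T. openin (zariski R) T \<and> P \<in> T \<and> T \<subseteq> {P \<in> U. phi P \<in> V}"
    by (intro exI[of _ T]) (auto simp: T_def)
qed

lemma openin_image:
  assumes W: "openin (zariski R) W" "W \<subseteq> U"
  shows "openin (zariski B) {Q \<in> spectrum B. chi Q \<in> W}"
proof -
  obtain S where S: "S \<subseteq> carrier R" "W = spectrum R - zero_locus R S"
    using W by (auto simp: openin_zariski)
  define S' where "S' = {b \<in> carrier B. \<kappa> b \<in> \<iota> ` S}"
  have "chi Q \<in> W \<longleftrightarrow> \<not> S' \<subseteq> Q" if "Q \<in> spectrum B" for Q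
  proof -
    have Q: "primeideal Q B" using that by (simp add: spectrum_def)
    have "S \<subseteq> chi Q \<longleftrightarrow> S' \<subseteq> Q"
    proof
      assume *: "S \<subseteq> chi Q"
      show "S' \<subseteq> Q"
      proof
        fix b assume "b \<in> S'"
        then obtain a where "b \<in> carrier B" "a \<in> S" "\<kappa> b = \<iota> a" by (auto simp: S'_def)
        then show "b \<in> Q" using chi_iff[OF Q, of a b] S(1) * by auto
      qed
    next
      assume *: "S' \<subseteq> Q"
      show "S \<subseteq> chi Q"
      proof
        fix a assume a: "a \<in> S"
        then have ac: "a \<in> carrier R" using S by auto
        obtain b where b: "b \<in> carrier B" "\<kappa> b = \<iota> a" using lift[OF ac] .
        then have "b \<in> S'" using a by (auto simp: S'_def)
        then show "a \<in> chi Q" using chi_iff[OF Q ac b] * by auto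
      qed
    qed
    moreover have "chi Q \<in> spectrum R" using prime_U[OF chi_in_U[OF Q]] by (simp add: spectrum_def)
    ultimately show ?thesis using S by (simp add: zero_locus_def)
  qed
  then have "{Q \<in> spectrum B. chi Q \<in> W} = spectrum B - zero_locus B S'"
    by (auto simp: zero_locus_def)
  then show ?thesis unfolding openin_zariski by (intro exI[of _ S']) (auto simp: S'_def)
qed

lemma homeomorphic: "homeomorphic_maps (subtopology (zariski R) U) (zariski B) phi chi"
proof -
  have US: "U \<subseteq> spectrum R" using prime_U by (auto simp: spectrum_def)
  have top: "topspace (subtopology (zariski R) U) = U"
    using US by (auto simp: topspace_subtopology)
  have "continuous_map (subtopology (zariski R) U) (zariski B) phi"
    unfolding continuous_map_def top
    using phi_prime openin_preimage
    by (auto simp: openin_open_subtopology[OF U(1)] spectrum_def)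
  moreover have "continuous_map (zariski B) (subtopology (zariski R) U) chi"
    unfolding continuous_map_def top
    using chi_in_U openin_image
    by (auto simp: openin_open_subtopology[OF U(1)] spectrum_def)
  ultimately show ?thesis
    unfolding homeomorphic_maps_def top using phi_chi chi_phi by (auto simp: spectrum_def)
qed

text \<open>A section is read as an element \<open>k\<close> of the field and written again over the
  preimage. For empty \<open>V\<close> the description is not unique, but there
  \<open>R.sect\<close> has the same value for every \<open>k\<close>.\<close>

definition psi :: "'b set set \<Rightarrow> ('b set \<Rightarrow> ('b \<times> 'b) set) \<Rightarrow> 'a set \<Rightarrow> ('a \<times> 'a) set" where
  "psi V \<tau> = R.sect {P \<in> U. phi P \<in> V} (THE k. k \<in> B.regular V \<and> \<tau> = B.sect V k)"

lemma psi_sect: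
  assumes V: "openin (zariski B) V" "V \<noteq> {}" and k: "k \<in> B.regular V"
  shows "psi V (B.sect V k) = R.sect {P \<in> U. phi P \<in> V} k"
proof -
  have "(THE l. l \<in> B.regular V \<and> B.sect V k = B.sect V l) = k"
    using k B.sect_inj[OF V] by (intro the_equality) (auto dest: inj_onD)
  then show ?thesis by (simp add: psi_def)
qed

lemma preimage_nonempty:
  assumes V: "openin (zariski B) V" "V \<noteq> {}"
  shows "{P \<in> U. phi P \<in> V} \<noteq> {}"
proof -
  obtain Q where Q: "Q \<in> V" using V by auto
  then have "primeideal Q B" using B.open_subset[OF V(1)] by simp
  then have "chi Q \<in> {P \<in> U. phi P \<in> V}" using phi_chi chi_in_U Q by simp
  then show ?thesis by auto
qed

lemma regular_preimage:
  assumes V: "openin (zariski B) V"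
  shows "R.regular {P \<in> U. phi P \<in> V} = B.regular V"
proof (intro subset_antisym subsetI)
  fix k assume k: "k \<in> R.regular {P \<in> U. phi P \<in> V}"
  have "k \<in> B.stalk Q" if Q: "Q \<in> V" for Q
  proof -
    have Q': "primeideal Q B" using B.open_subset[OF V] Q by simp
    then have "k \<in> R.stalk (chi Q)" using k Q phi_chi chi_in_U by (simp add: R.regular_def)
    then show ?thesis using stalk_phi[OF chi_in_U[OF Q']] phi_chi[OF Q'] by simp
  qed
  then show "k \<in> B.regular V" by (simp add: B.regular_def)
next
  fix k assume "k \<in> B.regular V"
  then show "k \<in> R.regular {P \<in> U. phi P \<in> V}" using stalk_phi by (auto simp: B.regular_def R.regular_def)
qed

lemma psi_iso:
  assumes V: "openin (zariski B) V"
  shows "psi V \<in> ring_iso (structure_sheaf B V) (structure_sheaf R {P \<in> U. phi P \<in> V})"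
proof (cases "V = {}")
  case True
  then show ?thesis
    by (auto simp: ring_iso_def ring_hom_def carrier_structure_sheaf_empty psi_def R.sect_def
        structure_sheaf_def bij_betw_def restrict_def)
next
  case False
  let ?W = "{P \<in> U. phi P \<in> V}"
  note W = openin_preimage[OF V] preimage_nonempty[OF V False]
  note car = B.carrier_structure_sheaf[OF V False] R.carrier_structure_sheaf[OF W]
  note ps = psi_sect[OF V False]
  note rg = regular_preimage[OF V]
  have inj: "inj_on (psi V) (carrier (structure_sheaf B V))"
  proof (rule inj_onI)
    fix x y assume "x \<in> carrier (structure_sheaf B V)" "y \<in> carrier (structure_sheaf B V)" "psi V x = psi V y"
    then obtain k l where k: "k \<in> B.regular V" "l \<in> B.regular V" "x = B.sect V k" "y = B.sect V l"
      "R.sect ?W k = R.sect ?W l" by (auto simp: car ps)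
    have "k = l" by (rule inj_onD[OF R.sect_inj[OF W] k(5)]) (use k(1,2) rg in simp_all)
    then show "x = y" using k by simp
  qed
  have "psi V ` carrier (structure_sheaf B V) = carrier (structure_sheaf R ?W)"
    unfolding car image_image rg using ps by (intro image_cong) auto
  moreover have "psi V \<in> ring_hom (structure_sheaf B V) (structure_sheaf R ?W)"
    by (rule ring_hom_memI)
      (auto simp: car ps rg B.sect_hom[OF V] R.sect_hom[OF W(1)] B.sect_one[OF V] R.sect_one[OF W(1)]
        B.regular_closed[OF V] B.one_in_regular[OF V])
  ultimately show ?thesis using inj by (simp add: ring_iso_def bij_betw_def)
qed

lemma psi_natural:
  assumes VW: "openin (zariski B) V" "openin (zariski B) W" "W \<subseteq> V"
    and \<tau>: "\<tau> \<in> carrier (structure_sheaf B V)"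
  shows "psi W (restrict \<tau> W) = restrict (psi V \<tau>) {P \<in> U. phi P \<in> W}"
proof (cases "W = {}")
  case True
  then show ?thesis by (simp add: psi_def R.sect_def restrict_def)
next
  case False
  then have V: "V \<noteq> {}" using VW by auto
  obtain k where k: "k \<in> B.regular V" "\<tau> = B.sect V k"
    using \<tau> B.carrier_structure_sheaf[OF VW(1) V] by auto
  then have "k \<in> B.regular W" using VW by (auto simp: B.regular_def)
  moreover have "{P \<in> U. phi P \<in> W} \<subseteq> {P \<in> U. phi P \<in> V}" using VW(3) by auto
  ultimately show ?thesis
    using k VW psi_sect[OF VW(1) V k(1)] psi_sect[OF VW(2) False]
    by (simp add: B.restrict_sect R.restrict_sect)
qed

lemma ringed_iso: "ringed_iso (open_subspace (Spec R) U) (Spec B)"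
proof -
  have "topspace (subtopology (zariski R) U) = U"
    using prime_U by (auto simp: topspace_subtopology spectrum_def)
  moreover have "homeomorphic_map (subtopology (zariski R) U) (zariski B) phi"
    using homeomorphic by (auto simp: homeomorphic_map_maps)
  ultimately show ?thesis
    unfolding ringed_iso_def Let_def Spec_def open_subspace_def ringed_space.simps
    using psi_iso psi_natural
    by (intro exI[of _ phi] exI[of _ psi]) auto
qed

end

section \<open>Necessity of the criterion\<close>

lemma (in cring) openin_spectrum: "openin (zariski R) (spectrum R)"
  using openin_topspace[of "zariski R"] by simp

definition (in cring) const_sect :: "'a \<Rightarrow> 'a set \<Rightarrow> ('a \<times> 'a) set" where
  "const_sect b = (\<lambda>P\<in>spectrum R. fraction R P b \<one>)"

lemma (in cring) const_sect_carrier: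
  assumes b: "b \<in> carrier R"
  shows "const_sect b \<in> carrier (structure_sheaf R (spectrum R))"
proof -
  have one: "\<one> \<notin> P" if "P \<in> spectrum R" for P
    using that primeideal_simps(3) by (simp add: spectrum_def)
  have "fraction R P b \<one> \<in> carrier (localization R P)" if "P \<in> spectrum R" for P
    using b one[OF that] unfolding localization_def partial_object.simps
    by (intro CollectI exI[of _ b] exI[of _ \<one>]) simp
  then have "const_sect b \<in> (\<Pi>\<^sub>E P\<in>spectrum R. carrier (localization R P))"
    by (auto simp: const_sect_def)
  moreover have "\<exists>V a f. openin (zariski R) V \<and> P \<in> V \<and> V \<subseteq> spectrum R \<and> a \<in> carrier R \<and> f \<in> carrier R \<and>
         (\<forall>Q\<in>V. f \<notin> Q \<and> const_sect b Q = fraction R Q a f)" if "P \<in> spectrum R" for P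
    using that b one openin_spectrum
    by (intro exI[of _ "spectrum R"] exI[of _ b] exI[of _ \<one>]) (simp add: const_sect_def)
  ultimately show ?thesis by (simp add: structure_sheaf_def)
qed

lemma (in cring) const_sect_hom:
  assumes b: "a \<in> carrier R" "b \<in> carrier R"
  shows "const_sect a \<otimes>\<^bsub>structure_sheaf R (spectrum R)\<^esub> const_sect b = const_sect (a \<otimes> b)"
    "const_sect a \<oplus>\<^bsub>structure_sheaf R (spectrum R)\<^esub> const_sect b = const_sect (a \<oplus> b)"
proof -
  have P: "primeideal P R" "\<one> \<in> carrier R - P" if "P \<in> spectrum R" for P
    using that primeideal_simps(3)[of P] by (simp_all add: spectrum_def)
  show "const_sect a \<otimes>\<^bsub>structure_sheaf R (spectrum R)\<^esub> const_sect b = const_sect (a \<otimes> b)"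
    using localization_mult[OF P(1) b(1) P(2) b(2) P(2)]
    by (auto intro!: restrict_ext simp: structure_sheaf_def const_sect_def)
  show "const_sect a \<oplus>\<^bsub>structure_sheaf R (spectrum R)\<^esub> const_sect b = const_sect (a \<oplus> b)"
    using localization_add[OF P(1) b(1) P(2) b(2) P(2)] b
    by (auto intro!: restrict_ext simp: structure_sheaf_def const_sect_def)
qed

lemma (in cring) const_sect_one: "\<one>\<^bsub>structure_sheaf R (spectrum R)\<^esub> = const_sect \<one>"
  by (simp add: structure_sheaf_def const_sect_def localization_def)

text \<open>The elements \<open>u\<close> with \<open>u a = u b\<close> form an ideal. Equality of
  the germs at \<open>P\<close> gives such a \<open>u\<close> outside \<open>P\<close>, so no prime
  contains the ideal, and it contains \<open>1\<close>.\<close>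

lemma (in cring) const_sect_inj:
  assumes a: "a \<in> carrier R" and b: "b \<in> carrier R" and eq: "const_sect a = const_sect b"
  shows "a = b"
proof -
  define J where "J = {u \<in> carrier R. u \<otimes> a = u \<otimes> b}"
  have "ideal J R"
    by (rule ideal_leftI) (use a b in \<open>auto simp: J_def l_distr m_assoc\<close>)
  moreover have "\<not> J \<subseteq> P" if P: "primeideal P R" for P
  proof -
    have one: "\<one> \<in> carrier R - P" using primeideal_simps(3)[OF P] by simp
    have "fraction R P a \<one> = fraction R P b \<one>"
      using fun_cong[OF eq, of P] P by (simp add: const_sect_def spectrum_def)
    then have "(a, \<one>) \<in> fraction R P b \<one>" using fraction_self[OF P a one] by simp
    then obtain u where "u \<in> carrier R - P" "u \<otimes> (b \<otimes> \<one>) = u \<otimes> (a \<otimes> \<one>)"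
      using mem_fraction_iff[OF P b one_closed] by metis
    then have "u \<in> J" "u \<notin> P" using a b by (auto simp: J_def)
    then show ?thesis by auto
  qed
  ultimately have "\<one> \<in> J" using exists_primeideal by metis
  then show ?thesis using a b by (simp add: J_def)
qed

text \<open>\<open>B\<close> is an arbitrary ring; the isomorphism on global sections embeds it in
  the field with image \<open>regular U\<close>, and \<open>q\<close> becomes a prime
  \<open>Q\<close> of \<open>B\<close>. The homeomorphism \<phi> is given abstractly, so the point
  \<open>P\<close> of \<open>U\<close> over \<open>Q\<close> is not known to be the contraction of
  \<open>q\<close>. Only one inclusion is proved, and openness of \<open>U\<close> does the
  rest.\<close>

lemma (in embedded_domain) prime_contract_in_open:
  fixes B :: "('b, 'n) ring_scheme"
  assumes U: "openin (zariski R) U" "U \<noteq> {}" and B: "cring B"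
    and iso: "ringed_iso (open_subspace (Spec R) U) (Spec B)"
    and q: "prime_in (regular U) q"
  shows "{a \<in> carrier R. \<iota> a \<in> q} \<in> U"
proof -
  interpret B: cring B by fact
  let ?T = "spectrum B"
  have topU: "topspace (subtopology (zariski R) U) = U"
    using open_subset[OF U(1)] by (auto simp: topspace_subtopology spectrum_def)
  from iso obtain \<phi> \<psi> where *: "homeomorphic_map (subtopology (zariski R) U) (zariski B) \<phi> \<and>
      (\<forall>V. openin (zariski B) V \<longrightarrow>
        \<psi> V \<in> ring_iso (structure_sheaf B V) (structure_sheaf R {x \<in> U. \<phi> x \<in> V})) \<and>
      (\<forall>V W. openin (zariski B) V \<and> openin (zariski B) W \<and> W \<subseteq> V \<longrightarrow>
        (\<forall>\<sigma> \<in> carrier (structure_sheaf B V).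
          \<psi> W (restrict \<sigma> W) = restrict (\<psi> V \<sigma>) {x \<in> U. \<phi> x \<in> W}))"
    unfolding ringed_iso_def Let_def Spec_def open_subspace_def ringed_space.simps topU by (elim exE)
  note \<phi> = conjunct1[OF *]
  have \<psi>: "\<psi> V \<in> ring_iso (structure_sheaf B V) (structure_sheaf R {x \<in> U. \<phi> x \<in> V})"
    if "openin (zariski B) V" for V using * that by simp
  have nat: "\<psi> W (restrict \<sigma> W) = restrict (\<psi> V \<sigma>) {x \<in> U. \<phi> x \<in> W}"
    if "openin (zariski B) V" "openin (zariski B) W" "W \<subseteq> V" "\<sigma> \<in> carrier (structure_sheaf B V)"
    for V W \<sigma> using * that by simp
  have \<phi>_im: "\<phi> ` U = ?T"
    using homeomorphic_imp_surjective_map[OF \<phi>] topU by simp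
  then have preT: "{x \<in> U. \<phi> x \<in> ?T} = U" by auto
  note T = B.openin_spectrum
  note \<psi>T = \<psi>[OF T, unfolded preT]
  have hom: "\<psi> ?T \<in> ring_hom (structure_sheaf B ?T) (structure_sheaf R U)"
    and bij: "bij_betw (\<psi> ?T) (carrier (structure_sheaf B ?T)) (carrier (structure_sheaf R U))"
    using \<psi>T by (auto simp: ring_iso_def)
  note car = carrier_structure_sheaf[OF U]
  \<comment> \<open>An element of \<open>B\<close> becomes a global section, is carried to
    \<open>U\<close> by the isomorphism, and is read as an element of the field.\<close>
  define \<kappa> where "\<kappa> b = inv_into (regular U) (sect U) (\<psi> ?T (B.const_sect b))" for b
  have \<kappa>: "\<kappa> b \<in> regular U" "sect U (\<kappa> b) = \<psi> ?T (B.const_sect b)" if b: "b \<in> carrier B" for b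
  proof -
    have "\<psi> ?T (B.const_sect b) \<in> sect U ` regular U"
      using bij_betwE[OF bij] B.const_sect_carrier[OF b] car by auto
    then show "\<kappa> b \<in> regular U" "sect U (\<kappa> b) = \<psi> ?T (B.const_sect b)"
      unfolding \<kappa>_def by (auto intro: inv_into_into f_inv_into_f)
  qed
  note eqU = inj_onD[OF sect_inj[OF U]]
  have \<kappa>_mult: "\<kappa> (a \<otimes>\<^bsub>B\<^esub> b) = \<kappa> a * \<kappa> b" if "a \<in> carrier B" "b \<in> carrier B" for a b
  proof (rule eqU)
    show "sect U (\<kappa> (a \<otimes>\<^bsub>B\<^esub> b)) = sect U (\<kappa> a * \<kappa> b)"
      using that ring_hom_mult[OF hom B.const_sect_carrier B.const_sect_carrier, of a b]
      by (simp add: \<kappa> B.const_sect_hom flip: sect_hom[OF U(1) \<kappa>(1) \<kappa>(1)])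
  qed (use that \<kappa> regular_closed[OF U(1)] in auto)
  have \<kappa>_add: "\<kappa> (a \<oplus>\<^bsub>B\<^esub> b) = \<kappa> a + \<kappa> b" if "a \<in> carrier B" "b \<in> carrier B" for a b
  proof (rule eqU)
    show "sect U (\<kappa> (a \<oplus>\<^bsub>B\<^esub> b)) = sect U (\<kappa> a + \<kappa> b)"
      using that ring_hom_add[OF hom B.const_sect_carrier B.const_sect_carrier, of a b]
      by (simp add: \<kappa> B.const_sect_hom flip: sect_hom[OF U(1) \<kappa>(1) \<kappa>(1)])
  qed (use that \<kappa> regular_closed[OF U(1)] in auto)
  have \<kappa>_one: "\<kappa> \<one>\<^bsub>B\<^esub> = 1"
  proof (rule eqU)
    show "sect U (\<kappa> \<one>\<^bsub>B\<^esub>) = sect U 1"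
      using ring_hom_one[OF hom] by (simp add: \<kappa> B.const_sect_one sect_one[OF U(1)])
  qed (use \<kappa> one_in_regular[OF U(1)] in auto)
  have \<kappa>_inj: "inj_on \<kappa> (carrier B)"
  proof (rule inj_onI)
    fix a b assume ab: "a \<in> carrier B" "b \<in> carrier B" "\<kappa> a = \<kappa> b"
    then have "\<psi> ?T (B.const_sect a) = \<psi> ?T (B.const_sect b)" using \<kappa>(2) by metis
    then have "B.const_sect a = B.const_sect b"
      using B.const_sect_carrier ab by (intro inj_onD[OF bij_betw_imp_inj_on[OF bij]]) auto
    then show "a = b" using B.const_sect_inj ab by metis
  qed
  have \<kappa>_zero: "\<kappa> \<zero>\<^bsub>B\<^esub> = 0"
    using \<kappa>_add[of "\<zero>\<^bsub>B\<^esub>" "\<zero>\<^bsub>B\<^esub>"] by (metis B.zero_closed B.r_zero add_cancel_right_right)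
  have "domain B"
  proof (rule domain.intro[OF B], unfold_locales)
    show "\<one>\<^bsub>B\<^esub> \<noteq> \<zero>\<^bsub>B\<^esub>" using \<kappa>_one \<kappa>_zero by auto
    fix a b assume ab: "a \<otimes>\<^bsub>B\<^esub> b = \<zero>\<^bsub>B\<^esub>" "a \<in> carrier B" "b \<in> carrier B"
    then have "\<kappa> a = 0 \<or> \<kappa> b = 0" using \<kappa>_mult[of a b] \<kappa>_zero by simp
    then show "a = \<zero>\<^bsub>B\<^esub> \<or> b = \<zero>\<^bsub>B\<^esub>"
      using inj_onD[OF \<kappa>_inj _ _ B.zero_closed] ab \<kappa>_zero by metis
  qed
  then interpret E: embedded_domain B \<kappa>
    using \<kappa>_mult \<kappa>_add \<kappa>_one \<kappa>_inj by (intro embedded_domain.intro embedded_domain_axioms.intro) auto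
  have Tne: "?T \<noteq> {}" using \<phi>_im U(2) by auto
  have const: "B.const_sect b = E.sect ?T (\<kappa> b)" if "b \<in> carrier B" for b
    unfolding B.const_sect_def E.sect_def
  proof (rule restrict_ext)
    fix P assume "P \<in> ?T"
    then have P: "primeideal P B" by (simp add: spectrum_def)
    then have "\<one>\<^bsub>B\<^esub> \<in> carrier B - P" using B.primeideal_simps(3)[OF P] by simp
    then show "fraction B P b \<one>\<^bsub>B\<^esub> = E.germ P (\<kappa> b)"
      using E.fraction_eq_germ[OF P that] \<kappa>_one by simp
  qed
  have global: "k \<in> \<kappa> ` carrier B" if k: "k \<in> E.regular ?T" for k
  proof -
    \<comment> \<open>The denominators of \<open>k\<close> in \<open>B\<close> form an ideal that no
      prime contains, so \<open>1\<close> is a denominator.\<close>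
    define J where "J = {u \<in> carrier B. \<exists>b \<in> carrier B. k * \<kappa> u = \<kappa> b}"
    have closed: "b \<otimes>\<^bsub>B\<^esub> u \<in> J" if "u \<in> J" "b \<in> carrier B" for u b
    proof -
      obtain c where c: "u \<in> carrier B" "c \<in> carrier B" "k * \<kappa> u = \<kappa> c"
        using \<open>u \<in> J\<close> by (auto simp: J_def)
      then have "k * \<kappa> (b \<otimes>\<^bsub>B\<^esub> u) = \<kappa> (b \<otimes>\<^bsub>B\<^esub> c)"
        using that by (simp add: \<kappa>_mult mult.left_commute)
      then show ?thesis using c that unfolding J_def by blast
    qed
    have add: "u \<oplus>\<^bsub>B\<^esub> v \<in> J" if "u \<in> J" "v \<in> J" for u v
    proof -
      obtain c d where c: "u \<in> carrier B" "c \<in> carrier B" "k * \<kappa> u = \<kappa> c"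
        "v \<in> carrier B" "d \<in> carrier B" "k * \<kappa> v = \<kappa> d"
        using \<open>u \<in> J\<close> \<open>v \<in> J\<close> by (auto simp: J_def)
      then have "k * \<kappa> (u \<oplus>\<^bsub>B\<^esub> v) = \<kappa> (c \<oplus>\<^bsub>B\<^esub> d)"
        by (simp add: \<kappa>_add distrib_left)
      then show ?thesis using c unfolding J_def by (intro CollectI conjI bexI[of _ "c \<oplus>\<^bsub>B\<^esub> d"]) auto
    qed
    have "\<zero>\<^bsub>B\<^esub> \<in> J" by (simp add: J_def \<kappa>_zero) (metis B.zero_closed \<kappa>_zero)
    then have "ideal J B" using closed add by (intro B.ideal_leftI) (auto simp: J_def)
    moreover have "\<not> J \<subseteq> P" if P: "primeideal P B" for P
    proof -
      have "k \<in> E.stalk P" using k P by (simp add: E.regular_def spectrum_def)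
      then show ?thesis unfolding E.stalk_def J_def by blast
    qed
    ultimately have "\<one>\<^bsub>B\<^esub> \<in> J" using B.exists_primeideal by metis
    then show ?thesis by (auto simp: J_def \<kappa>_one)
  qed
  have image: "\<kappa> ` carrier B = regular U"
  proof (intro subset_antisym subsetI)
    fix k assume k: "k \<in> regular U"
    then have "sect U k \<in> \<psi> ?T ` carrier (structure_sheaf B ?T)"
      using car bij_betw_imp_surj_on[OF bij] by simp
    then obtain l where l: "l \<in> E.regular ?T" "sect U k = \<psi> ?T (E.sect ?T l)"
      using E.carrier_structure_sheaf[OF T Tne] by auto
    obtain b where b: "b \<in> carrier B" "l = \<kappa> b" using global[OF l(1)] by auto
    then have "sect U k = sect U (\<kappa> b)" using l(2) const[OF b(1)] \<kappa>(2)[OF b(1)] by simp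
    then have "k = \<kappa> b" using eqU k \<kappa>(1)[OF b(1)] by metis
    then show "k \<in> \<kappa> ` carrier B" using b by simp
  qed (use \<kappa>(1) in auto)
  define Q where "Q = {b \<in> carrier B. \<kappa> b \<in> q}"
  have Q: "primeideal Q B" unfolding Q_def by (rule E.prime_contract[OF q]) (simp add: image)
  then have "Q \<in> \<phi> ` U" using \<phi>_im by (simp add: spectrum_def)
  then obtain P where P: "P \<in> U" "\<phi> P = Q" by blast
  \<comment> \<open>If \<open>f\<close> does not vanish at \<open>P\<close>, it is invertible near \<open>P\<close>, so the corresponding element of \<open>B\<close> is
    invertible in the local ring at \<open>Q\<close>, although it belongs to \<open>Q\<close>.\<close>
  have "f \<in> P" if f: "f \<in> carrier R" "\<iota> f \<in> q" for f
  proof (rule ccontr)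
    assume fP: "f \<notin> P"
    define W where "W = U \<inter> {P \<in> spectrum R. f \<notin> P}"
    have W: "openin (zariski R) W" unfolding W_def using U f by (intro openin_Int open_basic)
    have PW: "P \<in> W" using P fP open_subset[OF U(1) P(1)] by (simp add: W_def spectrum_def)
    have WU: "W \<subseteq> U" by (simp add: W_def)
    define V where "V = \<phi> ` W"
    have V: "openin (zariski B) V"
      unfolding V_def using homeomorphic_imp_open_map[OF \<phi>] W WU
      by (auto simp: open_map_def openin_open_subtopology[OF U(1)])
    have preV: "{x \<in> U. \<phi> x \<in> V} = W"
      using homeomorphic_imp_injective_map[OF \<phi>] WU unfolding V_def topU by (auto dest: inj_onD)
    have Vne: "V \<noteq> {}" using PW by (auto simp: V_def)
    have VT: "V \<subseteq> ?T" using E.open_subset[OF V] by (auto simp: spectrum_def)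
    have homV: "\<psi> V \<in> ring_hom (structure_sheaf B V) (structure_sheaf R W)"
      and bijV: "bij_betw (\<psi> V) (carrier (structure_sheaf B V)) (carrier (structure_sheaf R W))"
      using \<psi>[OF V] preV by (auto simp: ring_iso_def)
    have f_nz: "\<iota> f \<noteq> 0" using emb_nonzero[OF open_subset[OF U(1) P(1)]] f fP by simp
    have inv: "1 / \<iota> f \<in> regular W"
    proof -
      have "\<iota> \<one> / \<iota> f \<in> stalk x" if "x \<in> W" for x
        using that open_subset[OF W that] f by (intro stalk_divide) (auto simp: W_def)
      then show ?thesis by (simp add: regular_def emb_one)
    qed
    obtain b where b: "b \<in> carrier B" "\<kappa> b = \<iota> f"
      using emb_in_regular[OF U(1) f(1)] image by (metis imageE)
    have "sect W (1 / \<iota> f) \<in> \<psi> V ` carrier (structure_sheaf B V)"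
      using bij_betw_imp_surj_on[OF bijV] carrier_structure_sheaf[OF W] PW inv by auto
    then obtain l where l: "l \<in> E.regular V" "sect W (1 / \<iota> f) = \<psi> V (E.sect V l)"
      using E.carrier_structure_sheaf[OF V Vne] by auto
    have \<kappa>b: "\<kappa> b \<in> E.regular V" using E.emb_in_regular[OF V b(1)] .
    \<comment> \<open>Naturality for the inclusion of \<open>V\<close> in the whole spectrum
      identifies the section of \<open>b\<close> over \<open>V\<close> with that of \<open>f\<close>
      over \<open>W\<close>.\<close>
    have "\<psi> V (E.sect V (\<kappa> b)) = \<psi> V (restrict (B.const_sect b) V)"
      using const[OF b(1)] E.restrict_sect[OF VT] by simp
    also have "\<dots> = restrict (\<psi> ?T (B.const_sect b)) W"
      using nat[OF T V VT B.const_sect_carrier[OF b(1)]] preV by simp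
    also have "\<dots> = restrict (sect U (\<iota> f)) W" using \<kappa>(2)[OF b(1)] b by simp
    also have "\<dots> = sect W (\<iota> f)" by (rule restrict_sect[OF WU])
    finally have "\<psi> V (E.sect V (\<kappa> b)) = sect W (\<iota> f)" .
    moreover have "\<psi> V (E.sect V (\<kappa> b * l)) = \<psi> V (E.sect V (\<kappa> b)) \<otimes>\<^bsub>structure_sheaf R W\<^esub> \<psi> V (E.sect V l)"
      using E.sect_hom(1)[OF V \<kappa>b l(1)] ring_hom_mult[OF homV] E.carrier_structure_sheaf[OF V Vne] \<kappa>b l(1)
      by (metis imageI)
    ultimately have "\<psi> V (E.sect V (\<kappa> b * l)) = sect W 1"
      using sect_hom(1)[OF W emb_in_regular[OF W f(1)] inv] l(2) f_nz by simp
    also have "\<dots> = \<psi> V (E.sect V 1)"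
      using ring_hom_one[OF homV] sect_one[OF W] E.sect_one[OF V] by simp
    finally have "E.sect V (\<kappa> b * l) = E.sect V 1"
      using E.carrier_structure_sheaf[OF V Vne] E.regular_closed(1)[OF V \<kappa>b l(1)] E.one_in_regular[OF V]
      by (intro inj_onD[OF bij_betw_imp_inj_on[OF bijV]]) auto
    then have "\<kappa> b * l = 1"
      using E.regular_closed(1)[OF V \<kappa>b l(1)] E.one_in_regular[OF V]
      by (intro inj_onD[OF E.sect_inj[OF V Vne]]) auto
    moreover have "Q \<in> V" using PW P by (auto simp: V_def)
    then obtain a s where a: "a \<in> carrier B" "s \<in> carrier B - Q" "l = \<kappa> a / \<kappa> s" "\<kappa> s \<noteq> 0"
      using l(1) E.stalkE[OF Q] by (metis (no_types, lifting) E.regular_def mem_Collect_eq)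
    ultimately have "\<kappa> s = \<kappa> (b \<otimes>\<^bsub>B\<^esub> a)" using b(1) by (simp add: \<kappa>_mult field_simps)
    then have "s = b \<otimes>\<^bsub>B\<^esub> a" using E.emb_eq_iff a b by simp
    moreover have "b \<in> Q" using b f by (simp add: Q_def)
    ultimately show False using B.primeideal_simps(5)[OF Q b(1) a(1)] a(2) by simp
  qed
  \<comment> \<open>Open sets contain every prime that lies inside one of their points, so the
    inclusion suffices.\<close>
  then have "{a \<in> carrier R. \<iota> a \<in> q} \<subseteq> P" by auto
  moreover have "primeideal {a \<in> carrier R. \<iota> a \<in> q} R"
    using emb_in_regular[OF U(1)] by (intro prime_contract[OF q]) auto
  ultimately show ?thesis using open_downward[OF U(1) P(1)] by simp
qed

theorem (in embedded_domain) affine_scheme_iff: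
  assumes U: "openin (zariski R) U" "U \<noteq> {}"
  shows "affine_scheme (open_subspace (Spec R) U) \<longleftrightarrow>
    (\<forall>q. prime_in (regular U) q \<longrightarrow> {a \<in> carrier R. \<iota> a \<in> q} \<in> U)"
proof
  assume "affine_scheme (open_subspace (Spec R) U)"
  then obtain B :: "('a set \<Rightarrow> ('a \<times> 'a) set) ring"
    where "cring B" "ringed_iso (open_subspace (Spec R) U) (Spec B)"
    unfolding affine_scheme_def by (elim exE conjE)
  then show "\<forall>q. prime_in (regular U) q \<longrightarrow> {a \<in> carrier R. \<iota> a \<in> q} \<in> U"
    by (intro allI impI prime_contract_in_open[OF U])
next
  assume crit: "\<forall>q. prime_in (regular U) q \<longrightarrow> {a \<in> carrier R. \<iota> a \<in> q} \<in> U"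
  let ?B = "structure_sheaf R U"
  interpret B: embedded_domain ?B "inv_into (regular U) (sect U)"
    by (rule structure_sheaf_embedded[OF U])
  have "affine_pair R \<iota> ?B (inv_into (regular U) (sect U)) U"
    by (intro affine_pair.intro affine_pair_axioms.intro embedded_domain_axioms
        B.embedded_domain_axioms U image_inv_sect) (simp add: crit)
  then show "affine_scheme (open_subspace (Spec R) U)"
    unfolding affine_scheme_def by (intro exI[of _ ?B] conjI B.is_cring affine_pair.ringed_iso)
qed

section \<open>Prime ideals and their local rings\<close>

definition prime_set :: "'a::idom set \<Rightarrow> bool" where
  "prime_set P \<longleftrightarrow> 0 \<in> P \<and> 1 \<notin> P \<and> (\<forall>a\<in>P. \<forall>b\<in>P. a + b \<in> P) \<and>
     (\<forall>a b. a * b \<in> P \<longleftrightarrow> a \<in> P \<or> b \<in> P)"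

definition is_ideal :: "'a::idom set \<Rightarrow> bool" where
  "is_ideal I \<longleftrightarrow> 0 \<in> I \<and> (\<forall>a\<in>I. \<forall>b\<in>I. a + b \<in> I) \<and> (\<forall>a\<in>I. \<forall>r. r * a \<in> I)"

lemma prime_set_zero: "prime_set {0}"
  by (simp add: prime_set_def)

lemma prime_setD:
  assumes "prime_set P"
  shows "0 \<in> P" "1 \<notin> P" "a \<in> P \<Longrightarrow> b \<in> P \<Longrightarrow> a + b \<in> P" "a * b \<in> P \<longleftrightarrow> a \<in> P \<or> b \<in> P"
    "a ^ n \<in> P \<longleftrightarrow> 0 < n \<and> a \<in> P"
proof -
  show *: "a * b \<in> P \<longleftrightarrow> a \<in> P \<or> b \<in> P" for a b using assms unfolding prime_set_def by blast
  show "0 \<in> P" and one: "1 \<notin> P" and "a \<in> P \<Longrightarrow> b \<in> P \<Longrightarrow> a + b \<in> P"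
    using assms unfolding prime_set_def by blast+
  show "a ^ n \<in> P \<longleftrightarrow> 0 < n \<and> a \<in> P" by (induction n) (auto simp: * one)
qed

lemma prime_set_sum:
  assumes "prime_set P" "\<And>i. i \<in> I \<Longrightarrow> f i \<in> P"
  shows "sum f I \<in> P"
  using assms(2) by (induction I rule: infinite_finite_induct) (auto intro: prime_setD[OF assms(1)])

lemma prime_set_prod:
  assumes "prime_set P" "finite I" "\<And>i. i \<in> I \<Longrightarrow> f i \<notin> P"
  shows "prod f I \<notin> P"
  using assms(2,3) by (induction I rule: finite_induct) (auto simp: prime_setD[OF assms(1)])

lemma primeideal_class_iff: "primeideal P cring_class_ops \<longleftrightarrow> prime_set P"
proof
  assume "primeideal P cring_class_ops"
  from cring.primeideal_simps[OF cring_class this] show "prime_set P"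
    by (auto simp: prime_set_def class_simps)
next
  assume P: "prime_set P"
  show "primeideal P cring_class_ops"
    by (rule cring.primeidealI_iff[OF cring_class])
      (use prime_setD[OF P] in \<open>auto simp: class_simps\<close>)
qed

lemma spectrum_class_iff: "P \<in> spectrum cring_class_ops \<longleftrightarrow> prime_set P"
  by (simp add: spectrum_def primeideal_class_iff)

lemma ideal_class_iff: "ideal I cring_class_ops \<longleftrightarrow> is_ideal I"
proof
  assume "ideal I cring_class_ops"
  then interpret ideal I "cring_class_ops" .
  have "r * a \<in> I" if "a \<in> I" for a r using I_l_closed[OF that, of r] by (simp add: class_simps)
  moreover have "a + b \<in> I" if "a \<in> I" "b \<in> I" for a b using a_closed[OF that] by (simp add: class_simps)
  moreover have "0 \<in> I" using zero_closed by (simp add: class_simps)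
  ultimately show "is_ideal I" by (simp add: is_ideal_def)
next
  assume I: "is_ideal I"
  show "ideal I cring_class_ops"
    by (rule cring.ideal_leftI[OF cring_class]) (use I in \<open>auto simp: is_ideal_def class_simps\<close>)
qed

lemma embedded_class: "embedded_domain cring_class_ops (to_fract :: 'a::idom \<Rightarrow> 'a fract)"
proof -
  have "domain (cring_class_ops :: 'a ring)"
    by (intro domain.intro cring_class domain_axioms.intro) (auto simp: class_simps)
  then show ?thesis
    by (intro embedded_domain.intro embedded_domain_axioms.intro) (auto simp: class_simps inj_on_def)
qed

lemma fractE:
  fixes f :: "'a::idom fract"
  obtains g h where "f = to_fract g / to_fract h" "h \<noteq> 0"
  by (cases f rule: Fract_cases_nonzero) (auto simp: Fract_conv_to_fract intro: that[of 0 1])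

lemma to_fract_power: "to_fract (x ^ n) = to_fract x ^ n"
  by (induction n) simp_all

lemma mem_local_ring_iff: "x \<in> local_ring P \<longleftrightarrow> (\<exists>a s. s \<notin> P \<and> x = to_fract a / to_fract s)"
  by (auto simp: local_ring_def Fract_conv_to_fract)

lemma stalk_eq_local_ring:
  assumes P: "prime_set P"
  shows "embedded_domain.stalk cring_class_ops to_fract P = local_ring P"
proof -
  have "(x * to_fract s = to_fract a) \<longleftrightarrow> x = to_fract a / to_fract s" if "s \<notin> P" for x a s
  proof -
    have "to_fract s \<noteq> 0" using that prime_setD(1)[OF P] by auto
    then show ?thesis by (auto simp: eq_divide_eq)
  qed
  then show ?thesis
    unfolding embedded_domain.stalk_def[OF embedded_class] Set.set_eq_iff mem_local_ring_iff
    by (auto simp: class_simps Bex_def)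
qed

definition regular_on :: "'a::idom set set \<Rightarrow> 'a fract set" where
  "regular_on U = {x. \<forall>P\<in>U. x \<in> local_ring P}"

lemma regular_eq_regular_on:
  assumes "openin (zariski cring_class_ops) U"
  shows "embedded_domain.regular cring_class_ops to_fract U = regular_on U"
proof -
  have "prime_set P" if "P \<in> U" for P
    using embedded_domain.open_subset[OF embedded_class assms that] by (simp add: primeideal_class_iff)
  then show ?thesis
    by (auto simp: embedded_domain.regular_def[OF embedded_class] regular_on_def stalk_eq_local_ring)
qed

theorem affine_open_iff:
  fixes U :: "'a::idom set set"
  assumes U: "openin (zariski cring_class_ops) U" "U \<noteq> {}"
  shows "affine_scheme (open_subspace (Spec cring_class_ops) U) \<longleftrightarrow>
    (\<forall>q. prime_in (regular_on U) q \<longrightarrow> {a. to_fract a \<in> q} \<in> U)"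
  using embedded_domain.affine_scheme_iff[OF embedded_class U]
  by (simp add: regular_eq_regular_on[OF U(1)] class_simps)

section \<open>Irreducible closed sets and codimension one\<close>

lemma closedin_zariski_class:
  "closedin (zariski cring_class_ops) Y \<longleftrightarrow> (\<exists>S. Y = zero_locus cring_class_ops S)"
proof -
  have sub: "zero_locus cring_class_ops S \<subseteq> spectrum cring_class_ops" for S :: "'a set"
    by (auto simp: zero_locus_def)
  have "topspace (zariski (cring_class_ops :: 'a ring)) = spectrum cring_class_ops"
    by (rule ring.topspace_zariski[OF cring.axioms(1)[OF cring_class]])
  then show ?thesis
    unfolding closedin_def openin_zariski using sub by (auto simp: class_simps double_diff) blast+
qed

lemma mem_zero_locus_iff: "Q \<in> zero_locus cring_class_ops P \<longleftrightarrow> prime_set Q \<and> P \<subseteq> Q"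
  by (auto simp: zero_locus_def spectrum_class_iff)

lemma zero_locus_subset_iff:
  "prime_set P \<Longrightarrow> zero_locus cring_class_ops P \<subseteq> zero_locus cring_class_ops Q \<longleftrightarrow> Q \<subseteq> P"
  by (auto simp: mem_zero_locus_iff subset_iff)

lemma zero_locus_eq_iff:
  "prime_set P \<Longrightarrow> prime_set Q \<Longrightarrow>
    zero_locus cring_class_ops P = zero_locus cring_class_ops Q \<longleftrightarrow> P = Q"
  using zero_locus_subset_iff[of P Q] zero_locus_subset_iff[of Q P] by auto

lemma irreducible_zero_locus:
  assumes P: "prime_set P"
  shows "irreducible_closedin (zariski cring_class_ops) (zero_locus cring_class_ops P)"
  unfolding irreducible_closedin_def
proof (intro conjI allI impI)
  show "closedin (zariski cring_class_ops) (zero_locus cring_class_ops P)"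
    by (auto simp: closedin_zariski_class)
  have PP: "P \<in> zero_locus cring_class_ops P" using P by (simp add: mem_zero_locus_iff)
  then show "zero_locus cring_class_ops P \<noteq> {}" by auto
  fix F G assume *: "closedin (zariski cring_class_ops) F \<and> closedin (zariski cring_class_ops) G \<and>
    zero_locus cring_class_ops P = F \<union> G"
  then obtain S T where S: "F = zero_locus cring_class_ops S" "G = zero_locus cring_class_ops T"
    by (auto simp: closedin_zariski_class)
  have "P \<in> F \<or> P \<in> G" using * PP by auto
  then have "S \<subseteq> P \<or> T \<subseteq> P" using S by (auto simp: mem_zero_locus_iff)
  then have "zero_locus cring_class_ops P \<subseteq> F \<or> zero_locus cring_class_ops P \<subseteq> G"
    unfolding S using zero_locus_subset_iff[OF P] by blast
  then show "zero_locus cring_class_ops P = F \<or> zero_locus cring_class_ops P = G"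
    using * by auto
qed

text \<open>The generic point is the intersection of all primes in \<open>Y\<close>. If
  \<open>a b\<close> lies in it, \<open>Y\<close> is covered by its closed subsets where
  \<open>a\<close> or \<open>b\<close> vanishes, so one of them is all of \<open>Y\<close>.\<close>

lemma irreducible_closedinE:
  fixes Y :: "'a::idom set set"
  assumes Y: "irreducible_closedin (zariski cring_class_ops) Y"
  obtains P where "prime_set P" "Y = zero_locus cring_class_ops P"
proof -
  define P where "P = \<Inter>Y"
  obtain S where S: "Y = zero_locus cring_class_ops S"
    using Y by (auto simp: irreducible_closedin_def closedin_zariski_class)
  have pr: "prime_set Q" if "Q \<in> Y" for Q using that S by (simp add: mem_zero_locus_iff)
  have ne: "Y \<noteq> {}" using Y by (simp add: irreducible_closedin_def)
  have mult: "a \<in> P \<or> b \<in> P" if ab: "a * b \<in> P" for a b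
  proof -
    let ?V = "\<lambda>x. zero_locus cring_class_ops (S \<union> {x})"
    have "Y = ?V a \<union> ?V b"
    proof (intro subset_antisym subsetI)
      fix Q assume Q: "Q \<in> Y"
      then have "a * b \<in> Q" using ab by (auto simp: P_def)
      then have "a \<in> Q \<or> b \<in> Q" using prime_setD(4)[OF pr[OF Q]] by simp
      then show "Q \<in> ?V a \<union> ?V b" using Q S by (auto simp: mem_zero_locus_iff)
    next
      fix Q assume "Q \<in> ?V a \<union> ?V b"
      then show "Q \<in> Y" using S by (auto simp: mem_zero_locus_iff)
    qed
    moreover have "closedin (zariski cring_class_ops) (?V a)" "closedin (zariski cring_class_ops) (?V b)"
      by (auto simp: closedin_zariski_class)
    ultimately have "Y = ?V a \<or> Y = ?V b" using Y unfolding irreducible_closedin_def by blast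
    then show ?thesis by (auto simp: P_def mem_zero_locus_iff)
  qed
  have mult': "a * b \<in> P" if "a \<in> P \<or> b \<in> P" for a b
    using that prime_setD(4)[OF pr] by (auto simp: P_def)
  have add: "a + b \<in> P" if "a \<in> P" "b \<in> P" for a b
    using that prime_setD(3)[OF pr] by (auto simp: P_def)
  have "0 \<in> P" "1 \<notin> P" using prime_setD(1,2)[OF pr] ne by (auto simp: P_def)
  then have "prime_set P"
    unfolding prime_set_def using mult mult' add by (intro conjI ballI allI iffI)
  moreover have "S \<subseteq> P" using S by (auto simp: P_def mem_zero_locus_iff)
  then have "Y = zero_locus cring_class_ops P"
    using S pr unfolding P_def by (fastforce simp: mem_zero_locus_iff)
  ultimately show thesis by (intro that)
qed

definition height_one :: "'a::idom set \<Rightarrow> bool" where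
  "height_one P \<longleftrightarrow> prime_set P \<and> P \<noteq> {0} \<and> (\<forall>Q. prime_set Q \<and> Q \<subseteq> P \<longrightarrow> Q = {0} \<or> Q = P)"

text \<open>Passing to zero loci reverses inclusions, and \<open>{0}\<close> is the least prime; so
  the forbidden chains of length two amount to nonzero primes strictly below
  \<open>P\<close>.\<close>

lemma codim_one_zero_locus_iff:
  assumes P: "prime_set P"
  shows "codim_one (zariski cring_class_ops) (zero_locus cring_class_ops P) \<longleftrightarrow> height_one P"
proof -
  have irr: "irreducible_closedin (zariski cring_class_ops) Y \<longleftrightarrow>
      (\<exists>Q. prime_set Q \<and> Y = zero_locus cring_class_ops Q)" for Y :: "'a set set"
    using irreducible_zero_locus irreducible_closedinE by metis
  have less: "zero_locus cring_class_ops Q \<subset> zero_locus cring_class_ops Q' \<longleftrightarrow> Q' \<subset> Q"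
    if "prime_set Q" "prime_set Q'" for Q Q' :: "'a set"
    using that zero_locus_subset_iff zero_locus_eq_iff by (metis psubset_eq)
  have zero: "{0} \<subseteq> Q" if "prime_set Q" for Q :: "'a set" using prime_setD(1)[OF that] by simp
  have "codim_one (zariski cring_class_ops) (zero_locus cring_class_ops P) \<longleftrightarrow>
      (\<exists>Q. prime_set Q \<and> Q \<subset> P) \<and> \<not> (\<exists>Q Q'. prime_set Q \<and> prime_set Q' \<and> Q \<subset> P \<and> Q' \<subset> Q)"
    unfolding codim_one_def irr using less P by (smt (verit))
  also have "\<dots> \<longleftrightarrow> height_one P"
  proof
    assume *: "(\<exists>Q. prime_set Q \<and> Q \<subset> P) \<and> \<not> (\<exists>Q Q'. prime_set Q \<and> prime_set Q' \<and> Q \<subset> P \<and> Q' \<subset> Q)"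
    then have "P \<noteq> {0}" using zero by blast
    moreover have "Q = {0} \<or> Q = P" if "prime_set Q" "Q \<subseteq> P" for Q
      using * that zero[OF that(1)] prime_set_zero by (metis psubsetI)
    ultimately show "height_one P" using P by (simp add: height_one_def)
  next
    assume *: "height_one P"
    then have "{0} \<subset> P" using zero[OF P] by (auto simp: height_one_def)
    moreover have "\<not> (prime_set Q \<and> prime_set Q' \<and> Q \<subset> P \<and> Q' \<subset> Q)" for Q Q'
      using * zero unfolding height_one_def by (metis psubset_eq subset_antisym)
    ultimately show "(\<exists>Q. prime_set Q \<and> Q \<subset> P) \<and> \<not> (\<exists>Q Q'. prime_set Q \<and> prime_set Q' \<and> Q \<subset> P \<and> Q' \<subset> Q)"
      using prime_set_zero by blast
  qed
  finally show ?thesis .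
qed

lemma prime_divisor_iff: "prime_divisor P \<longleftrightarrow> height_one P"
  using codim_one_zero_locus_iff[of P] by (auto simp: prime_divisor_def spectrum_class_iff height_one_def)

lemma height_one_prime: "height_one P \<Longrightarrow> prime_set P"
  by (simp add: height_one_def)

lemma height_one_subset_eq: "height_one P \<Longrightarrow> height_one Q \<Longrightarrow> Q \<subseteq> P \<Longrightarrow> Q = P"
  by (auto simp: height_one_def)

section \<open>Valuations\<close>

text \<open>
  The last condition says that \<open>a\<close> is a unit times \<open>t\<^sup>n\<close> in the local ring at \<open>P\<close>.
\<close>
definition uniformizer :: "'a::idom set \<Rightarrow> 'a \<Rightarrow> bool" where
  "uniformizer P t \<longleftrightarrow> prime_set P \<and> t \<in> P \<and> t \<noteq> 0 \<and>
     (\<forall>a. a \<noteq> 0 \<longrightarrow> (\<exists>n s b. s \<notin> P \<and> b \<notin> P \<and> s * a = t ^ n * b))"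

lemma uniformizerD:
  assumes "uniformizer P t"
  shows "prime_set P" "t \<in> P" "t \<noteq> 0"
  using assms by (auto simp: uniformizer_def)

lemma uniformizerE:
  assumes "uniformizer P t" "a \<noteq> 0"
  obtains n s b where "s \<notin> P" "b \<notin> P" "s * a = t ^ n * b"
  using assms unfolding uniformizer_def by blast

text \<open>Up to factors outside \<open>P\<close>, a nonzero element of a prime inside
  \<open>P\<close> is a power of \<open>t\<close>; so that prime contains \<open>t\<close>, and up
  to such factors \<open>t\<close> divides every element of \<open>P\<close>.\<close>

lemma uniformizer_height_one:
  assumes t: "uniformizer P t"
  shows "height_one P"
  unfolding height_one_def
proof (intro conjI allI impI)
  note P = uniformizerD[OF t]
  show "prime_set P" "P \<noteq> {0}" using P by auto
  fix Q assume Q: "prime_set Q \<and> Q \<subseteq> P"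
  show "Q = {0} \<or> Q = P"
  proof (cases "Q = {0}")
    case False
    then obtain a where a: "a \<in> Q" "a \<noteq> 0" using Q prime_setD(1) by blast
    obtain n s b where "s \<notin> P" "b \<notin> P" "s * a = t ^ n * b" using uniformizerE[OF t a(2)] .
    then have "t ^ n \<in> Q" using Q a prime_setD(4)[of Q s a] prime_setD(4)[of Q "t ^ n" b] by auto
    then have tQ: "t \<in> Q" using Q prime_setD(5) by blast
    have "c \<in> Q" if c: "c \<in> P" for c
    proof (cases "c = 0")
      case False
      obtain n s b where s: "s \<notin> P" "b \<notin> P" "s * c = t ^ n * b" using uniformizerE[OF t False] .
      then have "n > 0" using c prime_setD(4)[OF P(1), of s c] by (cases n) auto
      then have "s * c \<in> Q" using s tQ Q prime_setD(4,5)[of Q] by metis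
      then show ?thesis using s Q prime_setD(4)[of Q s c] by auto
    qed (use Q prime_setD(1) in auto)
    then show ?thesis using Q by auto
  qed simp
qed

definition local_units :: "'a::idom set \<Rightarrow> 'a fract set" where
  "local_units P = {to_fract b / to_fract c | b c. b \<notin> P \<and> c \<notin> P}"

lemma local_unitsE:
  assumes "prime_set P" "u \<in> local_units P"
  obtains b c where "b \<notin> P" "c \<notin> P" "u = to_fract b / to_fract c" "b \<noteq> 0" "c \<noteq> 0"
  using assms prime_setD(1)[OF assms(1)] unfolding local_units_def by blast

lemma local_unitsI: "b \<notin> P \<Longrightarrow> c \<notin> P \<Longrightarrow> to_fract b / to_fract c \<in> local_units P"
  by (auto simp: local_units_def)

lemma local_units_closed:
  assumes P: "prime_set P" and u: "u \<in> local_units P"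
  shows "inverse u \<in> local_units P" "u \<noteq> 0" "u powi n \<in> local_units P"
    "v \<in> local_units P \<Longrightarrow> u * v \<in> local_units P" "u \<in> local_ring P"
proof -
  have mult: "u * v \<in> local_units P" if uv: "u \<in> local_units P" "v \<in> local_units P" for u v
  proof -
    obtain b c where b: "b \<notin> P" "c \<notin> P" "u = to_fract b / to_fract c" using local_unitsE[OF P uv(1)] by metis
    obtain d e where d: "d \<notin> P" "e \<notin> P" "v = to_fract d / to_fract e" using local_unitsE[OF P uv(2)] by metis
    have "u * v = to_fract (b * d) / to_fract (c * e)" using b d by simp
    then show ?thesis using b d prime_setD(4)[OF P] by (metis local_unitsI)
  qed
  have inv: "inverse u \<in> local_units P" if "u \<in> local_units P" for u
    using local_unitsE[OF P that] local_unitsI by (metis inverse_divide)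
  have one: "1 \<in> local_units P" using local_unitsI[of 1 P 1] prime_setD(2)[OF P] by simp
  have pow: "u ^ n \<in> local_units P" if "u \<in> local_units P" for u n
    using that by (induction n) (auto intro: mult one)
  show "inverse u \<in> local_units P" using inv u .
  show "u \<noteq> 0" using local_unitsE[OF P u] by (metis divide_eq_0_iff to_fract_eq_0_iff)
  show "u powi n \<in> local_units P" using inv pow u by (auto simp: power_int_def)
  show "v \<in> local_units P \<Longrightarrow> u * v \<in> local_units P" using mult u by blast
  show "u \<in> local_ring P" using u by (auto simp: local_units_def mem_local_ring_iff)
qed

lemma local_max_iff:
  assumes P: "prime_set P"
  shows "x \<in> local_ring_max P \<longleftrightarrow> x \<in> local_ring P \<and> x \<notin> local_units P"
proof -
  have core: "\<not> (to_fract a / to_fract s = to_fract b / to_fract c)" if "a \<in> P" "s \<notin> P" "b \<notin> P" "c \<notin> P" for a b c s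
  proof
    assume "to_fract a / to_fract s = to_fract b / to_fract c"
    moreover have "s \<noteq> 0" "c \<noteq> 0" using that prime_setD(1)[OF P] by auto
    ultimately have "to_fract (a * c) = to_fract (b * s)" by (simp add: field_simps)
    then have "a * c = b * s" by (simp only: to_fract_eq_iff)
    then show False using that prime_setD(4)[OF P] by metis
  qed
  show ?thesis
  proof
    assume "x \<in> local_ring_max P"
    then obtain a s where "a \<in> P" "s \<notin> P" "x = to_fract a / to_fract s"
      by (auto simp: local_ring_max_def Fract_conv_to_fract)
    then show "x \<in> local_ring P \<and> x \<notin> local_units P"
      using core local_unitsE[OF P] mem_local_ring_iff by metis
  next
    assume x: "x \<in> local_ring P \<and> x \<notin> local_units P"
    then obtain a s where a: "s \<notin> P" "x = to_fract a / to_fract s" by (auto simp: mem_local_ring_iff)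
    then have "a \<in> P" using x local_unitsI by metis
    then show "x \<in> local_ring_max P" using a by (auto simp: local_ring_max_def Fract_conv_to_fract)
  qed
qed

text \<open>For the smaller exponent on the left, a quotient of units equals a power of
  \<open>t\<close>; clearing its denominator shows that \<open>t\<close>, being in \<open>P\<close>,
  can only occur with exponent zero.\<close>

lemma uniformizer_powi_unique:
  assumes t: "uniformizer P t" and u: "u \<in> local_units P" "v \<in> local_units P"
    and eq: "u * to_fract t powi n = v * to_fract t powi m"
  shows "n = m"
proof -
  note P = uniformizerD[OF t]
  have *: "m' = n'" if "u \<in> local_units P" "v \<in> local_units P"
    "u * to_fract t powi n' = v * to_fract t powi m'" "n' \<le> m'" for u v n' m'
  proof -
    have t0: "to_fract t \<noteq> 0" using P by simp
    define w where "w = u * inverse v"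
    have "w \<in> local_units P" unfolding w_def using that local_units_closed[OF P(1)] by blast
    then obtain b c where b: "b \<notin> P" "c \<notin> P" "w = to_fract b / to_fract c" "c \<noteq> 0"
      using local_unitsE[OF P(1)] by metis
    define k where "k = nat (m' - n')"
    have "to_fract t powi m' = to_fract t powi n' * to_fract t ^ k"
      using that(4) t0 by (simp add: k_def flip: power_int_of_nat power_int_add)
    moreover have "v \<noteq> 0" using local_units_closed(2)[OF P(1) that(2)] .
    ultimately have "w = to_fract t ^ k" using that(3) t0 by (simp add: w_def field_simps)
    then have "to_fract (t ^ k * c) = to_fract b" using b by (simp add: to_fract_power field_simps)
    then have "t ^ k * c = b" by (simp only: to_fract_eq_iff)
    then have "k = 0" using prime_setD(4,5)[OF P(1)] b P(2) by (metis gr0I)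
    then show ?thesis using that(4) by (simp add: k_def)
  qed
  show ?thesis using *[OF u eq] *[OF u(2,1) eq[symmetric]] by linarith
qed

lemma uniformizer_local_max:
  assumes t: "uniformizer P t"
  shows "local_ring_max P = (\<lambda>x. to_fract t * x) ` local_ring P"
proof (intro subset_antisym subsetI)
  note P = uniformizerD[OF t]
  fix x assume "x \<in> local_ring_max P"
  then obtain a s where a: "a \<in> P" "s \<notin> P" "x = to_fract a / to_fract s"
    by (auto simp: local_ring_max_def Fract_conv_to_fract)
  show "x \<in> (\<lambda>x. to_fract t * x) ` local_ring P"
  proof (cases "a = 0")
    case True
    have "0 \<in> local_ring P" unfolding mem_local_ring_iff using prime_setD(2)[OF P(1)]
      by (intro exI[of _ 0] exI[of _ 1]) simp
    then show ?thesis using True a by (intro image_eqI[of _ _ 0]) auto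
  next
    case False
    obtain n c b where c: "c \<notin> P" "b \<notin> P" "c * a = t ^ n * b" using uniformizerE[OF t False] .
    obtain m where n: "n = Suc m" using c a prime_setD(4)[OF P(1), of c a] by (cases n) auto
    have "to_fract c * to_fract a = to_fract t * to_fract (t ^ m * b)"
      using arg_cong[OF c(3), of to_fract] n by (simp add: mult_ac)
    moreover have "c \<noteq> 0" "s \<noteq> 0" using c a prime_setD(1)[OF P(1)] by auto
    ultimately have "to_fract a = to_fract t * to_fract (t ^ m * b) / to_fract c"
      by (simp add: field_simps)
    then have "x = to_fract t * (to_fract (t ^ m * b) / to_fract (c * s))"
      unfolding a(3) by simp
    moreover have "to_fract (t ^ m * b) / to_fract (c * s) \<in> local_ring P"
      using c a prime_setD(4)[OF P(1)] unfolding mem_local_ring_iff by blast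
    ultimately show ?thesis by blast
  qed
next
  note P = uniformizerD[OF t]
  fix x assume "x \<in> (\<lambda>x. to_fract t * x) ` local_ring P"
  then obtain y where y: "y \<in> local_ring P" "x = to_fract t * y" by blast
  then obtain a s where a: "s \<notin> P" "y = to_fract a / to_fract s" by (auto simp: mem_local_ring_iff)
  then have "x = to_fract (t * a) / to_fract s" using y by simp
  then show "x \<in> local_ring_max P"
    using a P prime_setD(4)[OF P(1)] unfolding local_ring_max_def Fract_conv_to_fract by blast
qed

text \<open>The definite description ranges over all generators \<pi> of the maximal ideal, so
  uniqueness of the exponent needs that two generators differ by a unit.\<close>

lemma valuation_at_eq:
  assumes t: "uniformizer P t" and u: "u \<in> local_units P"
  shows "valuation_at P (u * to_fract t powi n) = n"
  unfolding valuation_at_def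
proof (rule the_equality)
  note P = uniformizerD[OF t]
  have un: "local_ring P - local_ring_max P = local_units P"
    using local_max_iff[OF P(1)] local_units_closed(5)[OF P(1)] by blast
  show "\<exists>\<pi> v. local_ring_max P = (*) \<pi> ` local_ring P \<and> v \<in> local_ring P - local_ring_max P \<and>
      u * to_fract t powi n = v * \<pi> powi n"
    using uniformizer_local_max[OF t] u un by blast
  fix m assume "\<exists>\<pi> v. local_ring_max P = (*) \<pi> ` local_ring P \<and> v \<in> local_ring P - local_ring_max P \<and>
      u * to_fract t powi n = v * \<pi> powi m"
  then obtain \<pi> v where \<pi>: "local_ring_max P = (*) \<pi> ` local_ring P" "v \<in> local_units P"
    "u * to_fract t powi n = v * \<pi> powi m" using un by auto
  have one: "1 \<in> local_ring P" using prime_setD(2)[OF P(1)] unfolding mem_local_ring_iff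
    by (intro exI[of _ 1]) simp
  have "\<pi> \<in> local_ring_max P" using \<pi>(1) one by force
  then obtain y where y: "y \<in> local_ring P" "\<pi> = to_fract t * y" using uniformizer_local_max[OF t] by auto
  have "to_fract t \<in> local_ring_max P" using uniformizer_local_max[OF t] one by force
  then obtain z where z: "z \<in> local_ring P" "to_fract t = \<pi> * z" using \<pi>(1) by auto
  \<comment> \<open>\<open>y\<close> and \<open>z\<close> express each generator by the other, hence
    are inverse; \<open>y\<close> is not divisible by \<open>t\<close> in the local ring, as
    \<open>1\<close> would be too.\<close>
  have yz: "y * z = 1" using y z P by (metis mult.assoc mult_cancel_left1 to_fract_eq_0_iff)
  have "y \<in> local_units P"
  proof (rule ccontr)
    assume "y \<notin> local_units P"
    then obtain y' where y': "y' \<in> local_ring P" "y = to_fract t * y'"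
      using y local_max_iff[OF P(1), of y] uniformizer_local_max[OF t] by auto
    obtain a s where a: "s \<notin> P" "y' = to_fract a / to_fract s" using y' by (auto simp: mem_local_ring_iff)
    obtain b r where b: "r \<notin> P" "z = to_fract b / to_fract r" using z by (auto simp: mem_local_ring_iff)
    have "s \<noteq> 0" "r \<noteq> 0" using a b prime_setD(1)[OF P(1)] by auto
    then have "to_fract (t * a * b) = to_fract (s * r)" using yz y' a b by (simp add: field_simps)
    then have "t * (a * b) = s * r" by (simp only: to_fract_eq_iff mult.assoc)
    then show False using prime_setD(4)[OF P(1)] a b P(2) by metis
  qed
  then have "v * y powi m \<in> local_units P" using local_units_closed[OF P(1)] \<pi>(2) by blast
  moreover have "u * to_fract t powi n = (v * y powi m) * to_fract t powi m"
    using \<pi>(3) y by (simp add: power_int_mult_distrib)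
  ultimately show "m = n" using uniformizer_powi_unique[OF t u] by metis
qed

lemma valuationE:
  assumes t: "uniformizer P t" and f: "f \<noteq> 0"
  obtains u where "u \<in> local_units P" "f = u * to_fract t powi (valuation_at P f)"
proof -
  note P = uniformizerD[OF t]
  obtain a c where ac: "f = to_fract a / to_fract c" "c \<noteq> 0"
    by (rule fractE)
  have "a \<noteq> 0" using f ac by auto
  obtain n s b where s: "s \<notin> P" "b \<notin> P" "s * a = t ^ n * b" using uniformizerE[OF t \<open>a \<noteq> 0\<close>] .
  obtain m r d where r: "r \<notin> P" "d \<notin> P" "r * c = t ^ m * d" using uniformizerE[OF t ac(2)] .
  have nz: "s \<noteq> 0" "r \<noteq> 0" "d \<noteq> 0" "b \<noteq> 0" using s r prime_setD(1)[OF P(1)] by auto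
  define u where "u = to_fract (b * r) / to_fract (s * d)"
  have u: "u \<in> local_units P" unfolding u_def using s r prime_setD(4)[OF P(1)] by (intro local_unitsI) auto
  have "to_fract a = to_fract b / to_fract s * to_fract t ^ n"
    using arg_cong[OF s(3), of to_fract] nz by (simp add: to_fract_power field_simps)
  moreover have "to_fract c = to_fract d / to_fract r * to_fract t ^ m"
    using arg_cong[OF r(3), of to_fract] nz by (simp add: to_fract_power field_simps)
  ultimately have "f = u * (to_fract t ^ n / to_fract t ^ m)"
    unfolding ac(1) u_def using nz by (simp add: mult_ac)
  also have "to_fract t ^ n / to_fract t ^ m = to_fract t powi (int n - int m)"
    using P(3) by (simp add: power_int_diff)
  finally show thesis using valuation_at_eq[OF t u] that u by metis
qed

context
  fixes P t assumes t: "uniformizer P t"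
begin

lemma valuation_mult:
  assumes "f \<noteq> 0" "g \<noteq> 0"
  shows "valuation_at P (f * g) = valuation_at P f + valuation_at P g"
proof -
  note P = uniformizerD[OF t]
  obtain u where u: "u \<in> local_units P" "f = u * to_fract t powi (valuation_at P f)"
    using valuationE[OF t assms(1)] .
  obtain v where v: "v \<in> local_units P" "g = v * to_fract t powi (valuation_at P g)"
    using valuationE[OF t assms(2)] .
  have "f * g = (u * v) * to_fract t powi (valuation_at P f + valuation_at P g)"
    using P(3) by (subst u(2), subst v(2)) (simp add: power_int_add)
  then show ?thesis using valuation_at_eq[OF t local_units_closed(4)[OF P(1) u(1) v(1)]] by metis
qed

lemma valuation_one: "valuation_at P 1 = 0"
  using valuation_mult[of 1 1] by simp

lemma valuation_inverse: "f \<noteq> 0 \<Longrightarrow> valuation_at P (inverse f) = - valuation_at P f"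
  using valuation_mult[of f "inverse f"] valuation_one by simp

lemma valuation_divide:
  "f \<noteq> 0 \<Longrightarrow> g \<noteq> 0 \<Longrightarrow> valuation_at P (f / g) = valuation_at P f - valuation_at P g"
  using valuation_mult[of f "inverse g"] valuation_inverse[of g] by (simp add: divide_inverse)

lemma valuation_power: "f \<noteq> 0 \<Longrightarrow> valuation_at P (f ^ n) = int n * valuation_at P f"
  by (induction n) (auto simp: valuation_one valuation_mult algebra_simps)

lemma valuation_powi: "f \<noteq> 0 \<Longrightarrow> valuation_at P (f powi n) = n * valuation_at P f"
  by (auto simp: power_int_def valuation_power valuation_inverse)

lemma valuation_prod:
  "finite I \<Longrightarrow> (\<And>i. i \<in> I \<Longrightarrow> f i \<noteq> 0) \<Longrightarrow>
    valuation_at P (prod f I) = (\<Sum>i\<in>I. valuation_at P (f i))"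
  by (induction I rule: finite_induct) (auto simp: valuation_one valuation_mult)

lemma mem_local_ring_iff_valuation:
  assumes f: "f \<noteq> 0"
  shows "f \<in> local_ring P \<longleftrightarrow> 0 \<le> valuation_at P f"
proof -
  note P = uniformizerD[OF t]
  obtain u where u: "u \<in> local_units P" "f = u * to_fract t powi (valuation_at P f)"
    using valuationE[OF t f] .
  obtain b c where b: "b \<notin> P" "c \<notin> P" "u = to_fract b / to_fract c" "b \<noteq> 0" "c \<noteq> 0"
    using local_unitsE[OF P(1) u(1)] .
  show ?thesis
  proof
    assume "0 \<le> valuation_at P f"
    then have "f = to_fract (b * t ^ nat (valuation_at P f)) / to_fract c"
      using u(2) b(3) by (simp add: power_int_def to_fract_power)
    then show "f \<in> local_ring P" using b unfolding mem_local_ring_iff by blast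
  next
    assume "f \<in> local_ring P"
    then obtain a s where a: "s \<notin> P" "f = to_fract a / to_fract s" by (auto simp: mem_local_ring_iff)
    have "a \<noteq> 0" "s \<noteq> 0" using f a by auto
    obtain n r d where r: "r \<notin> P" "d \<notin> P" "r * a = t ^ n * d" using uniformizerE[OF t \<open>a \<noteq> 0\<close>] .
    have "r \<noteq> 0" using r prime_setD(1)[OF P(1)] by auto
    then have "to_fract a = to_fract d / to_fract r * to_fract t ^ n"
      using arg_cong[OF r(3), of to_fract] by (simp add: to_fract_power field_simps)
    then have "f = to_fract d / to_fract (r * s) * to_fract t powi (int n)" using a by simp
    moreover have "to_fract d / to_fract (r * s) \<in> local_units P"
      using r a prime_setD(4)[OF P(1)] by (intro local_unitsI) auto
    ultimately show "0 \<le> valuation_at P f" using valuation_at_eq[OF t] by (metis of_nat_0_le_iff)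
  qed
qed

lemma valuation_to_fract:
  assumes a: "a \<noteq> 0"
  shows "0 \<le> valuation_at P (to_fract a)" "0 < valuation_at P (to_fract a) \<longleftrightarrow> a \<in> P"
proof -
  note P = uniformizerD[OF t]
  obtain n s b where s: "s \<notin> P" "b \<notin> P" "s * a = t ^ n * b" using uniformizerE[OF t a] .
  have "s \<noteq> 0" using s prime_setD(1)[OF P(1)] by auto
  then have "to_fract a = to_fract b / to_fract s * to_fract t powi int n"
    using arg_cong[OF s(3), of to_fract] by (simp add: to_fract_power field_simps)
  then have v: "valuation_at P (to_fract a) = int n"
    using valuation_at_eq[OF t local_unitsI[OF s(2,1)]] by metis
  then show "0 \<le> valuation_at P (to_fract a)" by simp
  have "s * a \<in> P \<longleftrightarrow> 0 < n" unfolding s(3) using prime_setD(4,5)[OF P(1)] s(2) P(2) by auto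
  moreover have "s * a \<in> P \<longleftrightarrow> a \<in> P" using s(1) prime_setD(4)[OF P(1), of s a] by simp
  ultimately show "0 < valuation_at P (to_fract a) \<longleftrightarrow> a \<in> P" using v by simp
qed

end

section \<open>Noetherian normal domains\<close>

text \<open>The union of a nonempty chain of ideals is a member of the chain, so Zorn's lemma
  applies to any nonempty family.\<close>

lemma noetherian_maximal:
  assumes noeth: "noetherian_ring (cring_class_ops :: 'a::idom ring)"
    and F: "F \<noteq> {}" "\<And>I :: 'a set. I \<in> F \<Longrightarrow> is_ideal I"
  shows "\<exists>M\<in>F. \<forall>I\<in>F. M \<subseteq> I \<longrightarrow> I = M"
proof (rule subset_Zorn_nonempty[OF F(1)])
  fix C assume C: "C \<noteq> {}" "subset.chain F C"
  then have "subset.chain {I. ideal I (cring_class_ops :: 'a ring)} C"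
    using F(2) by (auto simp: subset.chain_def ideal_class_iff)
  then have "\<Union>C \<in> C" by (rule noetherian_ring.ideal_chain_is_trivial[OF noeth C(1)])
  then show "\<Union>C \<in> F" using C(2) by (auto simp: subset.chain_def)
qed

lemma noetherian_stationary:
  assumes noeth: "noetherian_ring (cring_class_ops :: 'a::idom ring)"
    and J: "\<And>n :: nat. is_ideal (J n :: 'a set)" "\<And>n. J n \<subseteq> J (Suc n)"
  shows "\<exists>n. J (Suc n) = J n"
proof -
  have "\<exists>M\<in>range J. \<forall>I\<in>range J. M \<subseteq> I \<longrightarrow> I = M"
    by (rule noetherian_maximal[OF noeth]) (use J(1) in auto)
  then obtain n where "\<forall>I\<in>range J. J n \<subseteq> I \<longrightarrow> I = J n" by auto
  then have "J (Suc n) = J n" using J(2)[of n] by simp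
  then show ?thesis ..
qed

lemma is_idealI:
  assumes "0 \<in> I" "\<And>a b. a \<in> I \<Longrightarrow> b \<in> I \<Longrightarrow> a + b \<in> I" "\<And>a r. a \<in> I \<Longrightarrow> r * a \<in> I"
  shows "is_ideal I"
  using assms by (simp add: is_ideal_def)

lemma is_idealD:
  assumes "is_ideal I"
  shows "0 \<in> I" "a \<in> I \<Longrightarrow> b \<in> I \<Longrightarrow> a + b \<in> I" "a \<in> I \<Longrightarrow> r * a \<in> I"
  using assms by (simp_all add: is_ideal_def)

lemma prime_set_is_ideal: "prime_set P \<Longrightarrow> is_ideal P"
  by (rule is_idealI) (auto simp: prime_setD)

text \<open>Noetherian induction: a maximal counterexample \<open>M\<close> is neither prime nor the
  whole ring, so \<open>x y\<close> lies in \<open>M\<close> for some \<open>x\<close> and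
  \<open>y\<close> outside, and every prime above \<open>M\<close> lies above \<open>M + (x)\<close>
  or \<open>M + (y)\<close>. The finite set contains the minimal primes over \<open>I\<close>,
  possibly along with others.\<close>

lemma finite_primes_below:
  fixes I :: "'a::idom set"
  assumes noeth: "noetherian_ring (cring_class_ops :: 'a ring)" and I: "is_ideal I"
  shows "\<exists>F. finite F \<and> (\<forall>Q\<in>F. prime_set Q \<and> I \<subseteq> Q) \<and>
    (\<forall>P. prime_set P \<and> I \<subseteq> P \<longrightarrow> (\<exists>Q\<in>F. Q \<subseteq> P))"
proof (rule ccontr)
  define good where "good I \<longleftrightarrow> (\<exists>F. finite F \<and> (\<forall>Q\<in>F. prime_set Q \<and> I \<subseteq> Q) \<and>
    (\<forall>P. prime_set P \<and> I \<subseteq> P \<longrightarrow> (\<exists>Q\<in>F. Q \<subseteq> P)))" for I :: "'a set"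
  assume "\<not> ?thesis"
  then have "I \<in> {I. is_ideal I \<and> \<not> good I}" using I by (simp add: good_def)
  then obtain M where M: "M \<in> {I. is_ideal I \<and> \<not> good I}"
    and max: "\<And>I. I \<in> {I. is_ideal I \<and> \<not> good I} \<Longrightarrow> M \<subseteq> I \<Longrightarrow> I = M"
    using noetherian_maximal[OF noeth, of "{I. is_ideal I \<and> \<not> good I}"] by (metis (no_types, lifting) empty_iff mem_Collect_eq)
  then have M': "is_ideal M" "\<not> good M" by auto
  have "\<not> prime_set M"
  proof
    assume "prime_set M"
    then have "good M" unfolding good_def by (intro exI[of _ "{M}"]) auto
    then show False using M'(2) by simp
  qed
  moreover have "1 \<notin> M"
  proof
    assume "1 \<in> M"
    then have "good M" unfolding good_def using prime_setD(2) by (intro exI[of _ "{}"]) blast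
    then show False using M'(2) by simp
  qed
  moreover have "a * b \<in> M" if "a \<in> M \<or> b \<in> M" for a b
    using that is_idealD(3)[OF M'(1)] by (metis mult.commute)
  ultimately obtain x y where xy: "x * y \<in> M" "x \<notin> M" "y \<notin> M"
    unfolding prime_set_def using is_idealD[OF M'(1)] by blast
  define N where "N x = {m + r * x | m r. m \<in> M}" for x
  have N: "is_ideal (N x) \<and> M \<subseteq> N x \<and> x \<in> N x" for x
  proof (intro conjI is_idealI)
    show "0 \<in> N x" unfolding N_def using is_idealD(1)[OF M'(1)] by (auto intro!: exI[of _ 0])
    show "a + b \<in> N x" if "a \<in> N x" "b \<in> N x" for a b
    proof -
      obtain m r n s where "m \<in> M" "n \<in> M" "a = m + r * x" "b = n + s * x" using \<open>a \<in> N x\<close> \<open>b \<in> N x\<close> by (auto simp: N_def)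
      then have "a + b = (m + n) + (r + s) * x" "m + n \<in> M"
        using is_idealD(2)[OF M'(1)] by (auto simp: algebra_simps)
      then show ?thesis unfolding N_def by blast
    qed
    show "r * a \<in> N x" if "a \<in> N x" for a r
    proof -
      obtain m s where "m \<in> M" "a = m + s * x" using \<open>a \<in> N x\<close> by (auto simp: N_def)
      then have "r * a = r * m + (r * s) * x" "r * m \<in> M"
        using is_idealD(3)[OF M'(1)] by (auto simp: algebra_simps)
      then show ?thesis unfolding N_def by blast
    qed
    show "M \<subseteq> N x"
    proof
      fix m assume "m \<in> M"
      then show "m \<in> N x" unfolding N_def by (intro CollectI exI[of _ m] exI[of _ 0]) simp
    qed
    show "x \<in> N x" unfolding N_def using is_idealD(1)[OF M'(1)]
      by (intro CollectI exI[of _ 0] exI[of _ 1]) simp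
  qed
  have "good (N x)" "good (N y)" using max[of "N x"] max[of "N y"] N xy by blast+
  then obtain F G where F: "finite F" "\<forall>Q\<in>F. prime_set Q \<and> N x \<subseteq> Q"
      "\<forall>P. prime_set P \<and> N x \<subseteq> P \<longrightarrow> (\<exists>Q\<in>F. Q \<subseteq> P)"
    and G: "finite G" "\<forall>Q\<in>G. prime_set Q \<and> N y \<subseteq> Q"
      "\<forall>P. prime_set P \<and> N y \<subseteq> P \<longrightarrow> (\<exists>Q\<in>G. Q \<subseteq> P)"
    unfolding good_def by (elim exE conjE)
  have "\<exists>Q\<in>F \<union> G. Q \<subseteq> P" if P: "prime_set P" "M \<subseteq> P" for P
  proof -
    have sub: "N z \<subseteq> P" if "z \<in> P" for z
      using P(2) that prime_setD(3,4)[OF P(1)] unfolding N_def by blast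
    have "x \<in> P \<or> y \<in> P" using xy(1) P prime_setD(4)[OF P(1)] by blast
    then show ?thesis
    proof
      assume "x \<in> P"
      then have "\<exists>Q\<in>F. Q \<subseteq> P" using F(3) P(1) sub[of x] by simp
      then show ?thesis by blast
    next
      assume "y \<in> P"
      then have "\<exists>Q\<in>G. Q \<subseteq> P" using G(3) P(1) sub[of y] by simp
      then show ?thesis by blast
    qed
  qed
  moreover have "prime_set Q \<and> M \<subseteq> Q" if "Q \<in> F \<union> G" for Q
    using that F(2) G(2) N[of x] N[of y] by (meson Un_iff order_trans)
  ultimately have "good M" unfolding good_def using F(1) G(1) by (intro exI[of _ "F \<union> G"]) simp
  then show False using M'(2) by simp
qed

text \<open>A height one prime containing \<open>a\<close> is minimal over the principal ideal of
  \<open>a\<close>, because the only smaller prime is zero.\<close>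

lemma finite_height_one_containing:
  assumes noeth: "noetherian_ring (cring_class_ops :: 'a::idom ring)" and a: "(a :: 'a) \<noteq> 0"
  shows "finite {P. height_one P \<and> a \<in> P}"
proof -
  define I where "I = {r * a | r. True}"
  have aI: "a \<in> I" unfolding I_def by (intro CollectI exI[of _ 1]) simp
  have "is_ideal I"
  proof (rule is_idealI)
    show "0 \<in> I" unfolding I_def by (intro CollectI exI[of _ 0]) simp
    show "x + y \<in> I" if "x \<in> I" "y \<in> I" for x y
      using that unfolding I_def by (auto simp flip: distrib_right)
    show "r * x \<in> I" if "x \<in> I" for x r
      using that unfolding I_def by (auto simp flip: mult.assoc)
  qed
  then obtain F where F: "finite F" "\<forall>Q\<in>F. prime_set Q \<and> I \<subseteq> Q"
    "\<forall>P. prime_set P \<and> I \<subseteq> P \<longrightarrow> (\<exists>Q\<in>F. Q \<subseteq> P)"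
    using finite_primes_below[OF noeth] by metis
  have "P \<in> F" if P: "height_one P" "a \<in> P" for P
  proof -
    have "I \<subseteq> P" using P prime_setD(4)[OF height_one_prime[OF P(1)]] by (auto simp: I_def)
    then obtain Q where Q: "Q \<in> F" "Q \<subseteq> P" using F(3) height_one_prime[OF P(1)] by blast
    then have "Q \<noteq> {0}" using F(2) aI a by auto
    then show ?thesis using P(1) Q F(2) unfolding height_one_def by blast
  qed
  then have "{P. height_one P \<and> a \<in> P} \<subseteq> F" by auto
  then show ?thesis using F(1) by (rule finite_subset)
qed

text \<open>
  The contraction to \<open>A\<close> of the annihilator of \<open>x\<close> modulo \<open>a\<close> in the localization at \<open>S\<close>.
\<close>
definition colon :: "'a::idom set \<Rightarrow> 'a \<Rightarrow> 'a \<Rightarrow> 'a set" where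
  "colon S a x = {r. \<exists>s\<in>S. \<exists>d. s * r * x = a * d}"

lemma is_ideal_colon:
  assumes S: "1 \<in> S" "\<And>s s'. s \<in> S \<Longrightarrow> s' \<in> S \<Longrightarrow> s * s' \<in> S"
  shows "is_ideal (colon S a x)"
proof (rule is_idealI)
  show "0 \<in> colon S a x" unfolding colon_def using S(1) by (intro CollectI bexI[of _ 1] exI[of _ 0]) auto
  show "u + v \<in> colon S a x" if "u \<in> colon S a x" "v \<in> colon S a x" for u v
  proof -
    obtain s d s' d' where s: "s \<in> S" "s * u * x = a * d" "s' \<in> S" "s' * v * x = a * d'"
      using \<open>u \<in> colon S a x\<close> \<open>v \<in> colon S a x\<close> by (auto simp: colon_def)
    have "(s * s') * (u + v) * x = s' * (s * u * x) + s * (s' * v * x)"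
      by (simp add: algebra_simps)
    also have "\<dots> = a * (s' * d + s * d')" unfolding s by (simp add: algebra_simps)
    finally show ?thesis unfolding colon_def using S(2)[OF s(1,3)] by blast
  qed
  show "r * u \<in> colon S a x" if "u \<in> colon S a x" for u r
  proof -
    obtain s d where s: "s \<in> S" "s * u * x = a * d" using \<open>u \<in> colon S a x\<close> by (auto simp: colon_def)
    have "s * (r * u) * x = r * (s * u * x)" by (simp add: mult_ac)
    also have "\<dots> = a * (r * d)" unfolding s by (simp add: mult_ac)
    finally show ?thesis unfolding colon_def using s(1) by blast
  qed
qed

text \<open>A proper annihilator that is maximal among those above the given one is prime: this is
  the existence of associated primes.\<close>

lemma exists_prime_colon:
  fixes S :: "'a::idom set"
  assumes noeth: "noetherian_ring (cring_class_ops :: 'a ring)"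
    and S: "1 \<in> S" "\<And>s s'. s \<in> S \<Longrightarrow> s' \<in> S \<Longrightarrow> s * s' \<in> S"
    and x: "1 \<notin> colon S a x"
  shows "\<exists>y. prime_set (colon S a y) \<and> colon S a x \<subseteq> colon S a y"
proof -
  have ideal: "is_ideal (colon S a y)" for y by (rule is_ideal_colon) (fact S)+
  let ?F = "{colon S a y | y. 1 \<notin> colon S a y \<and> colon S a x \<subseteq> colon S a y}"
  have one_iff: "1 \<in> colon S a (r * y) \<longleftrightarrow> r \<in> colon S a y" for r y
    unfolding colon_def by (auto simp: mult_ac)
  have "?F \<noteq> {}" using x by blast
  moreover have "is_ideal I" if "I \<in> ?F" for I using that ideal by blast
  ultimately have "\<exists>M\<in>?F. \<forall>I\<in>?F. M \<subseteq> I \<longrightarrow> I = M"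
    by (rule noetherian_maximal[OF noeth])
  then obtain M where M': "M \<in> ?F" "\<forall>I\<in>?F. M \<subseteq> I \<longrightarrow> I = M" by (rule bexE)
  note M = M'(1) mp[OF bspec[OF M'(2)]]
  then obtain y where y: "M = colon S a y" "1 \<notin> colon S a y" "colon S a x \<subseteq> colon S a y" by blast
  \<comment> \<open>If \<open>u\<close> does not annihilate \<open>y\<close>, the annihilator of
    \<open>u y\<close> is proper and at least as large, hence the same, and it contains
    \<open>v\<close>.\<close>
  have "v \<in> colon S a y" if uv: "u * v \<in> colon S a y" "u \<notin> colon S a y" for u v
  proof -
    have sub: "colon S a y \<subseteq> colon S a (u * y)"
    proof
      fix r assume "r \<in> colon S a y"
      then have "u * r \<in> colon S a y" by (rule is_idealD(3)[OF ideal])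
      then show "r \<in> colon S a (u * y)" by (simp add: colon_def mult_ac)
    qed
    have "1 \<notin> colon S a (u * y)" using uv(2) one_iff by blast
    then have "colon S a (u * y) \<in> ?F" using sub y(3) by blast
    then have "colon S a (u * y) = colon S a y" using M(2)[of "colon S a (u * y)"] y(1) sub by simp
    moreover have "v \<in> colon S a (u * y)" using uv(1) by (simp add: colon_def mult_ac)
    ultimately show ?thesis by simp
  qed
  moreover have "u * v \<in> colon S a y" if "u \<in> colon S a y \<or> v \<in> colon S a y" for u v
    using that is_idealD(3)[OF ideal] by (metis mult.commute)
  ultimately have "prime_set (colon S a y)"
    unfolding prime_set_def using y(2) is_idealD(1,2)[OF ideal[of y]]
    by (intro conjI ballI allI iffI) blast+
  then show ?thesis using y(3) by blast
qed

text \<open>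
  If \<open>a \<noteq> 0\<close> were divisible by all powers of \<open>t\<close>, then the fractions \<open>a / t\<^sup>n\<close> would generate a strictly
  increasing sequence of ideals \<open>J n\<close>.
\<close>
lemma uniformizerI:
  fixes P :: "'a::idom set"
  assumes noeth: "noetherian_ring (cring_class_ops :: 'a ring)"
    and P: "prime_set P" and t: "t \<in> P" "t \<noteq> 0"
    and gen: "\<And>r. r \<in> P \<Longrightarrow> \<exists>s c. s \<notin> P \<and> s * r = t * c"
  shows "uniformizer P t"
proof -
  have "\<exists>n s b. s \<notin> P \<and> b \<notin> P \<and> s * a = t ^ n * b" if a: "a \<noteq> 0" for a
  proof (rule ccontr)
    assume contra: "\<not> ?thesis"
    have div: "\<exists>s b. s \<notin> P \<and> s * a = t ^ n * b" for n
    proof (induction n)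
      case 0
      show ?case using prime_setD(2)[OF P] by (intro exI[of _ 1] exI[of _ a]) simp
    next
      case (Suc n)
      then obtain s b where s: "s \<notin> P" "s * a = t ^ n * b" by blast
      then have "b \<in> P" using contra by blast
      then obtain s' c where c: "s' \<notin> P" "s' * b = t * c" using gen by blast
      have "(s' * s) * a = s' * (s * a)" by (simp add: mult_ac)
      also have "\<dots> = t ^ n * (s' * b)" unfolding s(2) by (simp add: mult_ac)
      also have "\<dots> = t ^ Suc n * c" unfolding c(2) by (simp add: mult_ac)
      finally have "(s' * s) * a = t ^ Suc n * c" .
      then show ?case using s c prime_setD(4)[OF P] by blast
    qed
    define J where "J n = colon (- P) a (t ^ n)" for n
    have J: "r \<in> J n \<longleftrightarrow> (\<exists>s d. s \<notin> P \<and> s * r * t ^ n = a * d)" for r n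
      by (auto simp: J_def colon_def)
    have ideal: "is_ideal (J n)" for n
      unfolding J_def using prime_setD(2,4)[OF P] by (intro is_ideal_colon) auto
    have mono: "J n \<subseteq> J (Suc n)" for n
    proof
      fix x assume "x \<in> J n"
      then obtain s d where s: "s \<notin> P" "s * x * t ^ n = a * d" by (auto simp: J)
      have "s * x * t ^ Suc n = t * (s * x * t ^ n)" by (simp add: mult_ac)
      also have "\<dots> = a * (t * d)" unfolding s by (simp add: mult_ac)
      finally show "x \<in> J (Suc n)" unfolding J using s by blast
    qed
    obtain n where n: "J (Suc n) = J n"
      using noetherian_stationary[where J = J, OF noeth ideal mono] by blast
    obtain s b where s: "s \<notin> P" "s * a = t ^ Suc n * b" using div by blast
    have "b \<in> J (Suc n)" unfolding J using prime_setD(2)[OF P] s(2)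
      by (intro exI[of _ 1] exI[of _ s]) (simp add: mult_ac)
    then obtain s' d where s': "s' \<notin> P" "s' * b * t ^ n = a * d" unfolding n by (auto simp: J)
    have "a * (s' * s) = s' * (s * a)" by (simp add: mult_ac)
    also have "\<dots> = (s' * b * t ^ n) * t" unfolding s(2) by (simp add: mult_ac)
    also have "\<dots> = a * (t * d)" unfolding s'(2) by (simp add: mult_ac)
    finally have "s' * s = t * d" using a by (metis mult_left_cancel)
    then show False using s s' t prime_setD(4)[OF P] by metis
  qed
  then show ?thesis using P t by (simp add: uniformizer_def)
qed

lemma normal_domainD:
  fixes x :: "'a::idom fract"
  assumes normal: "normal_domain TYPE('a)"
    and eq: "x ^ Suc n = (\<Sum>i\<le>n. to_fract (f i) * x ^ i)"
  shows "x \<in> range to_fract"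
proof -
  define p :: "'a poly" where "p = monom 1 (Suc n) - (\<Sum>i\<le>n. monom (f i) i)"
  have cf: "poly.coeff p i = (if i = Suc n then 1 else if i \<le> n then - f i else 0)" for i
    by (auto simp: p_def coeff_sum sum.delta)
  have deg: "Polynomial.degree p = Suc n"
    by (rule antisym) (auto intro!: degree_le le_degree simp: cf)
  have tf: "(\<lambda>a. Fraction_Field.Fract a 1) = (to_fract :: 'a \<Rightarrow> _)" by (auto simp: to_fract_def)
  have "Polynomial.degree (map_poly to_fract p) = Suc n"
    using deg by (subst degree_map_poly) auto
  then have "poly (map_poly to_fract p) x = (\<Sum>i\<le>Suc n. to_fract (poly.coeff p i) * x ^ i)"
    by (simp add: poly_altdef coeff_map_poly)
  also have "\<dots> = x ^ Suc n + (\<Sum>i\<le>n. - (to_fract (f i) * x ^ i))"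
    by (simp add: cf add.commute)
  also have "\<dots> = 0" unfolding eq by (simp add: sum_negf)
  finally have "poly (map_poly to_fract p) x = 0" .
  moreover have "lead_coeff p = 1" by (simp add: deg cf)
  ultimately show ?thesis using normal unfolding normal_domain_def tf by blast
qed

text \<open>
  Either \<open>y t\<close> is a unit of the local ring for some \<open>t \<in> P\<close>, which is then a generator of the maximal
  ideal, or multiplication by \<open>y\<close> maps the maximal ideal to itself. In the second case \<open>c y\<^sup>n\<close> is regular
  at \<open>P\<close> for all \<open>n\<close> and a fixed \<open>c \<noteq> 0\<close>, and the ascending chain condition makes \<open>y\<close> integral.
\<close>
lemma uniformizer_of_fraction:
  fixes P :: "'a::idom set" and y :: "'a fract"
  assumes noeth: "noetherian_ring (cring_class_ops :: 'a ring)" and normal: "normal_domain TYPE('a)"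
    and P: "prime_set P" "P \<noteq> {0}"
    and y: "y \<notin> local_ring P" "\<And>p. p \<in> P \<Longrightarrow> y * to_fract p \<in> local_ring P"
  shows "\<exists>t. uniformizer P t"
proof (cases "\<exists>t\<in>P. y * to_fract t \<in> local_units P")
  case True
  then obtain t b c where t: "t \<in> P" and b: "b \<notin> P" "c \<notin> P" "y * to_fract t = to_fract b / to_fract c" "b \<noteq> 0" "c \<noteq> 0"
    using local_unitsE[OF P(1)] by metis
  then have t0: "t \<noteq> 0" by auto
  \<comment> \<open>Since \<open>y t\<close> is a unit, \<open>r\<close> is the product of
    \<open>t\<close> with the local function \<open>(y r) / (y t)\<close>.\<close>
  have "\<exists>s c. s \<notin> P \<and> s * r = t * c" if r: "r \<in> P" for r
  proof -
    obtain d e where e: "e \<notin> P" "y * to_fract r = to_fract d / to_fract e" using y(2)[OF r] by (auto simp: mem_local_ring_iff)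
    have "e \<noteq> 0" using e prime_setD(1)[OF P(1)] by auto
    have "y * to_fract t * to_fract r = y * to_fract r * to_fract t" by simp
    then have "to_fract b / to_fract c * to_fract r = to_fract d / to_fract e * to_fract t"
      unfolding b(3) e(2) .
    then have "to_fract (b * e * r) = to_fract (t * (c * d))"
      using \<open>e \<noteq> 0\<close> b by (simp add: field_simps)
    then have "(b * e) * r = t * (c * d)" by (simp only: to_fract_eq_iff)
    then show ?thesis using b e prime_setD(4)[OF P(1)] by blast
  qed
  then show ?thesis using uniformizerI[OF noeth P(1) t t0] by blast
next
  case False
  have step: "\<exists>q s. q \<in> P \<and> s \<notin> P \<and> y * to_fract p = to_fract q / to_fract s" if "p \<in> P" for p
  proof -
    have "y * to_fract p \<in> local_ring_max P"
      using False y(2) local_max_iff[OF P(1)] that by blast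
    then show ?thesis by (auto simp: local_ring_max_def Fract_conv_to_fract)
  qed
  \<comment> \<open>Any nonzero element of \<open>P\<close> serves as common denominator of all
    powers of \<open>y\<close>, as multiplication by \<open>y\<close> keeps the maximal ideal
    stable.\<close>
  obtain c where c: "c \<in> P" "c \<noteq> 0" using P prime_setD(1)[OF P(1)] by blast
  have pow: "\<exists>q s. q \<in> P \<and> s \<notin> P \<and> to_fract s * (to_fract c * y ^ n) = to_fract q" for n
  proof (induction n)
    case 0
    show ?case using c prime_setD(2)[OF P(1)] by (intro exI[of _ c] exI[of _ 1]) simp
  next
    case (Suc n)
    then obtain q s where q: "q \<in> P" "s \<notin> P" "to_fract s * (to_fract c * y ^ n) = to_fract q" by blast
    obtain q' s' where q': "q' \<in> P" "s' \<notin> P" "y * to_fract q = to_fract q' / to_fract s'"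
      using step[OF q(1)] by blast
    have "s' \<noteq> 0" using q' prime_setD(1)[OF P(1)] by auto
    have "to_fract (s' * s) * (to_fract c * y ^ Suc n) = to_fract s' * (y * (to_fract s * (to_fract c * y ^ n)))"
      by (simp add: mult_ac)
    also have "\<dots> = to_fract q'" unfolding q(3) q'(3) using \<open>s' \<noteq> 0\<close> by simp
    finally show ?case using q q' prime_setD(4)[OF P(1)] by blast
  qed
  \<comment> \<open>\<open>J n\<close> consists of the elements of \<open>A\<close> in the module
    spanned by \<open>c, c y, ..., c y^n\<close> over the local ring.\<close>
  define J where "J n = {r. \<exists>s f. s \<notin> P \<and> to_fract (s * r) = to_fract c * (\<Sum>i\<le>n. to_fract (f i) * y ^ i)}" for n :: nat
  have ideal: "is_ideal (J n)" for n
  proof (rule is_idealI)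
    show "0 \<in> J n" unfolding J_def using prime_setD(2)[OF P(1)]
      by (intro CollectI exI[of _ 1] exI[of _ "\<lambda>_. 0"]) simp
    show "a + b \<in> J n" if "a \<in> J n" "b \<in> J n" for a b
    proof -
      obtain s f s' f' where s: "s \<notin> P" "to_fract (s * a) = to_fract c * (\<Sum>i\<le>n. to_fract (f i) * y ^ i)"
        "s' \<notin> P" "to_fract (s' * b) = to_fract c * (\<Sum>i\<le>n. to_fract (f' i) * y ^ i)"
        using \<open>a \<in> J n\<close> \<open>b \<in> J n\<close> by (auto simp: J_def)
      have "to_fract ((s * s') * (a + b)) = to_fract s' * to_fract (s * a) + to_fract s * to_fract (s' * b)"
        by (simp add: algebra_simps)
      also have "\<dots> = to_fract c * (\<Sum>i\<le>n. to_fract (s' * f i + s * f' i) * y ^ i)"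
        unfolding s by (simp add: algebra_simps sum.distrib sum_distrib_left)
      finally show ?thesis unfolding J_def using s prime_setD(4)[OF P(1)]
        by (intro CollectI exI[of _ "s * s'"] exI[of _ "\<lambda>i. s' * f i + s * f' i"]) simp
    qed
    show "r * a \<in> J n" if "a \<in> J n" for a r
    proof -
      obtain s f where s: "s \<notin> P" "to_fract (s * a) = to_fract c * (\<Sum>i\<le>n. to_fract (f i) * y ^ i)"
        using \<open>a \<in> J n\<close> by (auto simp: J_def)
      have "to_fract (s * (r * a)) = to_fract r * to_fract (s * a)" by simp
      also have "\<dots> = to_fract c * (\<Sum>i\<le>n. to_fract (r * f i) * y ^ i)"
        unfolding s by (simp add: sum_distrib_left mult_ac)
      finally show ?thesis unfolding J_def using s
        by (intro CollectI exI[of _ s] exI[of _ "\<lambda>i. r * f i"]) simp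
    qed
  qed
  have mono: "J n \<subseteq> J (Suc n)" for n
  proof
    fix a assume "a \<in> J n"
    then obtain s f where s: "s \<notin> P" "to_fract (s * a) = to_fract c * (\<Sum>i\<le>n. to_fract (f i) * y ^ i)"
      by (auto simp: J_def)
    have "(\<Sum>i\<le>Suc n. to_fract ((f(Suc n := 0)) i) * y ^ i) = (\<Sum>i\<le>n. to_fract (f i) * y ^ i)"
      by (auto intro!: sum.cong)
    then show "a \<in> J (Suc n)" unfolding J_def using s
      by (intro CollectI exI[of _ s] exI[of _ "f(Suc n := 0)"]) metis
  qed
  obtain n where n: "J (Suc n) = J n"
    using noetherian_stationary[where J = J, OF noeth ideal mono] by blast
  \<comment> \<open>\<open>q\<close> is \<open>c y^(n+1)\<close> up to a unit of the local ring; its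
    membership in \<open>J n\<close> is an integral equation for \<open>y\<close> over the local
    ring.\<close>
  obtain q s where q: "s \<notin> P" "to_fract s * (to_fract c * y ^ Suc n) = to_fract q" using pow by blast
  have "(\<Sum>i\<le>Suc n. to_fract (if i = Suc n then s else 0) * y ^ i) = to_fract s * y ^ Suc n"
    by (simp add: if_distrib if_distribR sum.delta cong: if_cong)
  then have "to_fract (1 * q) = to_fract c * (\<Sum>i\<le>Suc n. to_fract (if i = Suc n then s else 0) * y ^ i)"
    using q(2) by (simp add: mult_ac)
  then have "q \<in> J (Suc n)" unfolding J_def using prime_setD(2)[OF P(1)]
    by (intro CollectI exI[of _ 1] exI[of _ "\<lambda>i. if i = Suc n then s else 0"]) simp
  then obtain s' f where s': "s' \<notin> P" "to_fract (s' * q) = to_fract c * (\<Sum>i\<le>n. to_fract (f i) * y ^ i)"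
    unfolding n by (auto simp: J_def)
  \<comment> \<open>The leading coefficient after clearing denominators; multiplying the equation by
    its \<open>n\<close>-th power makes \<open>\<sigma> y\<close> integral over \<open>A\<close>, so
    normality puts it into \<open>A\<close>.\<close>
  define \<sigma> where "\<sigma> = s' * s"
  have \<sigma>: "\<sigma> \<notin> P" "\<sigma> \<noteq> 0" unfolding \<sigma>_def using q s' prime_setD(1,4)[OF P(1)] by auto
  have "to_fract c * (to_fract \<sigma> * y ^ Suc n) = to_fract s' * (to_fract s * (to_fract c * y ^ Suc n))"
    by (simp add: \<sigma>_def mult_ac)
  also have "\<dots> = to_fract c * (\<Sum>i\<le>n. to_fract (f i) * y ^ i)" unfolding q(2) using s'(2) by simp
  finally have y_eq: "to_fract \<sigma> * y ^ Suc n = (\<Sum>i\<le>n. to_fract (f i) * y ^ i)" using c by simp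
  have "(to_fract \<sigma> * y) ^ Suc n = to_fract \<sigma> ^ n * (to_fract \<sigma> * y ^ Suc n)"
    by (simp add: power_mult_distrib mult_ac)
  also have "\<dots> = (\<Sum>i\<le>n. to_fract (f i * \<sigma> ^ (n - i)) * (to_fract \<sigma> * y) ^ i)"
    unfolding y_eq sum_distrib_left
  proof (rule sum.cong[OF refl])
    fix i assume "i \<in> {..n}"
    then have "to_fract \<sigma> ^ n = to_fract \<sigma> ^ (n - i) * to_fract \<sigma> ^ i"
      by (simp flip: power_add)
    then show "to_fract \<sigma> ^ n * (to_fract (f i) * y ^ i) = to_fract (f i * \<sigma> ^ (n - i)) * (to_fract \<sigma> * y) ^ i"
      by (simp add: to_fract_power power_mult_distrib mult_ac)
  qed
  finally have "to_fract \<sigma> * y \<in> range to_fract" by (rule normal_domainD[OF normal])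
  then obtain a where "to_fract \<sigma> * y = to_fract a" by blast
  then have "y = to_fract a / to_fract \<sigma>" using \<sigma>(2) by (simp add: field_simps)
  then have "y \<in> local_ring P" using \<sigma>(1) unfolding mem_local_ring_iff by blast
  then show ?thesis using y(1) by simp
qed

text \<open>Localizing at the complement of \<open>P\<close> keeps the associated prime of a nonzero
  \<open>a\<close> inside \<open>P\<close>; it contains \<open>a\<close>, so height one makes it
  equal to \<open>P\<close>. Then \<open>x / a\<close> is not regular at \<open>P\<close> but
  becomes so after multiplication by any element of \<open>P\<close>.\<close>

theorem height_one_uniformizer:
  fixes P :: "'a::idom set"
  assumes noeth: "noetherian_ring (cring_class_ops :: 'a ring)" and normal: "normal_domain TYPE('a)"
    and ht: "height_one P"
  shows "\<exists>t. uniformizer P t"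
proof -
  note P = height_one_prime[OF ht]
  obtain a where a: "a \<in> P" "a \<noteq> 0" using ht prime_setD(1)[OF P] unfolding height_one_def by blast
  have S: "1 \<in> - P" "\<And>s s'. s \<in> - P \<Longrightarrow> s' \<in> - P \<Longrightarrow> s * s' \<in> - P"
    using prime_setD(2,4)[OF P] by auto
  have "1 \<notin> colon (- P) a 1" unfolding colon_def using a prime_setD(4)[OF P] by auto
  then obtain x where x: "prime_set (colon (- P) a x)"
    using exists_prime_colon[where S = "- P", OF noeth S] by metis
  have J: "r \<in> colon (- P) a x \<longleftrightarrow> (\<exists>s d. s \<notin> P \<and> s * r * x = a * d)" for r
    by (auto simp: colon_def)
  have sub: "colon (- P) a x \<subseteq> P"
  proof
    fix r assume "r \<in> colon (- P) a x"
    then obtain s d where s: "s \<notin> P" "s * r * x = a * d" by (auto simp: J)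
    show "r \<in> P"
    proof (rule ccontr)
      assume "r \<notin> P"
      then have "s * r \<notin> P" using s prime_setD(4)[OF P] by blast
      then have "1 \<in> colon (- P) a x" using s(2) unfolding J by (intro exI[of _ "s * r"] exI[of _ d]) simp
      then show False using prime_setD(2)[OF x] by simp
    qed
  qed
  have "a \<in> colon (- P) a x" unfolding J using prime_setD(2)[OF P]
    by (intro exI[of _ 1] exI[of _ x]) simp
  then have JP: "colon (- P) a x = P" using ht sub x a(2) unfolding height_one_def by blast
  show ?thesis
  proof (rule uniformizer_of_fraction[OF noeth normal P, of "to_fract x / to_fract a"])
    show "P \<noteq> {0}" using a by auto
    show "to_fract x / to_fract a \<notin> local_ring P"
    proof
      assume "to_fract x / to_fract a \<in> local_ring P"
      then obtain d s where s: "s \<notin> P" "to_fract x / to_fract a = to_fract d / to_fract s" by (auto simp: mem_local_ring_iff)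
      then have "to_fract (s * x) = to_fract (a * d)"
        using a prime_setD(1)[OF P] by (auto simp: field_simps)
      then have "s * 1 * x = a * d" by (simp only: to_fract_eq_iff mult_1_right)
      then have "1 \<in> colon (- P) a x" unfolding J using s(1) by blast
      then show False using prime_setD(2)[OF x] by simp
    qed
    fix p assume "p \<in> P"
    then have "p \<in> colon (- P) a x" using JP by simp
    then obtain s d where s: "s \<notin> P" "s * p * x = a * d" by (auto simp: J)
    have "s \<noteq> 0" using s prime_setD(1)[OF P] by auto
    moreover have "to_fract s * to_fract p * to_fract x = to_fract a * to_fract d"
      using arg_cong[OF s(2), of to_fract] by (simp only: to_fract_mult)
    ultimately have "to_fract x / to_fract a * to_fract p = to_fract d / to_fract s"
      using a by (simp add: field_simps)
    then show "to_fract x / to_fract a * to_fract p \<in> local_ring P" using s(1) unfolding mem_local_ring_iff by blast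
  qed
qed

text \<open>If \<open>f = b / a\<close> is not in \<open>A\<close>, the ideal of its denominators is
  proper and lies in an associated prime of \<open>a\<close>. That prime has a uniformizer, hence
  height one, so \<open>f\<close> is regular there and some denominator of \<open>f\<close> lies
  outside it, a contradiction.\<close>

theorem Inter_local_rings:
  fixes f :: "'a::idom fract"
  assumes noeth: "noetherian_ring (cring_class_ops :: 'a ring)" and normal: "normal_domain TYPE('a)"
    and f: "\<And>P. height_one P \<Longrightarrow> f \<in> local_ring P"
  shows "f \<in> range to_fract"
proof (rule ccontr)
  assume contra: "f \<notin> range to_fract"
  obtain b a where ab: "f = to_fract b / to_fract a" "a \<noteq> 0"
    by (rule fractE)
  define J where "J x = colon {1} a x" for x
  have J: "r \<in> J x \<longleftrightarrow> (\<exists>d. r * x = a * d)" for r x by (auto simp: J_def colon_def)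
  have "1 \<notin> J b"
  proof
    assume "1 \<in> J b"
    then obtain d where "b = a * d" by (auto simp: J)
    then have "f = to_fract d" using ab by simp
    then show False using contra by simp
  qed
  then obtain x where P: "prime_set (J x)" and x: "J b \<subseteq> J x"
    using exists_prime_colon[OF noeth, of "{1}" a b] unfolding J_def by auto
  have aJ: "a \<in> J x" unfolding J by (intro exI[of _ x]) simp
  have "\<exists>t. uniformizer (J x) t"
  proof (rule uniformizer_of_fraction[OF noeth normal P, of "to_fract x / to_fract a"])
    show "J x \<noteq> {0}" using aJ ab by auto
    show "to_fract x / to_fract a \<notin> local_ring (J x)"
    proof
      assume "to_fract x / to_fract a \<in> local_ring (J x)"
      then obtain d s where s: "s \<notin> J x" "to_fract x / to_fract a = to_fract d / to_fract s" by (auto simp: mem_local_ring_iff)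
      then have "to_fract (s * x) = to_fract (a * d)"
        using ab prime_setD(1)[OF P] by (auto simp: field_simps)
      then have "s * x = a * d" by (simp only: to_fract_eq_iff)
      then show False using s(1) unfolding J by blast
    qed
    fix p assume "p \<in> J x"
    then obtain d where s: "p * x = a * d" by (auto simp: J)
    have "to_fract p * to_fract x = to_fract a * to_fract d"
      using arg_cong[OF s, of to_fract] by (simp only: to_fract_mult)
    then have "to_fract x / to_fract a * to_fract p = to_fract d / to_fract 1"
      using ab(2) by (simp add: field_simps)
    then show "to_fract x / to_fract a * to_fract p \<in> local_ring (J x)" using prime_setD(2)[OF P] unfolding mem_local_ring_iff by blast
  qed
  then have "f \<in> local_ring (J x)" using f uniformizer_height_one by blast
  then obtain d s where s: "s \<notin> J x" "f = to_fract d / to_fract s" by (auto simp: mem_local_ring_iff)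
  then have "to_fract (s * b) = to_fract (a * d)"
    using ab prime_setD(1)[OF P] by (auto simp: field_simps)
  then have "s * b = a * d" by (simp only: to_fract_eq_iff)
  then have "s \<in> J b" unfolding J by blast
  then show False using s(1) x by blast
qed

section \<open>Height one primes of a polynomial ring\<close>

lemma smult_conv_mult: "smult a p = [:a:] * p"
  by simp

lemma prime_set_add_iff:
  assumes P: "prime_set P" and b: "b \<in> P"
  shows "a + b \<in> P \<longleftrightarrow> a \<in> P"
proof
  assume "a + b \<in> P"
  moreover have "(-1) * b \<in> P" using b prime_setD(4)[OF P] by blast
  ultimately have "(a + b) + (-1) * b \<in> P" by (rule prime_setD(3)[OF P])
  then show "a \<in> P" by simp
qed (use prime_setD(3)[OF P] b in blast)

lemma coeff_mem_extend_prime: "g \<in> extend_prime P \<longleftrightarrow> (\<forall>i. poly.coeff g i \<in> P)"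
  by (simp add: extend_prime_def)

text \<open>Gauss's argument: take the first coefficients of \<open>f\<close> and \<open>g\<close>
  outside \<open>P\<close>; the coefficient of \<open>f g\<close> at the sum of their indices is the
  product of both plus terms in \<open>P\<close>.\<close>

lemma prime_set_extend:
  assumes P: "prime_set P"
  shows "prime_set (extend_prime P)"
proof -
  note P' = prime_setD[OF P]
  have mult: "f * g \<in> extend_prime P" if "f \<in> extend_prime P" for f g
    unfolding coeff_mem_extend_prime coeff_mult
  proof (intro allI prime_set_sum[OF P])
    fix n i
    have "poly.coeff f i \<in> P" using that by (simp add: coeff_mem_extend_prime)
    then show "poly.coeff f i * poly.coeff g (n - i) \<in> P" by (simp add: P'(4))
  qed
  have prime: "f * g \<notin> extend_prime P" if f: "f \<notin> extend_prime P" and g: "g \<notin> extend_prime P" for f g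
  proof -
    define i where "i = (LEAST i. poly.coeff f i \<notin> P)"
    define j where "j = (LEAST j. poly.coeff g j \<notin> P)"
    have i: "poly.coeff f i \<notin> P" "\<And>k. k < i \<Longrightarrow> poly.coeff f k \<in> P"
      unfolding i_def using f not_less_Least LeastI_ex[of "\<lambda>i. poly.coeff f i \<notin> P"]
      by (auto simp: coeff_mem_extend_prime)
    have j: "poly.coeff g j \<notin> P" "\<And>k. k < j \<Longrightarrow> poly.coeff g k \<in> P"
      unfolding j_def using g not_less_Least LeastI_ex[of "\<lambda>i. poly.coeff g i \<notin> P"]
      by (auto simp: coeff_mem_extend_prime)
    have "(\<Sum>k\<in>{..i + j} - {i}. poly.coeff f k * poly.coeff g (i + j - k)) \<in> P"
    proof (rule prime_set_sum[OF P])
      fix k assume "k \<in> {..i + j} - {i}"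
      then have "k < i \<or> i + j - k < j" by auto
      then show "poly.coeff f k * poly.coeff g (i + j - k) \<in> P" using i(2) j(2) P'(4) by blast
    qed
    moreover have "poly.coeff (f * g) (i + j) = poly.coeff f i * poly.coeff g j +
        (\<Sum>k\<in>{..i + j} - {i}. poly.coeff f k * poly.coeff g (i + j - k))"
      unfolding coeff_mult by (subst sum.remove[of _ i]) auto
    moreover have "poly.coeff f i * poly.coeff g j \<notin> P" using i j P'(4) by blast
    ultimately have "poly.coeff (f * g) (i + j) \<notin> P" using prime_set_add_iff[OF P] by metis
    then show ?thesis by (auto simp: coeff_mem_extend_prime)
  qed
  have "0 \<in> extend_prime P" "1 \<notin> extend_prime P"
    using P'(1,2) by (auto simp: coeff_mem_extend_prime intro: exI[of _ 0])
  moreover have "f + g \<in> extend_prime P" if "f \<in> extend_prime P" "g \<in> extend_prime P" for f g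
    using that P'(3) by (auto simp: coeff_mem_extend_prime)
  moreover have "f * g \<in> extend_prime P \<longleftrightarrow> f \<in> extend_prime P \<or> g \<in> extend_prime P" for f g
    using mult[of f g] mult[of g f] prime[of f g] by (auto simp: mult.commute)
  ultimately show ?thesis unfolding prime_set_def by simp
qed

lemma const_mem_extend_prime: "0 \<in> P \<Longrightarrow> [:a:] \<in> extend_prime P \<longleftrightarrow> a \<in> P"
  by (auto simp: coeff_mem_extend_prime coeff_pCons split: nat.splits)

lemma contract_extend: "0 \<in> P \<Longrightarrow> {a. [:a:] \<in> extend_prime P} = P"
  by (simp add: const_mem_extend_prime)

lemma prime_set_contract:
  assumes Q: "prime_set Q"
  shows "prime_set {a. [:a:] \<in> Q}"
  unfolding prime_set_def
proof (intro conjI allI ballI)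
  show "0 \<in> {a. [:a:] \<in> Q}" using prime_setD(1)[OF Q] by simp
  show "1 \<notin> {a. [:a:] \<in> Q}" using prime_setD(2)[OF Q] by (simp add: one_pCons)
  show "a + b \<in> {a. [:a:] \<in> Q}" if "a \<in> {a. [:a:] \<in> Q}" "b \<in> {a. [:a:] \<in> Q}" for a b
    using that prime_setD(3)[OF Q, of "[:a:]" "[:b:]"] by simp
  show "a * b \<in> {a. [:a:] \<in> Q} \<longleftrightarrow> a \<in> {a. [:a:] \<in> Q} \<or> b \<in> {a. [:a:] \<in> Q}" for a b
    using prime_setD(4)[OF Q, of "[:a:]" "[:b:]"] by (simp add: mult.commute)
qed

lemma extend_contract_subset:
  assumes Q: "prime_set Q"
  shows "extend_prime {a. [:a:] \<in> Q} \<subseteq> Q"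
proof
  fix g assume "g \<in> extend_prime {a. [:a:] \<in> Q}"
  then show "g \<in> Q"
  proof (induction g rule: pCons_induct)
    case 0
    then show ?case using prime_setD(1)[OF Q] by simp
  next
    case (pCons a g)
    have c: "[:poly.coeff (pCons a g) i:] \<in> Q" for i using pCons.prems by (simp add: coeff_mem_extend_prime)
    have "[:poly.coeff g i:] \<in> Q" for i using c[of "Suc i"] by simp
    then have "g \<in> Q" using pCons.IH by (simp add: coeff_mem_extend_prime)
    then have "monom 1 1 * g \<in> Q" using prime_setD(4)[OF Q] by blast
    moreover have "[:a:] \<in> Q" using c[of 0] by simp
    moreover have "pCons a g = [:a:] + monom 1 1 * g" by (simp add: monom_Suc monom_0)
    ultimately show ?case using prime_setD(3)[OF Q] by metis
  qed
qed

lemma common_denominator: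
  assumes P: "prime_set P" and c: "\<And>i. \<exists>s c. s \<notin> P \<and> s * poly.coeff g i = t * c"
  shows "\<exists>s g'. s \<notin> P \<and> smult s g = smult t g'"
  using c
proof (induction g rule: pCons_induct)
  case 0
  show ?case using prime_setD(2)[OF P] by (intro exI[of _ 1] exI[of _ 0]) simp
next
  case (pCons a g)
  obtain s c where s: "s \<notin> P" "s * a = t * c" using pCons.prems[of 0] by auto
  have "\<exists>s c. s \<notin> P \<and> s * poly.coeff g i = t * c" for i using pCons.prems[of "Suc i"] by simp
  then obtain s' g' where s': "s' \<notin> P" "smult s' g = smult t g'" using pCons.IH by blast
  have "smult (s * s') (pCons a g) = pCons (s' * (s * a)) (smult s (smult s' g))" by (simp add: mult_ac)
  also have "\<dots> = smult t (pCons (s' * c) (smult s g'))" unfolding s s' by (simp add: mult_ac)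
  finally show ?case using s s' prime_setD(4)[OF P] by blast
qed

text \<open>Otherwise \<open>g\<close> is divisible by every power of \<open>t\<close> up to
  constants outside \<open>P\<close>; but a single nonzero coefficient has a finite exponent
  \<open>k\<close>, and \<open>t^(k+1)\<close> is too much for it.\<close>

lemma extend_factor:
  assumes t: "uniformizer P t" and g: "g \<noteq> 0"
  shows "\<exists>n s g'. s \<notin> P \<and> g' \<notin> extend_prime P \<and> smult s g = smult (t ^ n) g'"
proof (rule ccontr)
  assume contra: "\<not> ?thesis"
  note P = uniformizerD[OF t]
  have "\<exists>s g'. s \<notin> P \<and> smult s g = smult (t ^ n) g'" for n
  proof (induction n)
    case 0
    show ?case using prime_setD(2)[OF P(1)] by (intro exI[of _ 1] exI[of _ g]) simp
  next
    case (Suc n)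
    then obtain s g' where s: "s \<notin> P" "smult s g = smult (t ^ n) g'" by blast
    then have "g' \<in> extend_prime P" using contra by blast
    then have c: "poly.coeff g' i \<in> P" for i by (simp add: coeff_mem_extend_prime)
    have "\<exists>s c. s \<notin> P \<and> s * poly.coeff g' i = t * c" for i
    proof (cases "poly.coeff g' i = 0")
      case True
      then show ?thesis using prime_setD(2)[OF P(1)] by (intro exI[of _ 1] exI[of _ 0]) simp
    next
      case False
      obtain n r b where r: "r \<notin> P" "b \<notin> P" "r * poly.coeff g' i = t ^ n * b" using uniformizerE[OF t False] .
      then obtain m where "n = Suc m" using c[of i] prime_setD(4)[OF P(1), of r "poly.coeff g' i"] by (cases n) auto
      then have "r * poly.coeff g' i = t * (t ^ m * b)" using r by (simp add: mult_ac)
      then show ?thesis using r by blast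
    qed
    then obtain s' h where s': "s' \<notin> P" "smult s' g' = smult t h" using common_denominator[OF P(1)] by blast
    have "smult (s' * s) g = smult s' (smult s g)" by simp
    also have "\<dots> = smult (t ^ n) (smult s' g')" unfolding s by (simp add: mult_ac)
    also have "\<dots> = smult (t ^ Suc n) h" unfolding s' by (simp add: mult_ac)
    finally show ?case using s s' prime_setD(4)[OF P(1)] by blast
  qed
  note div = this
  obtain i where i: "poly.coeff g i \<noteq> 0" using g by (metis leading_coeff_0_iff)
  obtain k r b where r: "r \<notin> P" "b \<notin> P" "r * poly.coeff g i = t ^ k * b" using uniformizerE[OF t i] .
  obtain s g' where s: "s \<notin> P" "smult s g = smult (t ^ Suc k) g'" using div by blast
  have "s * poly.coeff g i = t ^ Suc k * poly.coeff g' i" using arg_cong[OF s(2), of "\<lambda>p. poly.coeff p i"] by simp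
  then have "t ^ k * (s * b) = t ^ k * (t * (r * poly.coeff g' i))"
    using r(3) by (metis mult.left_commute mult.assoc power_Suc)
  then have "s * b = t * (r * poly.coeff g' i)" using P(3) by simp
  then show False using s r prime_setD(4)[OF P(1)] P(2) by metis
qed

lemma uniformizer_extend:
  assumes t: "uniformizer P t"
  shows "uniformizer (extend_prime P) [:t:]"
  unfolding uniformizer_def
proof (intro conjI allI impI)
  note P = uniformizerD[OF t]
  note c = const_mem_extend_prime[OF prime_setD(1)[OF P(1)]]
  show "prime_set (extend_prime P)" by (rule prime_set_extend[OF P(1)])
  show "[:t:] \<in> extend_prime P" "[:t:] \<noteq> 0" using P c by auto
  fix g :: "'a poly" assume "g \<noteq> 0"
  then obtain n s g' where s: "s \<notin> P" "g' \<notin> extend_prime P" "smult s g = smult (t ^ n) g'"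
    using extend_factor[OF t] by blast
  then show "\<exists>n s b. s \<notin> extend_prime P \<and> b \<notin> extend_prime P \<and> s * g = [:t:] ^ n * b"
    using c by (intro exI[of _ n] exI[of _ "[:s:]"] exI[of _ g']) (simp add: poly_const_pow)
qed

text \<open>The Gauss valuation: after splitting off \<open>t^n\<close>, every nonzero coefficient
  of \<open>g'\<close> has nonnegative value and one lies outside \<open>P\<close>. Both parts
  together say that the value at \<open>g\<close> is the minimum over the nonzero
  coefficients.\<close>

lemma valuation_extend:
  assumes t: "uniformizer P t" and g: "g \<noteq> 0"
  shows "poly.coeff g i \<noteq> 0 \<Longrightarrow>
      valuation_at (extend_prime P) (to_fract g) \<le> valuation_at P (to_fract (poly.coeff g i))"
    and "\<exists>i. poly.coeff g i \<noteq> 0 \<and>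
      valuation_at (extend_prime P) (to_fract g) = valuation_at P (to_fract (poly.coeff g i))"
proof -
  note P = uniformizerD[OF t]
  note c = const_mem_extend_prime[OF prime_setD(1)[OF P(1)]]
  obtain n s g' where s: "s \<notin> P" "g' \<notin> extend_prime P" "smult s g = smult (t ^ n) g'"
    using extend_factor[OF t g] by blast
  have s0: "s \<noteq> 0" using s prime_setD(1)[OF P(1)] by auto
  have "[:s:] * g = [:t:] ^ n * g'" using s(3) by (simp add: poly_const_pow)
  then have "to_fract [:s:] * to_fract g = to_fract [:t:] ^ n * to_fract g'"
    by (metis to_fract_mult to_fract_power)
  then have "to_fract g = (to_fract g' / to_fract [:s:]) * to_fract [:t:] powi int n"
    using s0 by (simp add: field_simps)
  moreover have "to_fract g' / to_fract [:s:] \<in> local_units (extend_prime P)"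
    using s c by (intro local_unitsI) auto
  ultimately have v: "valuation_at (extend_prime P) (to_fract g) = int n"
    using valuation_at_eq[OF uniformizer_extend[OF t]] by metis
  have co: "valuation_at P (to_fract (poly.coeff g i)) = int n + valuation_at P (to_fract (poly.coeff g' i))"
      "poly.coeff g' i \<noteq> 0" if "poly.coeff g i \<noteq> 0" for i
  proof -
    have eq: "s * poly.coeff g i = t ^ n * poly.coeff g' i" using arg_cong[OF s(3), of "\<lambda>p. poly.coeff p i"] by simp
    then show nz: "poly.coeff g' i \<noteq> 0" using that s0 by auto
    have sv: "valuation_at P (to_fract s) = 0"
      using valuation_to_fract[OF t s0] s(1) by linarith
    have "valuation_at P (to_fract t) = 1"
      using valuation_at_eq[OF t local_unitsI[of 1 P 1], of 1] prime_setD(2)[OF P(1)] by simp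
    then have "valuation_at P (to_fract t ^ n) = int n"
      using valuation_power[OF t, of "to_fract t" n] P(3) by simp
    moreover have "valuation_at P (to_fract s * to_fract (poly.coeff g i))
        = valuation_at P (to_fract t ^ n * to_fract (poly.coeff g' i))"
      using arg_cong[OF eq, of to_fract] by (metis to_fract_mult to_fract_power)
    ultimately show "valuation_at P (to_fract (poly.coeff g i)) = int n + valuation_at P (to_fract (poly.coeff g' i))"
      using valuation_mult[OF t, of "to_fract s" "to_fract (poly.coeff g i)"]
        valuation_mult[OF t, of "to_fract t ^ n" "to_fract (poly.coeff g' i)"] sv s0 that nz P(3)
      by simp
  qed
  show "valuation_at (extend_prime P) (to_fract g) \<le> valuation_at P (to_fract (poly.coeff g i))"
    if "poly.coeff g i \<noteq> 0"
    using co[OF that] valuation_to_fract(1)[OF t co(2)[OF that]] v by simp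
  obtain i where i: "poly.coeff g' i \<notin> P" using s(2) by (auto simp: coeff_mem_extend_prime)
  then have nz': "poly.coeff g' i \<noteq> 0" using prime_setD(1)[OF P(1)] by auto
  have "s * poly.coeff g i = t ^ n * poly.coeff g' i" using arg_cong[OF s(3), of "\<lambda>p. poly.coeff p i"] by simp
  then have nz: "poly.coeff g i \<noteq> 0" using nz' P(3) by auto
  have "valuation_at P (to_fract (poly.coeff g' i)) = 0" using valuation_to_fract[OF t nz'] i by linarith
  then show "\<exists>i. poly.coeff g i \<noteq> 0 \<and>
      valuation_at (extend_prime P) (to_fract g) = valuation_at P (to_fract (poly.coeff g i))"
    using co(1)[OF nz] nz v by auto
qed

lemma valuation_extend_const:
  assumes t: "uniformizer P t" and a: "a \<noteq> 0"
  shows "valuation_at (extend_prime P) (to_fract [:a:]) = valuation_at P (to_fract a)"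
proof -
  obtain i where i: "poly.coeff [:a:] i \<noteq> 0" "valuation_at (extend_prime P) (to_fract [:a:])
      = valuation_at P (to_fract (poly.coeff [:a:] i))"
    using valuation_extend(2)[OF t, of "[:a:]"] a by auto
  then have "i = 0" by (cases i) auto
  then show ?thesis using i by simp
qed

text \<open>
  The nonzero primes of \<open>A[T]\<close> lying over the generic point of \<open>Spec A\<close>. They correspond to primes of
  the polynomial ring over the fraction field, which is avoided by working up to nonzero constants.
\<close>
definition horizontal :: "'a::idom poly set \<Rightarrow> bool" where
  "horizontal Q \<longleftrightarrow> prime_set Q \<and> Q \<noteq> {0} \<and> (\<forall>a. [:a:] \<in> Q \<longrightarrow> a = 0)"

text \<open>A nonzero element \<open>d\<close> of least degree generates over the fraction field.
  Pseudo-division by \<open>d\<close> stays inside the polynomial ring at the cost of a power of the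
  leading coefficient of \<open>d\<close>.\<close>

lemma ideal_almost_principal:
  fixes I :: "'a::idom poly set"
  assumes I: "is_ideal I" "I \<noteq> {0}"
  shows "\<exists>d\<in>I. d \<noteq> 0 \<and> (\<forall>u\<in>I. \<exists>a q. a \<noteq> 0 \<and> smult a u = d * q)"
proof -
  have "\<exists>d. d \<in> I \<and> d \<noteq> 0" using I is_idealD(1)[OF I(1)] by blast
  then obtain d where d: "d \<in> I" "d \<noteq> 0"
    and min: "\<And>e. e \<in> I \<and> e \<noteq> 0 \<Longrightarrow> Polynomial.degree d \<le> Polynomial.degree e"
    using ex_has_least_nat[of "\<lambda>d. d \<in> I \<and> d \<noteq> 0" _ Polynomial.degree] by blast
  have "\<exists>a q. a \<noteq> 0 \<and> smult a u = d * q" if u: "u \<in> I" for u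
  proof -
    obtain q r where qr: "pseudo_divmod u d = (q, r)" by fastforce
    define a where "a = lead_coeff d ^ (Suc (Polynomial.degree u) - Polynomial.degree d)"
    have a: "a \<noteq> 0" using d by (simp add: a_def)
    have eq: "smult a u = d * q + r" and r: "r = 0 \<or> Polynomial.degree r < Polynomial.degree d"
      using pseudo_divmod[OF d(2) qr] by (simp_all add: a_def)
    have "r = [:a:] * u + (- q) * d" using eq by (simp add: algebra_simps)
    then have "r \<in> I" using is_idealD(2,3)[OF I(1)] u d(1) by metis
    then have "r = 0" using r min[of r] by (metis leD)
    then show ?thesis using eq a by auto
  qed
  then show ?thesis using d by blast
qed

lemma horizontal_generator:
  assumes Q: "horizontal Q"
  obtains p where "p \<in> Q" "p \<noteq> 0" "0 < Polynomial.degree p" "\<And>u. u \<in> Q \<Longrightarrow> \<exists>a q. a \<noteq> 0 \<and> smult a u = p * q"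
proof -
  have "is_ideal Q" "Q \<noteq> {0}" using Q prime_set_is_ideal by (auto simp: horizontal_def)
  then obtain p where p: "p \<in> Q" "p \<noteq> 0" "\<forall>u\<in>Q. \<exists>a q. a \<noteq> 0 \<and> smult a u = p * q"
    using ideal_almost_principal by metis
  have "0 < Polynomial.degree p"
  proof (rule ccontr)
    assume "\<not> 0 < Polynomial.degree p"
    then obtain a where "p = [:a:]" by (metis degree_eq_zeroE not_gr_zero)
    then show False using p Q by (auto simp: horizontal_def)
  qed
  then show thesis using that p by blast
qed

text \<open>Nonzero constants are units at \<open>Q\<close>, so a generator up to constants is a
  generator locally. Divisibility by all powers of \<open>p\<close> is excluded by degrees.\<close>

lemma uniformizer_horizontal:
  assumes Q: "horizontal Q" and p: "p \<in> Q" "p \<noteq> 0" "0 < Polynomial.degree p"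
    and gen: "\<And>u. u \<in> Q \<Longrightarrow> \<exists>a q. a \<noteq> 0 \<and> smult a u = p * q"
  shows "uniformizer Q p"
proof -
  have prime: "prime_set Q" and const: "\<And>a. a \<noteq> 0 \<Longrightarrow> [:a:] \<notin> Q" using Q by (auto simp: horizontal_def)
  have "\<exists>n s b. s \<notin> Q \<and> b \<notin> Q \<and> s * g = p ^ n * b" if g: "g \<noteq> 0" for g
  proof (rule ccontr)
    assume contra: "\<not> ?thesis"
    have "\<exists>a b. a \<noteq> 0 \<and> smult a g = p ^ n * b" for n
    proof (induction n)
      case 0
      show ?case by (intro exI[of _ 1] exI[of _ g]) simp
    next
      case (Suc n)
      then obtain a b where a: "a \<noteq> 0" "smult a g = p ^ n * b" by blast
      have "b \<in> Q" using contra a const[OF a(1)] by (metis smult_conv_mult)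
      then obtain c q where c: "c \<noteq> 0" "smult c b = p * q" using gen by blast
      have "smult (c * a) g = smult c (smult a g)" by simp
      also have "\<dots> = p ^ n * smult c b" unfolding a by simp
      also have "\<dots> = p ^ Suc n * q" unfolding c by (simp add: mult_ac)
      finally show ?case using a c by (intro exI[of _ "c * a"] exI[of _ q]) simp
    qed
    \<comment> \<open>The exponent is one more than the degree of \<open>g\<close>: as
      \<open>p\<close> has degree at least one, this power cannot divide \<open>g\<close>, even up
      to constants.\<close>
    then obtain a b where a: "a \<noteq> 0" "smult a g = p ^ (Polynomial.degree g + 1) * b" by blast
    define n where "n = Polynomial.degree g + 1"
    have "b \<noteq> 0" using a g by auto
    have pn: "Polynomial.degree (p ^ n) = n * Polynomial.degree p" "p ^ n \<noteq> 0"
      using p by (simp_all add: degree_power_eq)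
    have "Polynomial.degree g = Polynomial.degree (smult a g)" using a(1) by simp
    also have "\<dots> = n * Polynomial.degree p + Polynomial.degree b"
      unfolding a(2) n_def[symmetric] using pn \<open>b \<noteq> 0\<close> by (simp add: degree_mult_eq)
    also have "\<dots> \<ge> n * 1" using p(3) by (intro trans_le_add1 mult_le_mono) auto
    finally have "n * 1 \<le> Polynomial.degree g" .
    then show False by (simp add: n_def)
  qed
  then show ?thesis using prime p by (simp add: uniformizer_def)
qed

lemma horizontal_uniformizer:
  assumes Q: "horizontal Q"
  obtains p where "uniformizer Q p" "0 < Polynomial.degree p" "\<And>u. u \<in> Q \<Longrightarrow> \<exists>a q. a \<noteq> 0 \<and> smult a u = p * q"
  using horizontal_generator[OF Q] uniformizer_horizontal[OF Q] by metis

lemma horizontal_height_one: "horizontal Q \<Longrightarrow> height_one Q"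
  using horizontal_uniformizer uniformizer_height_one by metis

text \<open>A horizontal prime contains \<open>u\<close> as soon as it contains a nonzero constant
  multiple of \<open>u\<close>; so \<open>p\<close> in \<open>Q'\<close> forces all of
  \<open>Q\<close> into \<open>Q'\<close>, and both have height one.\<close>

lemma horizontal_eqI:
  assumes Q: "horizontal Q" and Q': "horizontal Q'"
    and p: "p \<in> Q'" and gen: "\<And>u. u \<in> Q \<Longrightarrow> \<exists>a q. a \<noteq> 0 \<and> smult a u = p * q"
  shows "Q = Q'"
proof -
  have prime: "prime_set Q'" and const: "\<And>a. a \<noteq> 0 \<Longrightarrow> [:a:] \<notin> Q'" using Q' by (auto simp: horizontal_def)
  have "Q \<subseteq> Q'"
  proof
    fix u assume "u \<in> Q"
    then obtain a q where a: "a \<noteq> 0" "smult a u = p * q" using gen by blast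
    have "smult a u \<in> Q'" unfolding a(2) using p by (simp add: prime_setD(4)[OF prime])
    then have "[:a:] * u \<in> Q'" by simp
    then show "u \<in> Q'" using const[OF a(1)] prime_setD(4)[OF prime] by blast
  qed
  then show ?thesis by (rule height_one_subset_eq[OF horizontal_height_one[OF Q'] horizontal_height_one[OF Q]])
qed

text \<open>Any nonzero prime inside the contraction of \<open>Q\<close> extends to a nonzero prime
  inside \<open>Q\<close>, hence to \<open>Q\<close>, and an extension determines its prime. So a
  nonzero contraction has height one and extends to \<open>Q\<close>.\<close>

lemma height_one_poly_cases:
  assumes Q: "height_one Q"
  obtains (horizontal) "horizontal Q" | (extend) P where "height_one P" "Q = extend_prime P"
proof (cases "horizontal Q")
  case False
  note Q' = height_one_prime[OF Q]
  let ?P = "{a. [:a:] \<in> Q}"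
  have P: "prime_set ?P" by (rule prime_set_contract[OF Q'])
  have eq: "extend_prime P = Q" if P: "prime_set P" "P \<subseteq> ?P" "P \<noteq> {0}" for P
  proof -
    have "extend_prime P \<subseteq> extend_prime ?P" using P(2) by (auto simp: extend_prime_def)
    then have "extend_prime P \<subseteq> Q" using extend_contract_subset[OF Q'] by blast
    moreover have "extend_prime P \<noteq> {0}"
    proof -
      obtain a where a: "a \<in> P" "a \<noteq> 0" using P prime_setD(1)[OF P(1)] by blast
      then have "[:a:] \<in> extend_prime P" using const_mem_extend_prime[OF prime_setD(1)[OF P(1)]] by simp
      then show ?thesis using a(2) by (metis pCons_eq_0_iff singletonD)
    qed
    ultimately show ?thesis using Q prime_set_extend[OF P(1)] unfolding height_one_def by blast
  qed
  have ne: "?P \<noteq> {0}" using False Q Q' by (auto simp: horizontal_def height_one_def)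
  have "height_one ?P" unfolding height_one_def
  proof (intro conjI allI impI P ne)
    fix P' assume P': "prime_set P' \<and> P' \<subseteq> ?P"
    show "P' = {0} \<or> P' = ?P"
    proof (cases "P' = {0}")
      case False
      then have "extend_prime P' = Q" using eq P' by simp
      then show ?thesis using contract_extend[of P'] P' prime_setD(1) by metis
    qed simp
  qed
  then show thesis using extend[of ?P] eq[OF P _ ne] by simp
qed (rule horizontal)

text \<open>Up to constants \<open>g\<close> is a multiple of the generator \<open>p\<close> of one
  such prime; any other one contains the cofactor, whose degree is smaller.\<close>

lemma finite_horizontal:
  assumes "(g :: 'a::idom poly) \<noteq> 0"
  shows "finite {Q. horizontal Q \<and> g \<in> Q}"
  using assms
proof (induction "Polynomial.degree g" arbitrary: g rule: less_induct)
  case (less g)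
  show ?case
  proof (cases "{Q. horizontal Q \<and> g \<in> Q} = {}")
    case False
    then obtain Q where Q: "horizontal Q" "g \<in> Q" by blast
    obtain p where p: "uniformizer Q p" "0 < Polynomial.degree p"
      "\<And>u. u \<in> Q \<Longrightarrow> \<exists>a q. a \<noteq> 0 \<and> smult a u = p * q" using horizontal_uniformizer[OF Q(1)] by blast
    obtain a q where q: "a \<noteq> 0" "smult a g = p * q" using p(3)[OF Q(2)] by blast
    have q0: "q \<noteq> 0" "p \<noteq> 0" using q less.prems by auto
    have "Polynomial.degree g = Polynomial.degree (smult a g)" using q(1) by simp
    also have "\<dots> = Polynomial.degree p + Polynomial.degree q" unfolding q using q0 by (simp add: degree_mult_eq)
    finally have "finite {Q. horizontal Q \<and> q \<in> Q}" using less.hyps[of q] p(2) q0 by simp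
    moreover have "{Q. horizontal Q \<and> g \<in> Q} \<subseteq> insert Q {Q. horizontal Q \<and> q \<in> Q}"
    proof
      fix Q' assume "Q' \<in> {Q. horizontal Q \<and> g \<in> Q}"
      then have Q': "horizontal Q'" "g \<in> Q'" by auto
      have prime: "prime_set Q'" using Q' by (simp add: horizontal_def)
      have "p * q \<in> Q'" using q(2) Q'(2) prime_setD(4)[OF prime] by (metis smult_conv_mult)
      then have "p \<in> Q' \<or> q \<in> Q'" using prime_setD(4)[OF prime] by blast
      then show "Q' \<in> insert Q {Q. horizontal Q \<and> q \<in> Q}"
        using horizontal_eqI[OF Q(1) Q'(1) _ p(3)] Q'(1) by auto
    qed
    ultimately show ?thesis by (meson finite_insert finite_subset)
  next
    case True
    then show ?thesis by (metis finite.emptyI)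
  qed
qed

text \<open>\<open>Q\<close> is the trace on \<open>A[T]\<close> of the ideal that a factor
  \<open>p\<close> of \<open>h\<close> generates over the fraction field; the least positive degree
  of \<open>p\<close> makes it prime.\<close>

lemma exists_horizontal:
  assumes h: "0 < Polynomial.degree (h :: 'a::idom poly)"
  shows "\<exists>Q. horizontal Q \<and> h \<in> Q"
proof -
  define S where "S = {p. 0 < Polynomial.degree p \<and> (\<exists>a q. a \<noteq> 0 \<and> smult a h = p * q)}"
  have "h \<in> S" using h unfolding S_def by (intro CollectI conjI exI[of _ 1]) auto
  then obtain p where p: "p \<in> S" and min: "\<And>e. e \<in> S \<Longrightarrow> Polynomial.degree p \<le> Polynomial.degree e"
    using ex_has_least_nat[of "\<lambda>p. p \<in> S" h Polynomial.degree] by blast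
  \<comment> \<open>\<open>p\<close> is an irreducible factor of \<open>h\<close> over the fraction field.\<close>
  define Q where "Q = {f. \<exists>a q. a \<noteq> 0 \<and> smult a f = p * q}"
  have p': "0 < Polynomial.degree p" "p \<noteq> 0" using p by (auto simp: S_def)
  obtain a0 q0 where a0: "a0 \<noteq> 0" "smult a0 h = p * q0" using p by (auto simp: S_def)
  have hQ: "h \<in> Q" unfolding Q_def using a0 by blast
  have pQ: "p \<in> Q" unfolding Q_def by (intro CollectI exI[of _ 1]) simp
  have const: "c = 0" if c: "[:c:] \<in> Q" for c
  proof -
    obtain a q where a: "a \<noteq> 0" "smult a [:c:] = p * q" using c by (auto simp: Q_def)
    have "q = 0"
    proof (rule ccontr)
      assume "q \<noteq> 0"
      then have "Polynomial.degree (p * q) \<ge> Polynomial.degree p" using p' by (simp add: degree_mult_eq)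
      moreover have "Polynomial.degree (p * q) = 0" unfolding a(2)[symmetric] by simp
      ultimately show False using p' by simp
    qed
    then show ?thesis using a by simp
  qed
  have mult: "f * g \<in> Q" if "f \<in> Q" for f g
  proof -
    obtain a q where a: "a \<noteq> 0" "smult a f = p * q" using \<open>f \<in> Q\<close> by (auto simp: Q_def)
    then have "smult a (f * g) = p * (q * g)" by (metis mult.assoc mult_smult_left)
    then show ?thesis using a(1) unfolding Q_def by blast
  qed
  have add: "f + g \<in> Q" if "f \<in> Q" "g \<in> Q" for f g
  proof -
    obtain a q b r where a: "a \<noteq> 0" "smult a f = p * q" "b \<noteq> 0" "smult b g = p * r"
      using \<open>f \<in> Q\<close> \<open>g \<in> Q\<close> by (auto simp: Q_def)
    have "smult (a * b) (f + g) = smult b (smult a f) + smult a (smult b g)"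
      by (simp add: smult_add_right mult_ac)
    also have "\<dots> = p * (smult b q + smult a r)" unfolding a by (simp add: distrib_left)
    finally show ?thesis using a unfolding Q_def by (intro CollectI exI[of _ "a * b"]) auto
  qed
  have prime: "g \<in> Q" if fg: "f * g \<in> Q" "f \<notin> Q" for f g
  proof -
    \<comment> \<open>\<open>f\<close> and \<open>p\<close> are compared through their greatest
      common divisor \<open>d\<close> over the fraction field.\<close>
    define I where "I = {p * x + f * y | x y. True}"
    have I: "is_ideal I"
    proof (rule is_idealI)
      show "0 \<in> I" unfolding I_def by (intro CollectI exI[of _ 0]) simp
      show "u + v \<in> I" if "u \<in> I" "v \<in> I" for u v
      proof -
        obtain x y x' y' where "u = p * x + f * y" "v = p * x' + f * y'" using \<open>u \<in> I\<close> \<open>v \<in> I\<close> by (auto simp: I_def)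
        then have "u + v = p * (x + x') + f * (y + y')" by (simp add: algebra_simps)
        then show ?thesis unfolding I_def by blast
      qed
      show "r * u \<in> I" if "u \<in> I" for u r
      proof -
        obtain x y where "u = p * x + f * y" using \<open>u \<in> I\<close> by (auto simp: I_def)
        then have "r * u = p * (r * x) + f * (r * y)" by (simp add: algebra_simps)
        then show ?thesis unfolding I_def by blast
      qed
    qed
    have pI: "p \<in> I" unfolding I_def by (intro CollectI exI[of _ 1] exI[of _ 0]) simp
    have fI: "f \<in> I" unfolding I_def by (intro CollectI exI[of _ 0] exI[of _ 1]) simp
    have "I \<noteq> {0}" using pI p' by auto
    then obtain d where d: "d \<in> I" "d \<noteq> 0" "\<And>u. u \<in> I \<Longrightarrow> \<exists>a q. a \<noteq> 0 \<and> smult a u = d * q"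
      using ideal_almost_principal[OF I] by blast
    obtain a e where a: "a \<noteq> 0" "smult a p = d * e" using d(3)[OF pI] by blast
    have e0: "e \<noteq> 0" using a p' by auto
    have dege: "Polynomial.degree p = Polynomial.degree d + Polynomial.degree e"
      using arg_cong[OF a(2), of Polynomial.degree] a(1) d(2) e0 by (simp add: degree_mult_eq)
    show ?thesis
    proof (cases "Polynomial.degree d = 0")
      case True
      \<comment> \<open>Here \<open>p\<close> and \<open>f\<close> are coprime: the Bezout relation,
        multiplied by \<open>g\<close>, puts \<open>g\<close> into \<open>Q\<close>.\<close>
      then obtain c where c: "d = [:c:]" by (metis degree_eq_zeroE)
      then have "c \<noteq> 0" using d by simp
      obtain x y where xy: "d = p * x + f * y" using d(1) by (auto simp: I_def)
      obtain b q where b: "b \<noteq> 0" "smult b (f * g) = p * q" using fg by (auto simp: Q_def)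
      have "smult (b * c) g = smult b (d * g)" unfolding c by simp
      also have "\<dots> = p * smult b (x * g) + smult b (f * g) * y" unfolding xy
        by (simp add: algebra_simps smult_add_right)
      also have "\<dots> = p * (smult b (x * g) + q * y)" unfolding b by (simp add: algebra_simps)
      finally show ?thesis unfolding Q_def using b(1) \<open>c \<noteq> 0\<close>
        by (intro CollectI exI[of _ "b * c"]) auto
    next
      case False
      \<comment> \<open>Here \<open>d\<close> is again a factor of \<open>h\<close>, so by
        minimality \<open>p\<close> and \<open>d\<close> agree up to constants and \<open>p\<close>
        divides \<open>f\<close> over the fraction field, contrary to assumption.\<close>
      have "smult (a * a0) h = d * (e * q0)"
      proof -
        have "smult (a * a0) h = smult a (p * q0)" using a0 by (metis smult_smult)
        also have "\<dots> = smult a p * q0" by simp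
        finally show ?thesis unfolding a by (simp add: mult.assoc)
      qed
      then have "d \<in> S" unfolding S_def using False a(1) a0(1)
        by (intro CollectI conjI exI[of _ "a * a0"] exI[of _ "e * q0"]) auto
      then have "Polynomial.degree e = 0" using min[of d] dege by simp
      then obtain c where c: "e = [:c:]" by (metis degree_eq_zeroE)
      then have "c \<noteq> 0" using e0 by simp
      obtain b w where b: "b \<noteq> 0" "smult b f = d * w" using d(3)[OF fI] by blast
      have "smult (c * b) f = smult c (d * w)" using b by (metis smult_smult)
      also have "\<dots> = (d * e) * w" unfolding c by simp
      also have "\<dots> = p * smult a w" unfolding a(2)[symmetric] by simp
      finally have "f \<in> Q" unfolding Q_def using b(1) \<open>c \<noteq> 0\<close> by (intro CollectI exI[of _ "c * b"] exI[of _ "smult a w"]) simp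
      then show ?thesis using fg by simp
    qed
  qed
  have "0 \<in> Q" unfolding Q_def by (intro CollectI exI[of _ 1] exI[of _ 0]) simp
  moreover have "1 \<notin> Q" using const[of 1] by (auto simp: one_pCons)
  moreover have "f * g \<in> Q \<longleftrightarrow> f \<in> Q \<or> g \<in> Q" for f g
    using mult[of f g] mult[of g f] prime[of f g] by (auto simp: mult.commute)
  ultimately have "prime_set Q" unfolding prime_set_def using add by simp
  then have "horizontal Q" using pQ p' const by (auto simp: horizontal_def)
  then show ?thesis using hQ by blast
qed

section \<open>Regular functions on the affine line\<close>

locale noetherian_normal =
  fixes ring_type :: "'a::idom itself"
  assumes noeth: "noetherian_ring (cring_class_ops :: 'a ring)"
    and normal: "normal_domain TYPE('a)"
begin

lemma height_one_extend:
  fixes P :: "'a set"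
  assumes "height_one P"
  shows "height_one (extend_prime P)"
  using height_one_uniformizer[OF noeth normal assms] uniformizer_extend uniformizer_height_one by blast

lemma poly_uniformizer:
  fixes Q :: "'a poly set"
  assumes Q: "height_one Q"
  shows "\<exists>t. uniformizer Q t"
  using Q
proof (cases rule: height_one_poly_cases)
  case horizontal
  then show ?thesis using horizontal_uniformizer by metis
next
  case (extend P)
  then show ?thesis using height_one_uniformizer[OF noeth normal] uniformizer_extend by blast
qed

lemma finite_height_one_poly:
  assumes g: "(g :: 'a poly) \<noteq> 0"
  shows "finite {Q. height_one Q \<and> g \<in> Q}"
proof -
  let ?c = "lead_coeff g"
  have "{Q. height_one Q \<and> g \<in> Q} \<subseteq> {Q. horizontal Q \<and> g \<in> Q} \<union> extend_prime ` {P. height_one P \<and> ?c \<in> P}"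
  proof
    fix Q assume "Q \<in> {Q. height_one Q \<and> g \<in> Q}"
    then have Q: "height_one Q" "g \<in> Q" by auto
    from Q(1) show "Q \<in> {Q. horizontal Q \<and> g \<in> Q} \<union> extend_prime ` {P. height_one P \<and> ?c \<in> P}"
    proof (cases rule: height_one_poly_cases)
      case horizontal
      then show ?thesis using Q by simp
    next
      case (extend P)
      then have "?c \<in> P" using Q(2) by (simp add: coeff_mem_extend_prime)
      then show ?thesis using extend by blast
    qed
  qed
  moreover have "finite {P. height_one P \<and> ?c \<in> P}"
    using finite_height_one_containing[OF noeth] g by simp
  ultimately show ?thesis using finite_horizontal[OF g] by (meson finite_Un finite_imageI finite_subset)
qed

text \<open>Take a denominator of least degree. If it is not constant, it lies in a horizontal
  \<open>Q\<close>; regularity at \<open>Q\<close> forces the numerator into \<open>Q\<close> too,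
  and the generator of \<open>Q\<close> cancels up to constants, which lowers the degree.\<close>

lemma Inter_horizontal:
  fixes f :: "'a poly fract"
  assumes f: "\<And>Q. horizontal Q \<Longrightarrow> f \<in> local_ring Q"
  shows "\<exists>g a. a \<noteq> 0 \<and> f = to_fract g / to_fract [:a:]"
proof -
  define S where "S = {h. h \<noteq> 0 \<and> (\<exists>g. f = to_fract g / to_fract h)}"
  obtain b a where "f = to_fract b / to_fract a" "a \<noteq> 0"
    by (rule fractE)
  then have "a \<in> S" by (auto simp: S_def)
  then obtain h where h: "h \<in> S" and min: "\<And>e. e \<in> S \<Longrightarrow> Polynomial.degree h \<le> Polynomial.degree e"
    using ex_has_least_nat[of "\<lambda>p. p \<in> S" a Polynomial.degree] by blast
  obtain g where g: "f = to_fract g / to_fract h" "h \<noteq> 0" using h by (auto simp: S_def)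
  have "Polynomial.degree h = 0"
  proof (rule ccontr)
    assume "Polynomial.degree h \<noteq> 0"
    then obtain Q where Q: "horizontal Q" "h \<in> Q" using exists_horizontal by blast
    have prime: "prime_set Q" using Q by (simp add: horizontal_def)
    obtain c d where d: "d \<notin> Q" "f = to_fract c / to_fract d" using f[OF Q(1)] by (auto simp: mem_local_ring_iff)
    have "d \<noteq> 0" using d prime_setD(1)[OF prime] by auto
    then have "to_fract (g * d) = to_fract (c * h)" using d g by (simp add: field_simps)
    then have "g * d = c * h" by (simp only: to_fract_eq_iff)
    then have "g \<in> Q" using Q(2) d(1) prime_setD(4)[OF prime] by metis
    obtain p where p: "uniformizer Q p" "0 < Polynomial.degree p" "\<And>u. u \<in> Q \<Longrightarrow> \<exists>a q. a \<noteq> 0 \<and> smult a u = p * q"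
      using horizontal_uniformizer[OF Q(1)] by blast
    obtain a q where a: "a \<noteq> 0" "smult a g = p * q" using p(3)[OF \<open>g \<in> Q\<close>] by blast
    obtain b r where b: "b \<noteq> 0" "smult b h = p * r" using p(3)[OF Q(2)] by blast
    have r0: "r \<noteq> 0" "p \<noteq> 0" using b g by auto
    have deg: "Polynomial.degree h = Polynomial.degree p + Polynomial.degree r"
      using arg_cong[OF b(2), of Polynomial.degree] b(1) r0 by (simp add: degree_mult_eq)
    have ag: "to_fract [:a:] * to_fract g = to_fract p * to_fract q"
      using arg_cong[OF a(2), of to_fract] by (simp only: smult_conv_mult to_fract_mult)
    have bh: "to_fract [:b:] * to_fract h = to_fract p * to_fract r"
      using arg_cong[OF b(2), of to_fract] by (simp only: smult_conv_mult to_fract_mult)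
    have nz: "to_fract [:a:] \<noteq> 0" "to_fract [:b:] \<noteq> 0" "to_fract h \<noteq> 0" "to_fract r \<noteq> 0" "to_fract p \<noteq> 0"
      using a b g r0 by auto
    have "f = (to_fract [:b:] * (to_fract [:a:] * to_fract g)) / (to_fract [:a:] * (to_fract [:b:] * to_fract h))"
      unfolding g(1) using nz by simp
    also have "\<dots> = to_fract ([:b:] * q) / to_fract ([:a:] * r)"
      unfolding ag bh using nz by (simp del: mult_pCons_left)
    finally have "[:a:] * r \<in> S" unfolding S_def using a(1) r0 by auto
    then have "Polynomial.degree h \<le> Polynomial.degree ([:a:] * r)" using min by blast
    moreover have "Polynomial.degree ([:a:] * r) = Polynomial.degree r" using a(1) by simp
    ultimately show False using deg p(2) by simp
  qed
  then obtain a where "h = [:a:]" by (metis degree_eq_zeroE)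
  then show ?thesis using g by (intro exI[of _ g] exI[of _ a]) auto
qed

text \<open>Horizontal primes leave only a constant \<open>a\<close> as denominator. At extended
  primes the Gauss valuation bounds the order of \<open>a\<close> by that of each coefficient of
  \<open>g\<close>, so \<open>a\<close> divides the coefficients by
  \<open>Inter_local_rings\<close>.\<close>

lemma Inter_local_rings_poly:
  fixes f :: "'a poly fract"
  assumes f: "\<And>Q. height_one Q \<Longrightarrow> f \<in> local_ring Q"
  shows "f \<in> range to_fract"
proof (cases "f = 0")
  case True
  then show ?thesis by (metis rangeI to_fract_0)
next
  case f0: False
  obtain g a where g: "a \<noteq> 0" "f = to_fract g / to_fract [:a:]"
    using Inter_horizontal[of f] f horizontal_height_one by blast
  have g0: "g \<noteq> 0" using g f0 by auto
  have "a dvd poly.coeff g i" for i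
  proof (cases "poly.coeff g i = 0")
    case False
    have "to_fract (poly.coeff g i) / to_fract a \<in> range to_fract"
    proof (rule Inter_local_rings[OF noeth normal])
      fix P :: "'a set" assume P: "height_one P"
      obtain t where t: "uniformizer P t" using height_one_uniformizer[OF noeth normal P] by blast
      note t' = uniformizer_extend[OF t]
      have "0 \<le> valuation_at (extend_prime P) f"
        using f[OF height_one_extend[OF P]] mem_local_ring_iff_valuation[OF t' f0] by simp
      also have "\<dots> = valuation_at (extend_prime P) (to_fract g) - valuation_at P (to_fract a)"
        unfolding g(2) using valuation_divide[OF t', of "to_fract g" "to_fract [:a:]"] g(1) g0
          valuation_extend_const[OF t g(1)] by simp
      also have "\<dots> \<le> valuation_at P (to_fract (poly.coeff g i)) - valuation_at P (to_fract a)"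
        using valuation_extend(1)[OF t g0 False] by simp
      also have "\<dots> = valuation_at P (to_fract (poly.coeff g i) / to_fract a)"
        using valuation_divide[OF t, of "to_fract (poly.coeff g i)" "to_fract a"] g(1) False by simp
      finally show "to_fract (poly.coeff g i) / to_fract a \<in> local_ring P"
        using mem_local_ring_iff_valuation[OF t, of "to_fract (poly.coeff g i) / to_fract a"] g(1) False by simp
    qed
    then obtain c where "to_fract (poly.coeff g i) / to_fract a = to_fract c" by blast
    then have "to_fract (poly.coeff g i) = to_fract (a * c)" using g(1) by (simp add: field_simps)
    then have "poly.coeff g i = a * c" by (simp only: to_fract_eq_iff)
    then show ?thesis by simp
  qed simp
  then have "[:a:] dvd g" by (simp add: const_poly_dvd_iff)
  then obtain c where "g = [:a:] * c" by (rule dvdE)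
  then have "f = to_fract c" using g by (simp del: mult_pCons_left)
  then show ?thesis by simp
qed

text \<open>A local form of \<open>Inter_local_rings_poly\<close>: regularity at a prime of any
  height is tested at the height one primes inside it.\<close>

lemma mem_local_ringI_valuation:
  fixes f :: "'a poly fract"
  assumes P: "prime_set P" and f0: "f \<noteq> 0"
    and v: "\<And>Q. height_one Q \<Longrightarrow> Q \<subseteq> P \<Longrightarrow> 0 \<le> valuation_at Q f"
  shows "f \<in> local_ring P"
proof -
  define bad where "bad = {Q. height_one Q \<and> valuation_at Q f < 0}"
  obtain g h where gh: "f = to_fract g / to_fract h" "h \<noteq> 0"
    by (rule fractE)
  have g0: "g \<noteq> 0" using gh f0 by auto
  have "bad \<subseteq> {Q. height_one Q \<and> h \<in> Q}"
  proof clarify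
    fix Q assume Q: "Q \<in> bad"
    then obtain t where t: "uniformizer Q t" using poly_uniformizer by (auto simp: bad_def)
    have "valuation_at Q f = valuation_at Q (to_fract g) - valuation_at Q (to_fract h)"
      unfolding gh(1) using valuation_divide[OF t] g0 gh(2) by simp
    then have "0 < valuation_at Q (to_fract h)"
      using Q valuation_to_fract(1)[OF t g0] by (simp add: bad_def)
    then show "height_one Q \<and> h \<in> Q" using valuation_to_fract(2)[OF t gh(2)] Q by (simp add: bad_def)
  qed
  then have fin: "finite bad" using finite_height_one_poly[OF gh(2)] finite_subset by blast
  have "\<exists>b. b \<in> Q \<and> b \<notin> P" if "Q \<in> bad" for Q using that v by (force simp: bad_def)
  then obtain b where b: "\<And>Q. Q \<in> bad \<Longrightarrow> b Q \<in> Q \<and> b Q \<notin> P" by metis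
  \<comment> \<open>\<open>f\<close> has finitely many poles, none of them passing through \<open>P\<close>, and \<open>d\<close> clears them.\<close>
  define d where "d = (\<Prod>Q\<in>bad. b Q ^ nat (- valuation_at Q f))"
  have dP: "d \<notin> P" unfolding d_def using b prime_setD(5)[OF P] by (intro prime_set_prod[OF P fin]) auto
  have d0: "d \<noteq> 0" using dP prime_setD(1)[OF P] by auto
  have b0: "b Q \<noteq> 0" if "Q \<in> bad" for Q using b[OF that] prime_setD(1)[OF P] by auto
  have "to_fract d * f \<in> range to_fract"
  proof (rule Inter_local_rings_poly)
    fix Q :: "'a poly set" assume Q: "height_one Q"
    obtain t where t: "uniformizer Q t" using poly_uniformizer[OF Q] by blast
    have "0 \<le> valuation_at Q (to_fract d) + valuation_at Q f"
    proof (cases "Q \<in> bad")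
      case True
      define e where "e = (\<Prod>Q\<in>bad - {Q}. b Q ^ nat (- valuation_at Q f))"
      have "d = b Q ^ nat (- valuation_at Q f) * e"
        unfolding d_def e_def using fin True by (rule prod.remove)
      then have de: "to_fract d = to_fract (b Q) ^ nat (- valuation_at Q f) * to_fract e"
        by (simp add: to_fract_power)
      have e0: "e \<noteq> 0" using de d0 by auto
      have "valuation_at Q (to_fract d) = int (nat (- valuation_at Q f)) * valuation_at Q (to_fract (b Q))
          + valuation_at Q (to_fract e)"
        unfolding de using valuation_mult[OF t] valuation_power[OF t] b0[OF True] e0 by simp
      moreover have "1 \<le> valuation_at Q (to_fract (b Q))"
        using valuation_to_fract(2)[OF t b0[OF True]] b[OF True] by simp
      then have "int (nat (- valuation_at Q f)) * 1 \<le> int (nat (- valuation_at Q f)) * valuation_at Q (to_fract (b Q))"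
        by (intro mult_left_mono) auto
      ultimately show ?thesis using valuation_to_fract(1)[OF t e0] by linarith
    next
      case False
      then show ?thesis using Q valuation_to_fract(1)[OF t d0] by (simp add: bad_def)
    qed
    then show "to_fract d * f \<in> local_ring Q"
      using mem_local_ring_iff_valuation[OF t, of "to_fract d * f"] valuation_mult[OF t, of "to_fract d" f] d0 f0 by simp
  qed
  then obtain c where "to_fract d * f = to_fract c" by blast
  then have "f = to_fract c / to_fract d" using d0 by (simp add: field_simps)
  then show ?thesis using dP unfolding mem_local_ring_iff by blast
qed

end

section \<open>Divisors and linear equivalence\<close>

text \<open>The calculus of divisors and linear equivalence rests on these two properties, which
  \<open>A\<close> and \<open>A[T]\<close> share.\<close>

locale krull_type =
  fixes ring_type :: "'b::idom itself"
  assumes ex_uniformizer: "\<And>P :: 'b set. height_one P \<Longrightarrow> \<exists>t. uniformizer P t"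
    and finite_containing: "\<And>a :: 'b. a \<noteq> 0 \<Longrightarrow> finite {P. height_one P \<and> a \<in> P}"
begin

lemma principal_divisor_eq:
  "principal_divisor f (P :: 'b set) = (if height_one P then valuation_at P f else 0)"
  by (simp add: principal_divisor_def prime_divisor_iff)

lemma principal_divisor_mult:
  assumes "f \<noteq> 0" "g \<noteq> 0"
  shows "principal_divisor (f * g) (P :: 'b set) = principal_divisor f P + principal_divisor g P"
  using ex_uniformizer[of P] valuation_mult[OF _ assms, of P] by (auto simp: principal_divisor_eq)

lemma principal_divisor_one: "principal_divisor 1 (P :: 'b set) = 0"
  using principal_divisor_mult[of 1 1 P] by simp

lemma principal_divisor_inverse:
  assumes "f \<noteq> 0"
  shows "principal_divisor (inverse f) (P :: 'b set) = - principal_divisor f P"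
  using principal_divisor_mult[of f "inverse f" P] assms principal_divisor_one[of P] by simp

lemma finite_principal_divisor:
  assumes f: "f \<noteq> 0"
  shows "finite {P :: 'b set. principal_divisor f P \<noteq> 0}"
proof -
  obtain g h where gh: "f = to_fract g / to_fract h" "h \<noteq> 0"
    by (rule fractE)
  have g0: "g \<noteq> 0" using gh f by auto
  have "{P. principal_divisor f P \<noteq> 0} \<subseteq> {P. height_one P \<and> g \<in> P} \<union> {P. height_one P \<and> h \<in> P}"
  proof
    fix P assume "P \<in> {P. principal_divisor f P \<noteq> 0}"
    then have P: "height_one P" "valuation_at P f \<noteq> 0" by (auto simp: principal_divisor_eq split: if_splits)
    obtain t where t: "uniformizer P t" using ex_uniformizer[OF P(1)] by blast
    have "valuation_at P f = valuation_at P (to_fract g) - valuation_at P (to_fract h)"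
      unfolding gh(1) using valuation_divide[OF t] g0 gh(2) by simp
    then have "0 < valuation_at P (to_fract g) \<or> 0 < valuation_at P (to_fract h)"
      using P(2) valuation_to_fract(1)[OF t g0] valuation_to_fract(1)[OF t gh(2)] by linarith
    then show "P \<in> {P. height_one P \<and> g \<in> P} \<union> {P. height_one P \<and> h \<in> P}"
      using P(1) valuation_to_fract(2)[OF t g0] valuation_to_fract(2)[OF t gh(2)] by auto
  qed
  then show ?thesis using finite_containing[OF g0] finite_containing[OF gh(2)]
    by (meson finite_Un finite_subset)
qed

lemma weil_divisor_iff: "weil_divisor D \<longleftrightarrow> finite {P :: 'b set. D P \<noteq> 0} \<and> (\<forall>P. D P \<noteq> 0 \<longrightarrow> height_one P)"
  by (simp add: weil_divisor_def prime_divisor_iff)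

lemma weil_divisor_add_principal:
  assumes D: "weil_divisor D" and f: "f \<noteq> 0"
  shows "weil_divisor (\<lambda>P :: 'b set. D P + principal_divisor f P)"
  unfolding weil_divisor_iff
proof
  have "{P. D P + principal_divisor f P \<noteq> 0} \<subseteq> {P. D P \<noteq> 0} \<union> {P. principal_divisor f P \<noteq> 0}" by auto
  then show "finite {P. D P + principal_divisor f P \<noteq> 0}"
    using D finite_principal_divisor[OF f] unfolding weil_divisor_iff by (meson finite_Un finite_subset)
  show "\<forall>P. D P + principal_divisor f P \<noteq> 0 \<longrightarrow> height_one P"
    using D by (auto simp: weil_divisor_iff principal_divisor_eq split: if_splits)
qed

lemma linear_equivalence_iff:
  "(D, E) \<in> linear_equivalence \<longleftrightarrow>
    weil_divisor D \<and> (\<exists>f. f \<noteq> 0 \<and> E = (\<lambda>P :: 'b set. D P + principal_divisor f P))"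
proof -
  have "(\<forall>P. E P = D P + principal_divisor f P) \<longleftrightarrow> E = (\<lambda>P. D P + principal_divisor f P)" for f
    by (rule fun_eq_iff[symmetric])
  then show ?thesis
    unfolding linear_equivalence_def by (auto intro: weil_divisor_add_principal)
qed

lemma equiv_linear_equivalence:
  "equiv (Collect weil_divisor) (linear_equivalence :: (('b set \<Rightarrow> int) \<times> ('b set \<Rightarrow> int)) set)"
proof (rule equivI)
  show "linear_equivalence \<subseteq> Collect weil_divisor \<times> Collect (weil_divisor :: ('b set \<Rightarrow> int) \<Rightarrow> bool)"
    by (auto simp: linear_equivalence_def)
  show "refl_on (Collect weil_divisor) (linear_equivalence :: (('b set \<Rightarrow> int) \<times> ('b set \<Rightarrow> int)) set)"
    unfolding refl_on_def by (auto simp: linear_equivalence_iff fun_eq_iff principal_divisor_one intro: exI[of _ 1])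
  show "sym (linear_equivalence :: (('b set \<Rightarrow> int) \<times> ('b set \<Rightarrow> int)) set)"
  proof (rule symI)
    fix D E :: "'b set \<Rightarrow> int" assume "(D, E) \<in> linear_equivalence"
    then obtain f where f: "weil_divisor D" "f \<noteq> 0" "E = (\<lambda>P. D P + principal_divisor f P)"
      by (auto simp: linear_equivalence_iff)
    then have "weil_divisor E" "D = (\<lambda>P. E P + principal_divisor (inverse f) P)"
      unfolding f(3) using weil_divisor_add_principal[OF f(1,2)] principal_divisor_inverse[OF f(2)] by auto
    then show "(E, D) \<in> linear_equivalence" using f(2) unfolding linear_equivalence_iff
      by (intro conjI exI[of _ "inverse f"]) auto
  qed
  show "trans (linear_equivalence :: (('b set \<Rightarrow> int) \<times> ('b set \<Rightarrow> int)) set)"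
  proof (rule transI)
    fix D E F :: "'b set \<Rightarrow> int" assume "(D, E) \<in> linear_equivalence" "(E, F) \<in> linear_equivalence"
    then obtain f g where f: "weil_divisor D" "f \<noteq> 0" "E = (\<lambda>P. D P + principal_divisor f P)"
      "g \<noteq> 0" "F = (\<lambda>P. E P + principal_divisor g P)"
      by (auto simp: linear_equivalence_iff)
    then show "(D, F) \<in> linear_equivalence" unfolding linear_equivalence_iff
      by (intro conjI exI[of _ "f * g"]) (auto simp: fun_eq_iff principal_divisor_mult)
  qed
qed

lemma divisor_classes_iff:
  "C \<in> divisor_classes \<longleftrightarrow> (\<exists>D :: 'b set \<Rightarrow> int. weil_divisor D \<and> C = linear_equivalence `` {D})"
  by (auto simp: divisor_classes_def quotient_def)

end

lemma mem_supp_iff: "P \<in> supp E \<longleftrightarrow> prime_set P \<and> (\<exists>Q. E Q \<noteq> 0 \<and> Q \<subseteq> P)"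
  by (auto simp: supp_def mem_zero_locus_iff)

lemma mem_complement_iff:
  "P \<in> spectrum cring_class_ops - supp E \<longleftrightarrow> prime_set P \<and> (\<forall>Q. Q \<subseteq> P \<longrightarrow> E Q = 0)"
  by (auto simp: mem_supp_iff spectrum_class_iff)

lemma closedin_supp:
  assumes "weil_divisor E"
  shows "closedin (zariski cring_class_ops) (supp E)"
  unfolding supp_def using assms
  by (intro closedin_Union) (auto simp: weil_divisor_def closedin_zariski_class)

lemma openin_complement:
  fixes E :: "'a::idom set \<Rightarrow> int"
  assumes "weil_divisor E"
  shows "openin (zariski cring_class_ops) (spectrum cring_class_ops - supp E)"
  using closedin_supp[OF assms] ring.topspace_zariski[OF cring.axioms(1)[OF cring_class]]
  unfolding closedin_def by metis

lemma complement_nonempty: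
  fixes E :: "'a::idom set \<Rightarrow> int"
  assumes "weil_divisor E"
  shows "spectrum cring_class_ops - supp E \<noteq> {}"
proof -
  have "{0} \<in> spectrum cring_class_ops - supp E"
    unfolding mem_complement_iff
  proof (intro conjI allI impI prime_set_zero)
    fix Q :: "'a set" assume Q: "Q \<subseteq> {0}"
    show "E Q = 0"
    proof (rule ccontr)
      assume "E Q \<noteq> 0"
      then have "height_one Q" using assms by (simp add: weil_divisor_def prime_divisor_iff)
      then show False using Q prime_setD(1)[of Q] by (auto simp: height_one_def)
    qed
  qed
  then show ?thesis by blast
qed

lemma regular_on_closed:
  assumes U: "openin (zariski cring_class_ops) U"
  shows "x \<in> regular_on U \<Longrightarrow> y \<in> regular_on U \<Longrightarrow> x * y \<in> regular_on U"
    "x \<in> regular_on U \<Longrightarrow> y \<in> regular_on U \<Longrightarrow> x + y \<in> regular_on U"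
    "to_fract a \<in> regular_on U"
    "x \<in> regular_on U \<Longrightarrow> x ^ n \<in> regular_on U"
proof -
  note * = embedded_domain.regular_closed[OF embedded_class U, unfolded regular_eq_regular_on[OF U]]
  show mult: "x \<in> regular_on U \<Longrightarrow> y \<in> regular_on U \<Longrightarrow> x * y \<in> regular_on U" for x y by (rule *(1))
  show "x \<in> regular_on U \<Longrightarrow> y \<in> regular_on U \<Longrightarrow> x + y \<in> regular_on U" by (rule *(2))
  show const: "to_fract a \<in> regular_on U" for a
    using embedded_domain.emb_in_regular[OF embedded_class U, of a] regular_eq_regular_on[OF U]
    by (simp add: class_simps)
  show "x \<in> regular_on U \<Longrightarrow> x ^ n \<in> regular_on U"
    using mult const[of 1] by (induction n) auto
qed

lemma prime_set_contract_fract: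
  assumes q: "prime_in C q" and C: "range to_fract \<subseteq> C"
  shows "prime_set {a. to_fract a \<in> q}"
  using embedded_domain.prime_contract[OF embedded_class q] C
  by (simp add: primeideal_class_iff class_simps image_subset_iff)

lemma prime_inD:
  assumes "prime_in C q"
  shows "x \<in> q \<Longrightarrow> x \<in> C" "0 \<in> q" "1 \<notin> q" "x \<in> q \<Longrightarrow> y \<in> q \<Longrightarrow> x + y \<in> q"
    "x \<in> C \<Longrightarrow> y \<in> C \<Longrightarrow> x * y \<in> q \<longleftrightarrow> x \<in> q \<or> y \<in> q"
  using assms unfolding prime_in_def by auto

lemma prime_in_sum:
  assumes "prime_in C q" "\<And>i. i \<in> I \<Longrightarrow> f i \<in> q"
  shows "sum f I \<in> q"
  using assms(2) by (induction I rule: infinite_finite_induct) (auto intro: prime_inD(2,4)[OF assms(1)])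

section \<open>Pull back of divisors\<close>

text \<open>The embedding of the fraction field of \<open>A\<close> into that of
  \<open>A[T]\<close>, given by a definite description because it must not depend on the
  representing fraction.\<close>

definition const_fract :: "'a::idom fract \<Rightarrow> 'a poly fract" where
  "const_fract x = (THE y. \<exists>a b. b \<noteq> 0 \<and> x = to_fract a / to_fract b \<and> y = to_fract [:a:] / to_fract [:b:])"

lemma const_fract_divide:
  assumes b: "b \<noteq> 0"
  shows "const_fract (to_fract a / to_fract b) = to_fract [:a:] / to_fract [:b:]"
  unfolding const_fract_def
proof (rule the_equality)
  show "\<exists>a' b'. b' \<noteq> 0 \<and> to_fract a / to_fract b = to_fract a' / to_fract b' \<and>
      to_fract [:a:] / to_fract [:b:] = to_fract [:a':] / to_fract [:b':]"
    using b by blast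
  fix y assume "\<exists>a' b'. b' \<noteq> 0 \<and> to_fract a / to_fract b = to_fract a' / to_fract b' \<and>
      y = to_fract [:a':] / to_fract [:b':]"
  then obtain a' b' where y: "b' \<noteq> 0" "to_fract a / to_fract b = to_fract a' / to_fract b'"
      "y = to_fract [:a':] / to_fract [:b':]" by blast
  have "to_fract (a * b') = to_fract (a' * b)" using y(1,2) b by (simp add: field_simps)
  then have "a * b' = a' * b" by (simp only: to_fract_eq_iff)
  then have "[:a:] * [:b':] = [:a':] * [:b:]" by (simp add: mult.commute)
  then have "to_fract [:a:] * to_fract [:b':] = to_fract [:a':] * to_fract [:b:]" by (metis to_fract_mult)
  moreover have "to_fract [:b:] \<noteq> 0" "to_fract [:b':] \<noteq> 0" using b y(1) by simp_all
  ultimately show "y = to_fract [:a:] / to_fract [:b:]" unfolding y(3) by (simp add: frac_eq_eq)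
qed

lemma const_fract_simps [simp]:
  fixes a :: "'a::idom" and x y :: "'a fract"
  shows "const_fract (to_fract a) = to_fract [:a:]"
  "const_fract (0 :: 'a fract) = 0" "const_fract (1 :: 'a fract) = 1"
  "const_fract (x + y) = const_fract x + const_fract y"
  "const_fract (x * y) = const_fract x * const_fract y"
  "const_fract x = 0 \<longleftrightarrow> x = 0"
proof -
  show c: "const_fract (to_fract a) = to_fract [:a:]" for a :: 'a
    using const_fract_divide[of 1 a] by (simp flip: one_pCons)
  show "const_fract (0 :: 'a fract) = 0" "const_fract (1 :: 'a fract) = 1"
    using c[of 0] c[of 1] by (simp_all flip: one_pCons)
  obtain a b where x: "x = to_fract a / to_fract b" "b \<noteq> 0" by (rule fractE)
  obtain c d where y: "y = to_fract c / to_fract d" "d \<noteq> 0" by (rule fractE)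
  have bd: "b * d \<noteq> 0" using x y by simp
  have nz: "to_fract [:b:] \<noteq> 0" "to_fract [:d:] \<noteq> 0" using x y by simp_all
  have "x + y = to_fract (a * d + c * b) / to_fract (b * d)" using x y by (simp add: field_simps)
  then have "const_fract (x + y) = to_fract [:a * d + c * b:] / to_fract [:b * d:]"
    by (simp only: const_fract_divide[OF bd])
  also have "[:a * d + c * b:] = [:a:] * [:d:] + [:c:] * [:b:]" by (simp add: mult.commute)
  also have "[:b * d:] = [:b:] * [:d:]" by (simp add: mult.commute)
  finally show "const_fract (x + y) = const_fract x + const_fract y"
    unfolding x(1) y(1) const_fract_divide[OF x(2)] const_fract_divide[OF y(2)] to_fract_add to_fract_mult
    using nz by (simp add: add_divide_distrib)
  have "x * y = to_fract (a * c) / to_fract (b * d)" using x y by simp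
  then have "const_fract (x * y) = to_fract [:a * c:] / to_fract [:b * d:]"
    by (simp only: const_fract_divide[OF bd])
  also have "[:a * c:] = [:a:] * [:c:]" by (simp add: mult.commute)
  also have "[:b * d:] = [:b:] * [:d:]" by (simp add: mult.commute)
  finally show "const_fract (x * y) = const_fract x * const_fract y"
    unfolding x(1) y(1) const_fract_divide[OF x(2)] const_fract_divide[OF y(2)] to_fract_mult by simp
  show "const_fract x = 0 \<longleftrightarrow> x = 0"
    unfolding x(1) const_fract_divide[OF x(2)] using x(2) by simp
qed

lemma valuation_const_fract:
  assumes t: "uniformizer P t" and x: "x \<noteq> 0"
  shows "valuation_at (extend_prime P) (const_fract x) = valuation_at P x"
proof -
  obtain a b where ab: "x = to_fract a / to_fract b" "b \<noteq> 0" by (rule fractE)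
  have a: "a \<noteq> 0" using x ab by auto
  show ?thesis
    unfolding ab(1) const_fract_divide[OF ab(2)]
    using valuation_divide[OF uniformizer_extend[OF t], of "to_fract [:a:]" "to_fract [:b:]"]
      valuation_divide[OF t, of "to_fract a" "to_fract b"] valuation_extend_const[OF t] a ab(2) by simp
qed

lemma valuation_const_horizontal:
  assumes Q: "horizontal Q" and x: "x \<noteq> 0"
  shows "valuation_at Q (const_fract x) = 0"
proof -
  obtain p where p: "uniformizer Q p" using horizontal_uniformizer[OF Q] by metis
  have c: "valuation_at Q (to_fract [:a:]) = 0" if "a \<noteq> 0" for a
    using valuation_to_fract[OF p, of "[:a:]"] that Q by (force simp: horizontal_def)
  obtain a b where ab: "x = to_fract a / to_fract b" "b \<noteq> 0" by (rule fractE)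
  have a: "a \<noteq> 0" using x ab by auto
  show ?thesis unfolding ab(1) const_fract_divide[OF ab(2)]
    using valuation_divide[OF p, of "to_fract [:a:]" "to_fract [:b:]"] c[OF a] c[OF ab(2)] a ab(2) by simp
qed

lemma extend_prime_inj: "prime_set P \<Longrightarrow> prime_set P' \<Longrightarrow> extend_prime P = extend_prime P' \<Longrightarrow> P = P'"
  using contract_extend prime_setD(1) by metis

lemma pullback_extend: "height_one P \<Longrightarrow> pullback D (extend_prime P) = D P"
  using contract_extend[OF prime_setD(1)[OF height_one_prime]]
  by (auto simp: pullback_def prime_divisor_iff)

lemma pullback_horizontal:
  assumes "horizontal Q"
  shows "pullback D Q = 0"
proof -
  have "\<not> (\<exists>P. prime_divisor P \<and> Q = extend_prime P)"
  proof
    assume "\<exists>P. prime_divisor P \<and> Q = extend_prime P"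
    then obtain P where P: "height_one P" "Q = extend_prime P" by (auto simp: prime_divisor_iff)
    then obtain a where "a \<in> P" "a \<noteq> 0" using prime_setD(1) unfolding height_one_def by blast
    then show False using assms P const_mem_extend_prime[OF prime_setD(1)[OF height_one_prime[OF P(1)]]]
      by (auto simp: horizontal_def)
  qed
  then show ?thesis by (auto simp: pullback_def)
qed

context noetherian_normal
begin

sublocale base: krull_type "TYPE('a)"
  using height_one_uniformizer[OF noeth normal] finite_height_one_containing[OF noeth] by unfold_locales

sublocale line: krull_type "TYPE('a poly)"
  using poly_uniformizer finite_height_one_poly by unfold_locales

lemma pullback_not_height_one:
  assumes "\<not> height_one (Q :: 'a poly set)"
  shows "pullback D Q = 0"
  using assms height_one_extend by (auto simp: pullback_def prime_divisor_iff)

lemma weil_divisor_pullback: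
  fixes D :: "'a set \<Rightarrow> int"
  assumes D: "weil_divisor D"
  shows "weil_divisor (pullback D)"
  unfolding line.weil_divisor_iff
proof
  have "{Q. pullback D Q \<noteq> 0} \<subseteq> extend_prime ` {P. D P \<noteq> 0}"
  proof
    fix Q assume Q: "Q \<in> {Q. pullback D Q \<noteq> 0}"
    then obtain P where P: "height_one P" "Q = extend_prime P"
      by (auto simp: pullback_def prime_divisor_iff split: if_splits)
    then show "Q \<in> extend_prime ` {P. D P \<noteq> 0}" using Q pullback_extend[OF P(1), of D] by auto
  qed
  moreover have "finite {P. D P \<noteq> 0}" using D by (simp add: weil_divisor_def)
  ultimately show "finite {Q. pullback D Q \<noteq> 0}" by (meson finite_imageI finite_subset)
  show "\<forall>Q. pullback D Q \<noteq> 0 \<longrightarrow> height_one Q" using pullback_not_height_one by blast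
qed

text \<open>The valuations at \<open>P\<close> and at its extension agree on constants, and at
  horizontal primes nonzero constants are units; so pull back respects linear equivalence.\<close>

lemma pullback_add_principal:
  fixes D :: "'a set \<Rightarrow> int"
  assumes f: "f \<noteq> 0"
  shows "pullback (\<lambda>P. D P + principal_divisor f P) Q = pullback D Q + principal_divisor (const_fract f) Q"
proof (cases "height_one Q")
  case True
  then show ?thesis
  proof (cases rule: height_one_poly_cases)
    case horizontal
    then show ?thesis using True f
      by (simp add: pullback_horizontal valuation_const_horizontal line.principal_divisor_eq)
  next
    case (extend P)
    obtain t where "uniformizer P t" using base.ex_uniformizer[OF extend(1)] by blast
    then show ?thesis using extend True f
      by (simp add: pullback_extend valuation_const_fract line.principal_divisor_eq base.principal_divisor_eq)
  qed
qed (simp add: pullback_not_height_one line.principal_divisor_eq)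

text \<open>Equivalent divisors have equivalent pull backs, so the union over the class collapses to
  a single class.\<close>

lemma pullback_class_eq:
  fixes D :: "'a set \<Rightarrow> int"
  assumes D: "weil_divisor D"
  shows "pullback_class (linear_equivalence `` {D}) = linear_equivalence `` {pullback D}"
proof -
  have "(pullback D, pullback D') \<in> linear_equivalence" if "(D, D') \<in> linear_equivalence" for D'
  proof -
    obtain f where f: "f \<noteq> 0" "D' = (\<lambda>P. D P + principal_divisor f P)"
      using \<open>(D, D') \<in> linear_equivalence\<close> by (auto simp: base.linear_equivalence_iff)
    then show ?thesis unfolding line.linear_equivalence_iff
      using weil_divisor_pullback[OF D] pullback_add_principal[OF f(1), of D]
      by (intro conjI exI[of _ "const_fract f"]) auto
  qed
  then have eq: "linear_equivalence `` {pullback D'} = linear_equivalence `` {pullback D}"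
    if "(D, D') \<in> linear_equivalence" for D'
    using equiv_class_eq[OF line.equiv_linear_equivalence] that by metis
  have self: "(D, D) \<in> linear_equivalence"
    using equivE[OF base.equiv_linear_equivalence] D by (metis mem_Collect_eq refl_on_def)
  show ?thesis
  proof (intro subset_antisym subsetI)
    fix E assume "E \<in> pullback_class (linear_equivalence `` {D})"
    then obtain D' where "(D, D') \<in> linear_equivalence" "E \<in> linear_equivalence `` {pullback D'}"
      by (auto simp: pullback_class_def)
    then show "E \<in> linear_equivalence `` {pullback D}" using eq by metis
  next
    fix E assume "E \<in> linear_equivalence `` {pullback D}"
    then show "E \<in> pullback_class (linear_equivalence `` {D})"
      using self unfolding pullback_class_def by auto
  qed
qed

end

section \<open>Affine complements on the affine line\<close>

lemma affine_complement_iff: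
  fixes E :: "'a::idom set \<Rightarrow> int"
  assumes "weil_divisor E"
  shows "affine_scheme (open_subspace (Spec cring_class_ops) (spectrum cring_class_ops - supp E)) \<longleftrightarrow>
    (\<forall>q. prime_in (regular_on (spectrum cring_class_ops - supp E)) q \<longrightarrow>
      {a. to_fract a \<in> q} \<in> spectrum cring_class_ops - supp E)"
  by (rule affine_open_iff[OF openin_complement[OF assms] complement_nonempty[OF assms]])

context noetherian_normal
begin

lemma affine_complement_poly:
  fixes D :: "'a set \<Rightarrow> int" and g :: "'a poly"
  assumes D: "weil_divisor D" and g: "g \<noteq> 0"
    and E: "E = (\<lambda>Q. pullback D Q + principal_divisor (to_fract g) Q)" and eff: "effective E"
    and coaffine: "\<And>D'. (D, D') \<in> linear_equivalence \<Longrightarrow> effective D' \<Longrightarrow>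
      affine_scheme (open_subspace (Spec cring_class_ops) (spectrum cring_class_ops - supp D'))"
  shows "affine_scheme (open_subspace (Spec cring_class_ops) (spectrum cring_class_ops - supp E))"
proof -
  let ?U = "spectrum cring_class_ops - supp E"
  have g0: "to_fract g \<noteq> 0" using g by simp
  have weilE: "weil_divisor E"
    unfolding E by (rule line.weil_divisor_add_principal[OF weil_divisor_pullback[OF D] g0])
  note openU = openin_complement[OF weilE]
  note closed = regular_on_closed[OF openU]
  have E0: "0 \<le> E Q" for Q using eff by (simp add: effective_def)
  have E_horizontal: "E Q = valuation_at Q (to_fract g)" if "horizontal Q" for Q
    using horizontal_height_one[OF that] pullback_horizontal[OF that] by (simp add: E line.principal_divisor_eq)
  have E_extend: "E (extend_prime P) = D P + valuation_at (extend_prime P) (to_fract g)" if "height_one P" for P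
    using height_one_extend[OF that] pullback_extend[OF that] by (simp add: E line.principal_divisor_eq)
  \<comment> \<open>\<open>E\<close> vanishes at every height one prime inside a point of
    \<open>?U\<close>, so these are the only primes to be tested.\<close>
  have regularI: "f \<in> regular_on ?U"
    if f: "f \<noteq> 0" "\<And>Q. height_one Q \<Longrightarrow> E Q = 0 \<Longrightarrow> 0 \<le> valuation_at Q f" for f
    unfolding regular_on_def
  proof (intro CollectI ballI)
    fix P assume "P \<in> ?U"
    then have P: "prime_set P" "\<And>Q. Q \<subseteq> P \<Longrightarrow> E Q = 0" unfolding mem_complement_iff by auto
    show "f \<in> local_ring P" by (rule mem_local_ringI_valuation[OF P(1) f(1)]) (intro f(2) P(2))
  qed
  define Di where "Di i P = D P + principal_divisor (to_fract (poly.coeff g i)) P" for i and P :: "'a set"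
  have Di_val: "Di i P = D P + valuation_at P (to_fract (poly.coeff g i))" if "height_one P" for i P
    using that by (simp add: Di_def base.principal_divisor_eq)
  have weil_Di: "weil_divisor (Di i)" if "poly.coeff g i \<noteq> 0" for i
    unfolding Di_def using that by (intro base.weil_divisor_add_principal[OF D]) simp
  \<comment> \<open>The Gauss valuation of \<open>g\<close> is at most the value of any nonzero
    coefficient; effectivity of \<open>Di i\<close> is inherited from \<open>E\<close> this
    way.\<close>
  have E_le_Di: "E (extend_prime P) \<le> Di i P" if "height_one P" "poly.coeff g i \<noteq> 0" for i P
  proof -
    obtain t where "uniformizer P t" using base.ex_uniformizer \<open>height_one P\<close> by blast
    then show ?thesis using valuation_extend(1)[OF _ g that(2)] E_extend[OF that(1)] Di_val[OF that(1)] by simp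
  qed
  have eff_Di: "effective (Di i)" if "poly.coeff g i \<noteq> 0" for i
    unfolding effective_def
  proof
    fix P
    show "0 \<le> Di i P"
    proof (cases "height_one P")
      case True
      then show ?thesis using E_le_Di[OF True that] E0[of "extend_prime P"] by linarith
    next
      case False
      then have "Di i P = 0" using D by (auto simp: Di_def base.principal_divisor_eq base.weil_divisor_iff)
      then show ?thesis by simp
    qed
  qed
  let ?Ui = "\<lambda>i. spectrum cring_class_ops - supp (Di i)"
  have affine_Di: "{a. to_fract a \<in> q} \<in> ?Ui i"
    if "poly.coeff g i \<noteq> 0" "prime_in (regular_on (?Ui i)) q" for i q
  proof -
    have "(D, Di i) \<in> linear_equivalence"
      unfolding base.linear_equivalence_iff using D that(1)
      by (intro conjI exI[of _ "to_fract (poly.coeff g i)"]) (auto simp: Di_def)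
    then have "affine_scheme (open_subspace (Spec cring_class_ops) (?Ui i))"
      using coaffine eff_Di[OF that(1)] by blast
    then show ?thesis using affine_complement_iff[OF weil_Di[OF that(1)]] that(2) by blast
  qed
  define x where "x i = to_fract [:poly.coeff g i:] / to_fract g" for i
  \<comment> \<open>Where \<open>E\<close> vanishes, the order of \<open>g\<close> is minus the
    multiplicity of the pull back of \<open>D\<close>, so the order of \<open>x i\<close> is the
    multiplicity of the pull back of \<open>Di i\<close>.\<close>
  have x_val: "valuation_at Q (x i) = pullback (Di i) Q"
    if Q: "height_one Q" "E Q = 0" and i: "poly.coeff g i \<noteq> 0" for Q i
  proof -
    obtain t where t: "uniformizer Q t" using line.ex_uniformizer[OF Q(1)] by blast
    have v: "valuation_at Q (x i) = valuation_at Q (to_fract [:poly.coeff g i:]) - valuation_at Q (to_fract g)"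
      unfolding x_def using valuation_divide[OF t] g i by simp
    from Q(1) show ?thesis
    proof (cases rule: height_one_poly_cases)
      case horizontal
      then show ?thesis
        using v Q(2) E_horizontal[OF horizontal] pullback_horizontal[OF horizontal, of "Di i"]
          valuation_const_horizontal[OF horizontal, of "to_fract (poly.coeff g i)"] i by simp
    next
      case (extend P)
      obtain s where "uniformizer P s" using base.ex_uniformizer[OF extend(1)] by blast
      then show ?thesis
        using v Q(2) E_extend[OF extend(1)] pullback_extend[OF extend(1), of "Di i"] Di_val[OF extend(1), of i]
          valuation_extend_const[of P s "poly.coeff g i"] i extend(2) by simp
    qed
  qed
  have pull_nonneg: "0 \<le> pullback (Di i) Q" if "height_one Q" "poly.coeff g i \<noteq> 0" for i Q
    using eff_Di[OF that(2)] by (auto simp: pullback_def effective_def)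
  have x0: "x i \<noteq> 0" if "poly.coeff g i \<noteq> 0" for i using that g by (simp add: x_def)
  have x_reg: "x i \<in> regular_on ?U" for i
  proof (cases "poly.coeff g i = 0")
    case True
    then show ?thesis using closed(3)[of 0] by (simp add: x_def)
  next
    case False
    show ?thesis
      by (rule regularI) (use x0 x_val pull_nonneg False in auto)
  qed
  have x_sum: "(\<Sum>i\<le>Polynomial.degree g. to_fract (monom 1 i) * x i) = 1"
  proof -
    have "(\<Sum>i\<le>Polynomial.degree g. monom 1 i * [:poly.coeff g i:]) = g"
      using poly_as_sum_of_monoms[of g] by (simp add: smult_monom)
    then have "(\<Sum>i\<le>Polynomial.degree g. to_fract (monom 1 i) * to_fract [:poly.coeff g i:]) = to_fract g"
      by (metis (no_types, lifting) sum.cong to_fract_mult to_fract_sum)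
    then show ?thesis using g by (simp add: x_def sum_divide_distrib[symmetric])
  qed
  have main: "{a. to_fract a \<in> q} \<in> ?U" if q: "prime_in (regular_on ?U) q" for q
  proof -
    note q' = prime_inD[OF q]
    define P where "P = {a. to_fract a \<in> q}"
    have P: "prime_set P" unfolding P_def using closed(3) by (intro prime_set_contract_fract[OF q]) auto
    obtain i where xi: "x i \<notin> q"
    proof -
      have "\<exists>i. x i \<notin> q"
      proof (rule ccontr)
        assume "\<nexists>i. x i \<notin> q"
        then have "(\<Sum>i\<le>Polynomial.degree g. to_fract (monom 1 i) * x i) \<in> q"
          using x_reg closed(3) by (intro prime_in_sum[OF q]) (simp add: q'(5))
        then show False using x_sum q'(3) by simp
      qed
      then show thesis using that by blast
    qed
    have gi: "poly.coeff g i \<noteq> 0" using xi q'(2) by (auto simp: x_def)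
    note closed_i = regular_on_closed[OF openin_complement[OF weil_Di[OF gi]]]
    have xn: "x i ^ n \<in> regular_on ?U" "x i ^ n \<notin> q" for n
    proof -
      show *: "x i ^ n \<in> regular_on ?U" for n using closed(4)[OF x_reg] .
      show "x i ^ n \<notin> q"
        using xi q'(3) by (induction n) (simp_all add: q'(5)[OF x_reg *])
    qed
    \<comment> \<open>Along components of the pull back of \<open>Di i\<close> the power of
      \<open>x i\<close> vanishes to order at least \<open>n\<close>; at the other height one primes
      outside \<open>E\<close>, \<open>const_fract h\<close> has no pole.\<close>
    have clear: "\<exists>n. const_fract h * x i ^ n \<in> regular_on ?U" if h: "h \<in> regular_on (?Ui i)" for h
    proof (cases "h = 0")
      case True
      then show ?thesis using closed(3)[of 0] by simp
    next
      case h0: False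
      define bad where "bad = {P. principal_divisor h P \<noteq> 0}"
      have fin: "finite bad" unfolding bad_def by (rule base.finite_principal_divisor[OF h0])
      \<comment> \<open>A bound for all pole orders of \<open>h\<close>; a sum avoids the maximum of
        a possibly empty set.\<close>
      define n where "n = (\<Sum>P\<in>bad. nat \<bar>principal_divisor h P\<bar>)"
      have n: "- valuation_at P h \<le> int n" if "height_one P" for P
      proof (cases "P \<in> bad")
        case True
        then have "nat \<bar>principal_divisor h P\<bar> \<le> n" unfolding n_def using fin by (intro member_le_sum) auto
        then show ?thesis using that by (simp add: base.principal_divisor_eq)
      next
        case False
        then show ?thesis using that by (simp add: bad_def base.principal_divisor_eq)
      qed
      have "const_fract h * x i ^ n \<in> regular_on ?U"
      proof (rule regularI)
        show "const_fract h * x i ^ n \<noteq> 0" using h0 x0[OF gi] by simp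
        fix Q assume Q: "height_one Q" "E Q = 0"
        obtain t where t: "uniformizer Q t" using line.ex_uniformizer[OF Q(1)] by blast
        have v: "valuation_at Q (const_fract h * x i ^ n) = valuation_at Q (const_fract h) + int n * pullback (Di i) Q"
          using valuation_mult[OF t] valuation_power[OF t] x0[OF gi] h0 x_val[OF Q gi] by simp
        from Q(1) show "0 \<le> valuation_at Q (const_fract h * x i ^ n)"
        proof (cases rule: height_one_poly_cases)
          case horizontal
          then show ?thesis
            using v valuation_const_horizontal[OF horizontal h0] pullback_horizontal[OF horizontal, of "Di i"] by simp
        next
          case (extend P)
          obtain s where s: "uniformizer P s" using base.ex_uniformizer[OF extend(1)] by blast
          have v': "valuation_at Q (const_fract h * x i ^ n) = valuation_at P h + int n * Di i P"
            using v valuation_const_fract[OF s h0] pullback_extend[OF extend(1), of "Di i"] extend(2) by simp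
          show ?thesis
          proof (cases "Di i P = 0")
            case True
            have "P \<in> ?Ui i"
              unfolding mem_complement_iff
            proof (intro conjI allI impI height_one_prime[OF extend(1)])
              fix P' assume "P' \<subseteq> P"
              show "Di i P' = 0"
              proof (rule ccontr)
                assume *: "Di i P' \<noteq> 0"
                then have "height_one P'" using weil_Di[OF gi] by (simp add: base.weil_divisor_iff)
                then have "P' = P" using height_one_subset_eq[OF extend(1)] \<open>P' \<subseteq> P\<close> by simp
                then show False using * True by simp
              qed
            qed
            then have "h \<in> local_ring P" using h by (simp add: regular_on_def)
            then have "0 \<le> valuation_at P h" using mem_local_ring_iff_valuation[OF s h0] by simp
            then show ?thesis using v' True by simp
          next
            case False
            then have "1 \<le> Di i P" using eff_Di[OF gi] by (simp add: effective_def order.not_eq_order_implies_strict int_one_le_iff_zero_less)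
            then have "int n * 1 \<le> int n * Di i P" by (intro mult_left_mono) auto
            then show ?thesis using v' n[OF extend(1)] by linarith
          qed
        qed
      qed
      then show ?thesis by blast
    qed
    \<comment> \<open>the contraction to \<open>regular_on (?Ui i)\<close> of the extension of \<open>q\<close> to the localization at \<open>x i\<close>\<close>
    define qi where "qi = {h \<in> regular_on (?Ui i). \<exists>n. const_fract h * x i ^ n \<in> q}"
    have "prime_in (regular_on (?Ui i)) qi"
      unfolding prime_in_def
    proof (intro conjI ballI)
      show "qi \<subseteq> regular_on (?Ui i)" by (auto simp: qi_def)
      show "0 \<in> qi" using closed_i(3)[of 0] q'(2) by (simp add: qi_def)
      show "1 \<notin> qi" using xn(2) by (simp add: qi_def)
      show "h + h' \<in> qi" if hh: "h \<in> qi" "h' \<in> qi" for h h'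
      proof -
        obtain n m where n: "const_fract h * x i ^ n \<in> q" "const_fract h' * x i ^ m \<in> q"
          using hh by (auto simp: qi_def)
        have "const_fract (h + h') * x i ^ (n + m)
            = const_fract h * x i ^ n * x i ^ m + const_fract h' * x i ^ m * x i ^ n"
          by (simp add: algebra_simps power_add)
        moreover have "const_fract h * x i ^ n * x i ^ m \<in> q" "const_fract h' * x i ^ m * x i ^ n \<in> q"
          using n q'(1) xn(1) by (simp_all add: q'(5))
        ultimately have "const_fract (h + h') * x i ^ (n + m) \<in> q" using q'(4) by simp
        then show ?thesis using hh closed_i(2) unfolding qi_def by blast
      qed
      fix h h' assume hh: "h \<in> regular_on (?Ui i)" "h' \<in> regular_on (?Ui i)"
      \<comment> \<open>Powers of \<open>x i\<close> turn both factors into elements of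
        \<open>regular_on ?U\<close>, where primality of \<open>q\<close> is available.\<close>
      obtain n m where n: "const_fract h * x i ^ n \<in> regular_on ?U" "const_fract h' * x i ^ m \<in> regular_on ?U"
        using clear hh by blast
      show "h * h' \<in> qi \<longleftrightarrow> h \<in> qi \<or> h' \<in> qi"
      proof
        assume "h * h' \<in> qi"
        then obtain k where k: "const_fract (h * h') * x i ^ k \<in> q" by (auto simp: qi_def)
        have "(const_fract (h * h') * x i ^ k) * x i ^ (n + m) \<in> q"
          using k q'(1) xn(1) by (simp add: q'(5))
        moreover have "(const_fract (h * h') * x i ^ k) * x i ^ (n + m)
            = (const_fract h * x i ^ n) * (const_fract h' * x i ^ m) * x i ^ k"
          by (simp add: power_add mult_ac)
        ultimately have "(const_fract h * x i ^ n) * (const_fract h' * x i ^ m) * x i ^ k \<in> q" by metis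
        then have "const_fract h * x i ^ n \<in> q \<or> const_fract h' * x i ^ m \<in> q"
          using n xn closed(1) by (simp add: q'(5))
        then show "h \<in> qi \<or> h' \<in> qi" using hh by (auto simp: qi_def)
      next
        have *: "h * h' \<in> qi" if h: "h \<in> qi" "h' \<in> regular_on (?Ui i)" "const_fract h' * x i ^ m \<in> regular_on ?U" for h h' m
        proof -
          obtain k where k: "const_fract h * x i ^ k \<in> q" using h(1) by (auto simp: qi_def)
          have "(const_fract h * x i ^ k) * (const_fract h' * x i ^ m) \<in> q"
            using k h(3) q'(1) by (simp add: q'(5))
          moreover have "(const_fract h * x i ^ k) * (const_fract h' * x i ^ m) = const_fract (h * h') * x i ^ (k + m)"
            by (simp add: power_add mult_ac)
          ultimately show ?thesis using h closed_i(1) unfolding qi_def by auto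
        qed
        assume "h \<in> qi \<or> h' \<in> qi"
        then show "h * h' \<in> qi" using *[OF _ hh(2) n(2)] *[OF _ hh(1) n(1)] by (metis mult.commute)
      qed
    qed
    then have p: "{a. to_fract a \<in> qi} \<in> ?Ui i" by (rule affine_Di[OF gi])
    \<comment> \<open>As no power of \<open>x i\<close> lies in \<open>q\<close>, constants belong
      to \<open>qi\<close> exactly when they belong to \<open>q\<close>.\<close>
    have "to_fract a \<in> qi \<longleftrightarrow> [:a:] \<in> P" for a
      using closed_i(3)[of a] xn closed(3)[of "[:a:]"] by (simp add: qi_def P_def q'(5))
    then have p': "{a. [:a:] \<in> P} \<in> ?Ui i" using p by simp
    \<comment> \<open>The contraction of \<open>P\<close> to \<open>A\<close> avoids the support of
      \<open>Di i\<close>, so no component of the pull back passes through \<open>P\<close>.\<close>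
    have Di_zero: "Di i P' = 0" if "height_one P'" "extend_prime P' \<subseteq> P" for P'
    proof -
      have "P' \<subseteq> {a. [:a:] \<in> P}"
        using that const_mem_extend_prime[OF prime_setD(1)[OF height_one_prime[OF that(1)]]] by auto
      then show ?thesis using p' unfolding mem_complement_iff by blast
    qed
    have "E Q = 0" if QP: "Q \<subseteq> P" for Q
    proof (rule ccontr)
      assume nz: "E Q \<noteq> 0"
      then have Q: "height_one Q" using weilE by (simp add: line.weil_divisor_iff)
      have pos: "0 < E Q" using nz E0[of Q] by simp
      from Q show False
      proof (cases rule: height_one_poly_cases)
        case (extend P')
        then show False using E_le_Di[OF extend(1) gi] Di_zero[OF extend(1)] QP pos by simp
      next
        case horizontal
        define y where "y = to_fract g / to_fract [:poly.coeff g i:]"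
        have y0: "y \<noteq> 0" using g gi by (simp add: y_def)
        have y_val: "valuation_at Q' y = valuation_at Q' (to_fract g) - valuation_at Q' (to_fract [:poly.coeff g i:])"
          if Q': "height_one Q'" for Q'
        proof -
          obtain t where t: "uniformizer Q' t" using line.ex_uniformizer[OF Q'] by blast
          show ?thesis unfolding y_def using valuation_divide[OF t] g gi by simp
        qed
        have y_hor: "valuation_at Q' y = E Q'" if "horizontal Q'" for Q'
          using y_val[OF horizontal_height_one[OF that]] E_horizontal[OF that]
            valuation_const_horizontal[OF that, of "to_fract (poly.coeff g i)"] gi by simp
        \<comment> \<open>At horizontal primes, and at extended primes inside \<open>P\<close>,
          where \<open>Di i\<close> vanishes, the order of \<open>y\<close> is the multiplicity of
          \<open>E\<close>, which is nonnegative.\<close>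
        have "y \<in> local_ring P"
        proof (rule mem_local_ringI_valuation[OF P y0])
          fix Q' assume Q': "height_one Q'" "Q' \<subseteq> P"
          from Q'(1) show "0 \<le> valuation_at Q' y"
          proof (cases rule: height_one_poly_cases)
            case horizontal
            then show ?thesis using y_hor E0[of Q'] by simp
          next
            case (extend P')
            obtain s where s: "uniformizer P' s" using base.ex_uniformizer[OF extend(1)] by blast
            have "D P' + valuation_at P' (to_fract (poly.coeff g i)) = 0"
              using Di_zero[OF extend(1)] Di_val[OF extend(1), of i] Q'(2) extend(2) by simp
            then show ?thesis
              using y_val[OF Q'(1)] E_extend[OF extend(1)] E0[of Q'] valuation_extend_const[OF s gi] extend(2) by simp
          qed
        qed
        then obtain c d where d: "d \<notin> P" "y = to_fract c / to_fract d" by (auto simp: mem_local_ring_iff)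
        have d0: "d \<noteq> 0" using d prime_setD(1)[OF P] by auto
        have c0: "c \<noteq> 0" using y0 d by auto
        obtain t where t: "uniformizer Q t" using line.ex_uniformizer[OF Q] by blast
        \<comment> \<open>\<open>y\<close> vanishes along \<open>Q\<close>, so its numerator
          \<open>c\<close> lies in \<open>Q\<close>, hence in \<open>P\<close>; multiplication by
          \<open>x i = 1 / y\<close> turns \<open>c\<close> into the denominator \<open>d\<close>,
          which would then lie in \<open>P\<close>.\<close>
        have "valuation_at Q y = valuation_at Q (to_fract c) - valuation_at Q (to_fract d)"
          unfolding d(2) using valuation_divide[OF t] c0 d0 by simp
        then have "0 < valuation_at Q (to_fract c)"
          using y_hor[OF horizontal] pos valuation_to_fract(1)[OF t d0] by linarith
        then have "c \<in> P" using valuation_to_fract(2)[OF t c0] QP by auto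
        then have "to_fract c \<in> q" by (simp add: P_def)
        then have "x i * to_fract c \<in> q" using x_reg closed(3) by (simp add: q'(5))
        moreover have "x i * y = 1" using g gi by (simp add: x_def y_def)
        then have "x i * to_fract c = to_fract d" using d(2) d0 by (simp add: field_simps)
        ultimately show False using d(1) by (simp add: P_def)
      qed
    qed
    then show ?thesis unfolding mem_complement_iff using P by (simp add: P_def)
  qed
  then show ?thesis using affine_complement_iff[OF weilE] by blast
qed

text \<open>Effectivity of \<open>E\<close> leaves \<open>f\<close> without poles at horizontal
  primes, where the pull back has multiplicity zero; so \<open>f = g / a\<close> with a constant
  \<open>a\<close>, and the factor \<open>1 / a\<close> is absorbed into \<open>D\<close>.\<close>

theorem coaffine_class_pullback:
  fixes C :: "('a set \<Rightarrow> int) set"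
  assumes C: "coaffine_class C"
  shows "coaffine_class (pullback_class C)"
  unfolding coaffine_class_def
proof (intro conjI ballI impI)
  obtain D where D: "weil_divisor D" "C = linear_equivalence `` {D}"
    using C base.divisor_classes_iff by (auto simp: coaffine_class_def)
  have pc: "pullback_class C = linear_equivalence `` {pullback D}" using pullback_class_eq[OF D(1)] D(2) by simp
  show "pullback_class C \<in> divisor_classes"
    unfolding pc line.divisor_classes_iff using weil_divisor_pullback[OF D(1)] by blast
  fix E assume E: "E \<in> pullback_class C" "effective E"
  then obtain f where f: "f \<noteq> 0" "E = (\<lambda>Q. pullback D Q + principal_divisor f Q)"
    by (auto simp: pc line.linear_equivalence_iff)
  have "f \<in> local_ring Q" if Q: "horizontal Q" for Q
  proof -
    obtain t where t: "uniformizer Q t" using line.ex_uniformizer[OF horizontal_height_one[OF Q]] by blast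
    have "0 \<le> E Q" using E(2) by (simp add: effective_def)
    then have "0 \<le> valuation_at Q f"
      using horizontal_height_one[OF Q] pullback_horizontal[OF Q, of D] by (simp add: f(2) line.principal_divisor_eq)
    then show ?thesis using mem_local_ring_iff_valuation[OF t f(1)] by simp
  qed
  then obtain g a where g: "a \<noteq> 0" "f = to_fract g / to_fract [:a:]" using Inter_horizontal by blast
  have g0: "g \<noteq> 0" using f(1) g by auto
  let ?h = "inverse (to_fract a)"
  define D' where "D' = (\<lambda>P. D P + principal_divisor ?h P)"
  have h0: "?h \<noteq> 0" using g(1) by simp
  have DD': "(D, D') \<in> linear_equivalence"
    unfolding base.linear_equivalence_iff using D(1) h0 by (auto simp: D'_def intro!: exI[of _ ?h])
  have weil_D': "weil_divisor D'" unfolding D'_def by (rule base.weil_divisor_add_principal[OF D(1) h0])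
  have "const_fract ?h * to_fract [:a:] = 1"
    using const_fract_simps(5)[of ?h "to_fract a"] g(1) by simp
  then have f_eq: "f = const_fract ?h * to_fract g"
    unfolding g(2) using g(1) by (simp add: field_simps)
  have "E = (\<lambda>Q. pullback D' Q + principal_divisor (to_fract g) Q)"
    unfolding f(2) D'_def f_eq using pullback_add_principal[OF h0, of D]
      line.principal_divisor_mult[of "const_fract ?h" "to_fract g"] h0 g0 by auto
  moreover have "affine_scheme (open_subspace (Spec cring_class_ops) (spectrum cring_class_ops - supp D''))"
    if "(D', D'') \<in> linear_equivalence" "effective D''" for D''
  proof -
    have "D'' \<in> C" using DD' that(1) equivE[OF base.equiv_linear_equivalence] unfolding D(2)
      by (metis Image_singleton_iff transE)
    then show ?thesis using C that(2) by (simp add: coaffine_class_def)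
  qed
  ultimately show "affine_scheme (open_subspace (Spec cring_class_ops) (spectrum cring_class_ops - supp E))"
    using affine_complement_poly[OF weil_D' g0 _ E(2)] by blast
qed

end

section \<open>Hypersurfaces\<close>

text \<open>Distinct height one primes are never nested, so each \<open>V(P)\<close> making up the
  support is maximal among the irreducible closed subsets, and every such subset lies in one of
  them.\<close>

lemma irreducible_component_supp_iff:
  fixes D :: "'a::idom set \<Rightarrow> int"
  assumes D: "weil_divisor D" and P: "prime_set P"
  shows "irreducible_component (zariski cring_class_ops) (supp D) (zero_locus cring_class_ops P) \<longleftrightarrow> D P \<noteq> 0"
proof
  have ht: "height_one Q" if "D Q \<noteq> 0" for Q using D that by (simp add: weil_divisor_def prime_divisor_iff)
  have sub: "zero_locus cring_class_ops Q \<subseteq> supp D" if "D Q \<noteq> 0" for Q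
    using that by (auto simp: supp_def)
  {
    assume comp: "irreducible_component (zariski cring_class_ops) (supp D) (zero_locus cring_class_ops P)"
    then have "P \<in> supp D" using P by (auto simp: irreducible_component_def mem_zero_locus_iff)
    then obtain Q where Q: "D Q \<noteq> 0" "Q \<subseteq> P" by (auto simp: mem_supp_iff)
    have "zero_locus cring_class_ops P \<subseteq> zero_locus cring_class_ops Q"
      using zero_locus_subset_iff[OF P] Q(2) by blast
    then have "zero_locus cring_class_ops Q = zero_locus cring_class_ops P"
      using comp sub[OF Q(1)] irreducible_zero_locus[OF height_one_prime[OF ht[OF Q(1)]]]
      unfolding irreducible_component_def by blast
    then show "D P \<noteq> 0" using zero_locus_eq_iff[OF height_one_prime[OF ht[OF Q(1)]] P] Q(1) by simp
  }
  assume DP: "D P \<noteq> 0"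
  show "irreducible_component (zariski cring_class_ops) (supp D) (zero_locus cring_class_ops P)"
    unfolding irreducible_component_def
  proof (intro conjI allI impI irreducible_zero_locus[OF P] sub[OF DP])
    fix Z assume Z: "irreducible_closedin (zariski cring_class_ops) Z \<and> zero_locus cring_class_ops P \<subseteq> Z \<and> Z \<subseteq> supp D"
    then obtain Q where Q: "prime_set Q" "Z = zero_locus cring_class_ops Q"
      using irreducible_closedinE by metis
    then have "Q \<in> supp D" using Z by (auto simp: mem_zero_locus_iff)
    then obtain Q' where Q': "D Q' \<noteq> 0" "Q' \<subseteq> Q" by (auto simp: mem_supp_iff)
    have "Q \<subseteq> P" using Z Q zero_locus_subset_iff[OF P] by metis
    then have "Q' = P" using height_one_subset_eq[OF ht[OF DP] ht[OF Q'(1)]] Q'(2) by simp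
    then show "Z = zero_locus cring_class_ops P" using Q Q'(2) \<open>Q \<subseteq> P\<close> by simp
  qed
qed

lemma reduced_divisor_supp:
  assumes D: "weil_divisor D"
  shows "reduced_divisor (supp D) P = (if D P \<noteq> 0 then 1 else 0)"
proof (cases "prime_set P")
  case True
  then show ?thesis
    using irreducible_component_supp_iff[OF D True] by (simp add: reduced_divisor_def spectrum_class_iff)
next
  case False
  then have "D P = 0" using D by (auto simp: weil_divisor_def prime_divisor_iff height_one_def)
  then show ?thesis using False by (simp add: reduced_divisor_def spectrum_class_iff)
qed

lemma hypersurface_supp:
  fixes D :: "'a::idom set \<Rightarrow> int"
  assumes D: "weil_divisor D"
  shows "hypersurface (zariski cring_class_ops) (supp D)"
  unfolding hypersurface_def
proof (intro conjI allI impI closedin_supp[OF D])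
  fix Y assume Y: "irreducible_component (zariski cring_class_ops) (supp D) Y"
  then obtain P where P: "prime_set P" "Y = zero_locus cring_class_ops P"
    unfolding irreducible_component_def using irreducible_closedinE by metis
  then have "D P \<noteq> 0" using Y irreducible_component_supp_iff[OF D P(1)] by simp
  then have "height_one P" using D by (simp add: weil_divisor_def prime_divisor_iff)
  then show "codim_one (zariski cring_class_ops) Y" using codim_one_zero_locus_iff[OF P(1)] P(2) by simp
qed

text \<open>If only zero vanished on \<open>H\<close>, the whole space would be a component of
  \<open>H\<close>, of codimension zero. So some nonzero \<open>s\<close> vanishes on
  \<open>H\<close>, and every component is the closure of a height one prime containing
  \<open>s\<close>.\<close>

lemma (in krull_type) weil_divisor_reduced:
  fixes H :: "'b set set"
  assumes H: "hypersurface (zariski cring_class_ops) H"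
  shows "weil_divisor (reduced_divisor H)"
proof -
  have comp: "irreducible_component (zariski cring_class_ops) H (zero_locus cring_class_ops P)" "prime_set P"
    if "reduced_divisor H P \<noteq> 0" for P
    using that by (auto simp: reduced_divisor_def spectrum_class_iff split: if_splits)
  have ht: "height_one P" if "reduced_divisor H P \<noteq> 0" for P
    using comp[OF that] H codim_one_zero_locus_iff[of P] unfolding hypersurface_def by blast
  obtain S where S: "H = zero_locus cring_class_ops S"
    using H unfolding hypersurface_def closedin_zariski_class by blast
  obtain s where s: "s \<in> S" "s \<noteq> 0"
  proof -
    have "\<exists>s\<in>S. s \<noteq> 0"
    proof (rule ccontr)
      assume "\<not> ?thesis"
      then have "S \<subseteq> {0}" by auto
      then have "S \<subseteq> P \<longleftrightarrow> {0} \<subseteq> P" if "prime_set P" for P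
        using prime_setD(1)[OF that] by auto
      then have H0: "H = zero_locus cring_class_ops {0}"
        unfolding S by (auto simp: mem_zero_locus_iff)
      have "irreducible_component (zariski cring_class_ops) H (zero_locus cring_class_ops {0})"
        unfolding irreducible_component_def H0 using irreducible_zero_locus[OF prime_set_zero] by blast
      then have "height_one {0 :: 'b}"
        using H codim_one_zero_locus_iff[OF prime_set_zero] unfolding hypersurface_def by blast
      then show False by (simp add: height_one_def)
    qed
    then show thesis using that by blast
  qed
  have "{P. reduced_divisor H P \<noteq> 0} \<subseteq> {P. height_one P \<and> s \<in> P}"
  proof
    fix P assume "P \<in> {P. reduced_divisor H P \<noteq> 0}"
    then have P: "reduced_divisor H P \<noteq> 0" by simp
    have "P \<in> H" using comp[OF P] by (auto simp: irreducible_component_def mem_zero_locus_iff)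
    then show "P \<in> {P. height_one P \<and> s \<in> P}" using ht[OF P] s(1) by (auto simp: S mem_zero_locus_iff)
  qed
  then have "finite {P. reduced_divisor H P \<noteq> 0}" using finite_containing[OF s(2)] by (rule finite_subset)
  then show ?thesis using ht by (simp add: weil_divisor_iff)
qed

section \<open>Hypersurfaces of the affine line\<close>

context noetherian_normal
begin

text \<open>The generator \<open>p Q\<close> has order one at \<open>Q\<close> and zero at all other
  horizontal primes, so a product of powers of generators removes the horizontal part of
  \<open>E\<close>; what remains is supported on extended primes.\<close>

lemma linear_equivalent_pullback:
  fixes E :: "'a poly set \<Rightarrow> int"
  assumes E: "weil_divisor E"
  shows "\<exists>D :: 'a set \<Rightarrow> int. weil_divisor D \<and> (E, pullback D) \<in> linear_equivalence"
proof -
  have "\<exists>p. uniformizer Q p \<and> (\<forall>u\<in>Q. \<exists>a q. a \<noteq> 0 \<and> smult a u = p * q)" if "horizontal Q" for Q :: "'a poly set"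
    using horizontal_uniformizer[OF that] by metis
  then obtain p where p: "\<And>Q :: 'a poly set. horizontal Q \<Longrightarrow> uniformizer Q (p Q)"
    "\<And>(Q :: 'a poly set) u. horizontal Q \<Longrightarrow> u \<in> Q \<Longrightarrow> \<exists>a q. a \<noteq> 0 \<and> smult a u = p Q * q" by metis
  have p_val: "valuation_at Q' (to_fract (p Q)) = (if Q = Q' then 1 else 0)"
    if Q: "horizontal Q" "horizontal Q'" for Q Q'
  proof (cases "Q = Q'")
    case True
    have "to_fract 1 / to_fract 1 \<in> local_units Q"
      using prime_setD(2)[OF uniformizerD(1)[OF p(1)[OF Q(1)]]] by (rule local_unitsI) (use prime_setD(2)[OF uniformizerD(1)[OF p(1)[OF Q(1)]]] in auto)
    from valuation_at_eq[OF p(1)[OF Q(1)] this, of 1] show ?thesis using True by simp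
  next
    case False
    then have "p Q \<notin> Q'" using horizontal_eqI[OF Q _ p(2)[OF Q(1)]] by blast
    then show ?thesis
      using False valuation_to_fract[OF p(1)[OF Q(2)] uniformizerD(3)[OF p(1)[OF Q(1)]]] by simp
  qed
  define B where "B = {Q. E Q \<noteq> 0 \<and> horizontal Q}"
  have fin: "finite B" using E unfolding B_def line.weil_divisor_iff by (auto elim: finite_subset[rotated])
  define f where "f = (\<Prod>Q\<in>B. to_fract (p Q) powi (- E Q))"
  have p0: "to_fract (p Q) \<noteq> 0" if "Q \<in> B" for Q using that uniformizerD(3)[OF p(1)] by (auto simp: B_def)
  have f0: "f \<noteq> 0" unfolding f_def using fin p0 by (simp add: power_int_eq_0_iff)
  have f_val: "valuation_at Q f = - E Q" if Q: "horizontal Q" for Q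
  proof -
    have "valuation_at Q f = (\<Sum>Q'\<in>B. valuation_at Q (to_fract (p Q') powi (- E Q')))"
      unfolding f_def using p0 by (intro valuation_prod[OF p(1)[OF Q] fin]) (auto simp: power_int_eq_0_iff)
    also have "\<dots> = (\<Sum>Q'\<in>B. if Q' = Q then - E Q else 0)"
    proof (rule sum.cong[OF refl])
      fix Q' assume Q': "Q' \<in> B"
      then have "horizontal Q'" by (simp add: B_def)
      then show "valuation_at Q (to_fract (p Q') powi (- E Q')) = (if Q' = Q then - E Q else 0)"
        using valuation_powi[OF p(1)[OF Q] p0[OF Q']] p_val[OF _ Q] by simp
    qed
    also have "\<dots> = - E Q" using fin Q by (auto simp: B_def)
    finally show ?thesis .
  qed
  define E' where "E' = (\<lambda>Q. E Q + principal_divisor f Q)"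
  have weil_E': "weil_divisor E'" unfolding E'_def by (rule line.weil_divisor_add_principal[OF E f0])
  have E'_hor: "E' Q = 0" if "horizontal Q" for Q
    using f_val[OF that] horizontal_height_one[OF that] by (simp add: E'_def line.principal_divisor_eq)
  define D where "D P = (if height_one P then E' (extend_prime P) else 0)" for P :: "'a set"
  have "finite {P. D P \<noteq> 0}"
  proof (rule inj_on_finite)
    show "inj_on extend_prime {P. D P \<noteq> 0}"
      using extend_prime_inj height_one_prime by (auto simp: inj_on_def D_def split: if_splits)
    show "extend_prime ` {P. D P \<noteq> 0} \<subseteq> {Q. E' Q \<noteq> 0}" by (auto simp: D_def split: if_splits)
    show "finite {Q. E' Q \<noteq> 0}" using weil_E' by (simp add: weil_divisor_def)
  qed
  then have weil_D: "weil_divisor D" unfolding base.weil_divisor_iff by (auto simp: D_def)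
  have "pullback D Q = E' Q" for Q
  proof (cases "height_one Q")
    case True
    then show ?thesis
    proof (cases rule: height_one_poly_cases)
      case horizontal
      then show ?thesis by (simp add: E'_hor pullback_horizontal)
    next
      case (extend P)
      then show ?thesis by (simp add: pullback_extend D_def)
    qed
  next
    case False
    then have "E' Q = 0" using weil_E' by (auto simp: line.weil_divisor_iff)
    then show ?thesis using pullback_not_height_one[OF False] by simp
  qed
  then have "pullback D = E'" by auto
  then have "(E, pullback D) \<in> linear_equivalence"
    unfolding line.linear_equivalence_iff E'_def using E f0 by blast
  then show ?thesis using weil_D by blast
qed

lemma coaffine_class_of_hypersurfaces:
  fixes D :: "'a set \<Rightarrow> int"
  assumes hyp: "\<And>H :: 'a set set. hypersurface (zariski cring_class_ops) H \<Longrightarrow> coaffine_divisor (reduced_divisor H)"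
    and D: "weil_divisor D"
  shows "coaffine_class (linear_equivalence `` {D})"
  unfolding coaffine_class_def
proof (intro conjI ballI impI)
  show "linear_equivalence `` {D} \<in> divisor_classes" unfolding base.divisor_classes_iff using D by blast
  fix D' assume "D' \<in> linear_equivalence `` {D}"
  then have D': "weil_divisor D'" by (auto simp: linear_equivalence_def)
  let ?R = "reduced_divisor (supp D')"
  have "coaffine_divisor ?R" by (rule hyp[OF hypersurface_supp[OF D']])
  then have R: "weil_divisor ?R" "coaffine_class (linear_equivalence `` {?R})" by (simp_all add: coaffine_divisor_def)
  have "?R \<in> linear_equivalence `` {?R}"
    using R(1) by (auto simp: base.linear_equivalence_iff base.principal_divisor_one intro!: exI[of _ 1])
  moreover have "effective ?R" by (simp add: effective_def reduced_divisor_def)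
  ultimately have "affine_scheme (open_subspace (Spec cring_class_ops) (spectrum cring_class_ops - supp ?R))"
    using R(2) unfolding coaffine_class_def by blast
  moreover have "supp ?R = supp D'"
  proof -
    have "supp ?R = (\<Union>P\<in>{P. ?R P \<noteq> 0}. zero_locus cring_class_ops P)" by (rule supp_def)
    also have "{P. ?R P \<noteq> 0} = {P. D' P \<noteq> 0}" by (simp add: reduced_divisor_supp[OF D'])
    also have "(\<Union>P\<in>{P. D' P \<noteq> 0}. zero_locus cring_class_ops P) = supp D'"
      by (rule supp_def[symmetric])
    finally show ?thesis .
  qed
  ultimately show "affine_scheme (open_subspace (Spec cring_class_ops) (spectrum cring_class_ops - supp D'))" by simp
qed

text \<open>The class of \<open>reduced_divisor H\<close> is itself a pull back class, so
  \<open>coaffine_class_pullback\<close> applies to it.\<close>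

theorem coaffine_hypersurface_poly:
  fixes H :: "'a poly set set"
  assumes hyp: "\<And>H :: 'a set set. hypersurface (zariski cring_class_ops) H \<Longrightarrow> coaffine_divisor (reduced_divisor H)"
    and H: "hypersurface (zariski cring_class_ops) H"
  shows "coaffine_divisor (reduced_divisor H)"
proof -
  have weil: "weil_divisor (reduced_divisor H)" by (rule line.weil_divisor_reduced[OF H])
  obtain D :: "'a set \<Rightarrow> int" where D: "weil_divisor D" "(reduced_divisor H, pullback D) \<in> linear_equivalence"
    using linear_equivalent_pullback[OF weil] by blast
  have "linear_equivalence `` {reduced_divisor H} = linear_equivalence `` {pullback D}"
    by (rule equiv_class_eq[OF line.equiv_linear_equivalence D(2)])
  also have "\<dots> = pullback_class (linear_equivalence `` {D})" using pullback_class_eq[OF D(1)] by simp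
  finally show ?thesis
    unfolding coaffine_divisor_def
    using weil coaffine_class_pullback[OF coaffine_class_of_hypersurfaces[OF hyp D(1)]] by simp
qed

end

theorem mainTheorem10:
  assumes "noetherian_ring (cring_class_ops :: 'a::idom ring)"
    and "normal_domain TYPE('a)"
  shows "(\<forall>C :: ('a set \<Rightarrow> int) set. coaffine_class C \<longrightarrow> coaffine_class (pullback_class C)) \<and>
    ((\<forall>H :: 'a set set. hypersurface (zariski cring_class_ops) H \<longrightarrow>
        coaffine_divisor (reduced_divisor H)) \<longrightarrow>
     (\<forall>H :: 'a poly set set. hypersurface (zariski cring_class_ops) H \<longrightarrow>
        coaffine_divisor (reduced_divisor H)))"
proof -
  interpret noetherian_normal "TYPE('a)" using assms by (rule noetherian_normal.intro)
  show ?thesis using coaffine_class_pullback coaffine_hypersurface_poly by blast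
qed

end
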